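(* Let $\{X_i\}_{i\ge 1}$ be an i.i.d. sequence of real random variables such that the law of $X_1$ is nonlattice and $\mathbb{E}X_1<0$. Let $s_0>0$ be such that $\lambda(s)=\mathbb{E}[e^{sX_1}]<\infty$ for all $s\in D=[0,s_0)$, put $\Lambda=\log\lambda$, and suppose that $\alpha\in D$ (so $\alpha<s_0$) satisfies $\rho=\Lambda'(\alpha)>0$ and that $\lambda(\alpha+\xi)<\infty$ for some $\xi>0$. Let $\overline{\alpha}=\frac1\rho\Lambda^*(\rho)=\alpha-\frac{\Lambda(\alpha)}{\Lambda'(\alpha)}$. Let $\tau_u=\inf\{n: S_n>u\}$, where $S_n=X_1+\cdots+X_n$, and for $u>0$ let $k_u=u/\rho$ and $\Theta(u)=k_u-\lfloor k_u\rfloor$. Then there is a constant $C(\alpha)>0$ (not depending on $u$) such that $$\mathbb{P}\big[\tau_u=\lfloor k_u\rfloor\big]=C(\alpha)\,\lambda(\alpha)^{-\Theta(u)}\,\frac{e^{-u\overline{\alpha}}}{\sqrt{u}}\,(1+o(1))\qquad\text{as } u\to\infty .$$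
   Context: $S_0=0$ and $S_n=X_1+\cdots+X_n$ are the partial sums. $\lambda(s)=\mathbb{E}[e^{sX_1}]$ and $\Lambda(s)=\log\lambda(s)$ are the moment and cumulant generating functions of $X_1$; $\Lambda^*(x)=\sup_{s\in\mathbb{R}}\{sx-\Lambda(s)\}$ is the Fenchel–Legendre transform of $\Lambda$. "Nonlattice" means that there are no $a\in\mathbb{R}$, $h>0$ with $\mathbb{P}[X_1\in a+h\mathbb{Z}]=1$. The variable $u$ ranges over positive reals. The constant $C(\alpha)$ may depend on $\alpha$ and on the law of $X_1$. *)

theory Defs
  imports "HOL-Probability.Probability" "HOL-Library.Landau_Symbols"
begin

definition mgf :: "'a measure \<Rightarrow> ('a \<Rightarrow> real) \<Rightarrow> real \<Rightarrow> ennreal" where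
  "mgf M X s = (\<integral>\<^sup>+ \<omega>. ennreal (exp (s * X \<omega>)) \<partial>M)"

(* Extended-real valued, so that parameters s with infinite mgf do not contribute to the
   supremum in legendre_transform. On a probability space the mgf is positive, hence ln is
   never applied to 0. *)
definition cgf :: "'a measure \<Rightarrow> ('a \<Rightarrow> real) \<Rightarrow> real \<Rightarrow> ereal" where
  "cgf M X s = (if mgf M X s = \<infinity> then \<infinity> else ereal (ln (enn2real (mgf M X s))))"

definition legendre_transform :: "(real \<Rightarrow> ereal) \<Rightarrow> real \<Rightarrow> ereal" where
  "legendre_transform L x = (SUP s. ereal (s * x) - L s)"

definition nonlattice :: "real measure \<Rightarrow> bool" where
  "nonlattice N \<longleftrightarrow> \<not> (\<exists>a h. h > 0 \<and> measure N (range (\<lambda>k::int. a + h * of_int k)) = 1)"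

(* The sequence is indexed from 1: the value X 0 is never used. *)
definition partial_sum :: "(nat \<Rightarrow> 'a \<Rightarrow> real) \<Rightarrow> nat \<Rightarrow> 'a \<Rightarrow> real" where
  "partial_sum X n \<omega> = (\<Sum>i=1..n. X i \<omega>)"

(* The infimum of the empty set in enat is infinity. *)
definition first_passage :: "(nat \<Rightarrow> 'a \<Rightarrow> real) \<Rightarrow> real \<Rightarrow> 'a \<Rightarrow> enat" where
  "first_passage X u \<omega> = (INF n \<in> {n. partial_sum X n \<omega> > u}. enat n)"

end

theory Submission
  imports Defs "HOL-Real_Asymp.Real_Asymp"
begin

text \<open>
  Write P for the given law, lam = lam(alpha), n = floor(u / rho), and let Q be the law of a walk
  whose steps have the tilted distribution exp(alpha x) / lam * P[X_1 in dx].  Three ideas give the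
  theorem.

  Tilting and time reversal.  Under Q the steps have mean rho, so that level u is reached at about
  time n and the event costs no more than a factor 1 / sqrt n.  Changing the measure costs lam^n exp(- alpha u), and this
  is exp(- u alphabar) lam^(- Theta(u)) since n = u / rho - Theta(u).  What remains is the
  Q-expectation of exp(- alpha (S_n - u)) on the event that S_n > u and S_m \<le> u for all m < n.
  Reading the steps backwards turns the second condition into S_n - u \<le> S_j for 1 \<le> j \<le> n: the
  overshoot has to stay below the minimum of a walk with positive drift
  (\<open>prob_first_passage_eq\<close>).

  Local limit theorem.  The minimum is decided by the first few steps, while the overshoot is
  governed by S_n, whose density on bounded sets is asymptotically 1 / (sigma sqrt(2 pi n)),
  uniformly at bounded distance from n rho.  This is where the law must be nonlattice, and it is
  Stone's local limit theorem (\<open>stone_local_limit\<close>).  Keeping only the constraints with j \<le> k one gets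
  in the limit n \<rightarrow> infinity the constant (expectations are under Q)
  E[1 - exp(- alpha max(0, min(S_1, ..., S_k)))] / (alpha sigma sqrt(2 pi))
  for sqrt n times the expectation (\<open>prefix_limit\<close>).

  Removing the truncation.  Dropping the constraints with j > k creates an error that, after scaling
  by sqrt n, is at most a constant times the sum over j > k of (j + 1) rate^j, where
  rate = E[exp(- t S_1)] < 1 for a small t > 0 (\<open>prefix_error\<close>).  It tends to 0 as k \<rightarrow> infinity, uniformly
  in n and u.  The constants decrease in k; their limit is positive because a walk with positive drift
  has positive probability of staying above a positive level forever (\<open>walk_stays_above\<close>).  Since
  sqrt u / sqrt n tends to sqrt rho, the constant C is sqrt rho times that limit
  (\<open>staying_weight_limit\<close>).

  The formula for alphabar is the tangent inequality for the convex function Lambda at alpha, that is,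
  Jensen's inequality under Q.
\<close>

section \<open>Characteristic functions of nonlattice laws\<close>

lemma power_abs_le_one_plus_cube:
  fixes x :: real assumes "k \<le> 3" shows "\<bar>x\<bar> ^ k \<le> 1 + \<bar>x\<bar> ^ 3"
proof (cases "\<bar>x\<bar> \<le> 1")
  case True
  have "\<bar>x\<bar> ^ k \<le> 1" using True by (intro power_le_one) auto
  moreover have "0 \<le> \<bar>x\<bar> ^ 3" by simp
  ultimately show ?thesis by linarith
next
  case False
  have "\<bar>x\<bar> ^ k \<le> \<bar>x\<bar> ^ 3" using False assms by (intro power_increasing) auto
  then show ?thesis by linarith
qed

lemma (in real_distribution) integrable_moments_le_3:
  assumes "integrable M (\<lambda>x. \<bar>x\<bar> ^ 3)" "k \<le> 3"
  shows "integrable M (\<lambda>x. x ^ k)"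
proof (rule Bochner_Integration.integrable_bound[where f="\<lambda>x. 1 + \<bar>x\<bar> ^ 3"])
  show "integrable M (\<lambda>x. 1 + \<bar>x\<bar> ^ 3)" using assms by auto
  show "AE x in M. norm (x ^ k) \<le> norm (1 + \<bar>x\<bar> ^ 3)"
    using power_abs_le_one_plus_cube[OF assms(2)] by (auto simp: power_abs)
qed auto

lemma (in real_distribution) AE_lattice_imp_not_nonlattice:
  assumes "h > 0" "AE x in M. x \<in> range (\<lambda>k::int. a + h * of_int k)"
  shows "\<not> nonlattice M"
proof -
  have "countable (range (\<lambda>k::int. a + h * of_int k))" by auto
  then have "range (\<lambda>k::int. a + h * of_int k) \<in> sets M"
    by (rule sets.countable[rotated]) (simp add: events_eq_borel)
  then have "measure M (range (\<lambda>k::int. a + h * of_int k)) = 1"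
    using assms(2) by (intro prob_eq_1[THEN iffD2]) auto
  then show ?thesis using assms(1) unfolding nonlattice_def by blast
qed

text \<open>
  If the modulus is 1, say E[exp(i t X)] = exp(i a), then E[1 - cos(t X - a)] = 0.  The integrand is
  nonnegative, hence cos(t X - a) = 1 almost surely, which puts X on the lattice
  a / t + (2 pi / t) Z.
\<close>

lemma (in real_distribution) cmod_char_less_1:
  assumes "nonlattice M" "t \<noteq> 0"
  shows "cmod (char M t) < 1"
proof (rule ccontr)
  assume "\<not> ?thesis"
  then have "cmod (char M t) = 1" using cmod_char_le_1[of t] by simp
  then obtain a where a: "char M t = cis a"
    by (metis cis_Arg norm_eq_zero zero_neq_one sgn_div_norm divide_self_if inverse_1 scaleR_one)
  have int: "integrable M (\<lambda>x. iexp (t * x))" by (intro integrable_const_bound[of _ 1]) auto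
  have "1 = Re (cis (-a) * char M t)" by (simp add: a cis_mult)
  also have "cis (-a) * char M t = (CLINT x|M. cis (-a) * iexp (t * x))"
    unfolding char_def using int by simp
  also have "Re \<dots> = (LINT x|M. Re (cis (-a) * iexp (t * x)))"
    using int by (intro integral_Re[symmetric]) auto
  also have "\<dots> = (LINT x|M. cos (t * x - a))"
    by (intro Bochner_Integration.integral_cong refl)
       (simp only: cis_conv_exp[symmetric] cis_mult, simp)
  finally have E: "(LINT x|M. cos (t * x - a)) = 1" ..
  have ic: "integrable M (\<lambda>x. cos (t * x - a))"
    by (intro integrable_const_bound[of _ 1]) auto
  have "(LINT x|M. 1 - cos (t * x - a)) = 0"
    using E ic by (subst Bochner_Integration.integral_diff) (auto simp: prob_space[simplified])
  then have "AE x in M. 1 - cos (t * x - a) = 0"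
    using ic by (subst (asm) integral_nonneg_eq_0_iff_AE) auto
  then have "AE x in M. x \<in> range (\<lambda>k::int. a / t + (2 * pi / \<bar>t\<bar>) * of_int k)"
  proof eventually_elim
    case (elim x)
    then have "cos (t * x - a) = 1" by simp
    then obtain n :: int where n: "t * x - a = of_int n * (2 * pi)"
      unfolding cos_one_2pi_int by (auto simp: mult.assoc)
    show ?case
    proof (cases "t > 0")
      case True
      then have "x = a / t + (2 * pi / \<bar>t\<bar>) * of_int n" using n assms by (simp add: field_simps)
      then show ?thesis by blast
    next
      case False
      then have "x = a / t + (2 * pi / \<bar>t\<bar>) * of_int (-n)" using n assms by (simp add: field_simps)
      then show ?thesis by blast
    qed
  qed
  then have "\<not> nonlattice M"
    using assms(2) by (intro AE_lattice_imp_not_nonlattice[of "2 * pi / \<bar>t\<bar>" "a / t"]) auto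
  with assms show False by blast
qed

locale centered_nonlattice = real_distribution +
  fixes \<sigma> :: real
  assumes nonlattice: "nonlattice M"
    and third_moment: "integrable M (\<lambda>x. \<bar>x\<bar> ^ 3)"
    and mean_zero: "(LINT x|M. x) = 0"
    and sd_nonneg: "\<sigma> \<ge> 0"
    and variance_eq: "(LINT x|M. x\<^sup>2) = \<sigma>\<^sup>2"
begin

text \<open>
  A constant is a lattice variable, so that a nonlattice law is never degenerate.
\<close>

lemma sd_pos: "\<sigma> > 0"
proof (rule ccontr)
  assume "\<not> \<sigma> > 0"
  then have "\<sigma> = 0" using sd_nonneg by simp
  then have "AE x in M. x\<^sup>2 = 0"
    using integral_nonneg_eq_0_iff_AE[of M "\<lambda>x. x\<^sup>2"] variance_eq
      integrable_moments_le_3[OF third_moment, of 2] by simp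
  then have "AE x in M. x \<in> range (\<lambda>k::int. 0 + 1 * of_int k)"
    by eventually_elim (auto intro!: image_eqI[of _ _ 0])
  then have "\<not> nonlattice M"
    by (intro AE_lattice_imp_not_nonlattice[of 1 0]) auto
  with nonlattice show False by blast
qed

lemma char_second_order:
  "cmod (char M t - of_real (1 - \<sigma>\<^sup>2 * t\<^sup>2 / 2)) \<le> \<bar>t\<bar> ^ 3 / 6 * (LINT x|M. \<bar>x\<bar> ^ 3)"
proof -
  have "cmod (char M t - (1 - t^2 * \<sigma>\<^sup>2 / 2)) \<le>
      (t^2 / 6) * expectation (\<lambda>x. min (6 * x^2) (abs t * (abs x)^3))"
    using integrable_moments_le_3[OF third_moment, of 1]
      integrable_moments_le_3[OF third_moment, of 2] mean_zero variance_eq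
    by (intro char_approx3) (auto simp: )
  also have "\<dots> \<le> (t^2 / 6) * expectation (\<lambda>x. abs t * (abs x)^3)"
    using third_moment integrable_moments_le_3[OF third_moment, of 2]
    by (intro mult_left_mono integral_mono integrable_mult_right
        Bochner_Integration.integrable_bound[OF integrable_mult_right[OF third_moment, of "\<bar>t\<bar>"]]) auto
  also have "(t^2 / 6) * expectation (\<lambda>x. abs t * (abs x)^3) =
      \<bar>t\<bar> ^ 3 / 6 * (LINT x|M. \<bar>x\<bar> ^ 3)"
    by (simp add: power3_eq_cube power2_eq_square)
  finally show ?thesis by (simp add: mult.commute)
qed

text \<open>
  This single bound dominates the integrands in every Fourier argument below: evaluated at
  s / sqrt n its n-th power is at most exp(- c s^2), whatever n is.  Near 0 it comes from the second
  order expansion; away from 0 the modulus is bounded away from 1 by compactness, and a small enough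
  c makes exp(- c T^2) exceed that bound.
\<close>

lemma char_gaussian_bound:
  assumes "T > 0"
  shows "\<exists>c>0. \<forall>t. \<bar>t\<bar> \<le> T \<longrightarrow> cmod (char M t) \<le> exp (- c * t\<^sup>2)"
proof -
  define B where "B = (LINT x|M. \<bar>x\<bar> ^ 3)"
  have B: "B \<ge> 0" unfolding B_def by (intro integral_nonneg_AE) auto
  \<comment> \<open>The first bound makes the quadratic approximation nonnegative, the second one keeps the cubic
    remainder below half of the quadratic term; B + 1 avoids a division by 0.\<close>
  define e where "e = min (1 / \<sigma>) (3 * \<sigma>\<^sup>2 / (2 * (B + 1)))"
  have e: "e > 0" using sd_pos B by (simp add: e_def)
  have near: "cmod (char M t) \<le> exp (- (\<sigma>\<^sup>2 / 4) * t\<^sup>2)" if "\<bar>t\<bar> \<le> e" for t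
  proof -
    have "\<bar>t\<bar> \<le> 1 / \<sigma>" using that unfolding e_def by simp
    then have "\<bar>\<sigma> * t\<bar> \<le> 1" using sd_pos by (simp add: abs_mult field_simps)
    then have 1: "\<sigma>\<^sup>2 * t\<^sup>2 \<le> 1"
      by (metis abs_square_le_1 power_mult_distrib)
    have "\<bar>t\<bar> \<le> 3 * \<sigma>\<^sup>2 / (2 * (B + 1))" using that unfolding e_def by simp
    then have "\<bar>t\<bar> * (B + 1) \<le> 3 * \<sigma>\<^sup>2 / 2" using B by (simp add: field_simps)
    then have "\<bar>t\<bar> * B \<le> 3 * \<sigma>\<^sup>2 / 2" using B by (simp add: algebra_simps)
    then have "\<bar>t\<bar>\<^sup>2 * (\<bar>t\<bar> * B) \<le> \<bar>t\<bar>\<^sup>2 * (3 * \<sigma>\<^sup>2 / 2)" by (intro mult_left_mono) auto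
    then have 2: "\<bar>t\<bar> ^ 3 / 6 * B \<le> \<sigma>\<^sup>2 * t\<^sup>2 / 4"
      by (simp add: power3_eq_cube power2_eq_square algebra_simps)
    have "cmod (char M t) \<le> cmod (of_real (1 - \<sigma>\<^sup>2 * t\<^sup>2 / 2)) + cmod (char M t - of_real (1 - \<sigma>\<^sup>2 * t\<^sup>2 / 2))"
      by (rule norm_triangle_sub)
    also have "\<dots> \<le> (1 - \<sigma>\<^sup>2 * t\<^sup>2 / 2) + \<bar>t\<bar> ^ 3 / 6 * B"
      using char_second_order[of t] 1 unfolding B_def norm_of_real by (intro add_mono) auto
    also have "\<dots> \<le> 1 + (- (\<sigma>\<^sup>2 / 4) * t\<^sup>2)" using 2 by (simp add: algebra_simps)
    also have "\<dots> \<le> exp (- (\<sigma>\<^sup>2 / 4) * t\<^sup>2)" by (rule exp_ge_add_one_self)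
    finally show ?thesis .
  qed
  define K where "K = {t. e \<le> \<bar>t\<bar> \<and> \<bar>t\<bar> \<le> T}"
  have "\<exists>r<1. 0 < r \<and> (\<forall>t\<in>K. cmod (char M t) \<le> r)"
  proof (cases "K = {}")
    case True then show ?thesis by (intro exI[of _ "1/2"]) auto
  next
    case False
    have "closed K" unfolding K_def
      by (intro closed_Collect_conj closed_Collect_le continuous_intros)
    moreover have "bounded K" by (rule boundedI[of _ T]) (auto simp: K_def)
    ultimately have "compact K" by (simp add: compact_eq_bounded_closed)
    moreover have "continuous_on K (\<lambda>t. cmod (char M t))"
      by (intro continuous_at_imp_continuous_on ballI continuous_norm isCont_char)
    ultimately obtain t0 where t0: "t0 \<in> K" "\<And>t. t \<in> K \<Longrightarrow> cmod (char M t) \<le> cmod (char M t0)"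
      using continuous_attains_sup[OF _ False] by blast
    have "cmod (char M t0) < 1" using t0(1) e by (intro cmod_char_less_1 nonlattice) (auto simp: K_def)
    then show ?thesis using t0(2)
      by (intro exI[of _ "max (1/2) (cmod (char M t0))"]) (auto simp: max.coboundedI2)
  qed
  then obtain r where r: "r < 1" "0 < r" "\<And>t. t \<in> K \<Longrightarrow> cmod (char M t) \<le> r" by blast
  define c where "c = min (\<sigma>\<^sup>2 / 4) (- ln r / T\<^sup>2)"
  have "c > 0" using sd_pos r assms by (simp add: c_def divide_neg_pos)
  moreover have "cmod (char M t) \<le> exp (- c * t\<^sup>2)" if "\<bar>t\<bar> \<le> T" for t
  proof (cases "\<bar>t\<bar> \<le> e")
    case True
    have "c \<le> \<sigma>\<^sup>2 / 4" unfolding c_def by (rule min.cobounded1)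
    then have "c * t\<^sup>2 \<le> \<sigma>\<^sup>2 / 4 * t\<^sup>2" by (intro mult_right_mono) auto
    then show ?thesis using near[OF True] by (smt (verit) exp_le_cancel_iff mult_minus_left)
  next
    case False
    then have "cmod (char M t) \<le> r" using that by (intro r) (auto simp: K_def)
    also have "r = exp (ln r)" using r by simp
    also have "c * t\<^sup>2 \<le> (- ln r / T\<^sup>2) * T\<^sup>2"
      using r assms that \<open>c > 0\<close> by (intro mult_mono) (auto simp: c_def abs_le_square_iff[symmetric] divide_le_0_iff)
    then have "ln r \<le> - c * t\<^sup>2" using assms by simp
    then have "exp (ln r) \<le> exp (- c * t\<^sup>2)" by simp
    finally show ?thesis .
  qed
  ultimately show ?thesis by blast
qed

text \<open>
  The central limit theorem at the level of characteristic functions, along an arbitrary sequence of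
  sample sizes: compare the n-th powers of char (s / sqrt n) and of 1 - sigma^2 s^2 / (2 n), both of
  modulus at most 1, factor by factor.
\<close>

lemma char_power_tendsto:
  fixes N :: "nat \<Rightarrow> nat"
  assumes N: "filterlim N at_top sequentially"
  shows "(\<lambda>i. char M (s / sqrt (N i)) ^ N i) \<longlonglongrightarrow> exp (- (\<sigma>\<^sup>2 * s\<^sup>2 / 2))"
proof -
  define B where "B = (LINT x|M. \<bar>x\<bar> ^ 3)"
  define z where "z = - (\<sigma>\<^sup>2 * s\<^sup>2 / 2)"
  have "(\<lambda>n. char M (s / sqrt n) ^ n) \<longlonglongrightarrow> of_real (exp z)"
  proof (rule Lim_transform)
    show "(\<lambda>n. complex_of_real ((1 + z / n) ^ n)) \<longlonglongrightarrow> of_real (exp z)"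
      by (intro tendsto_of_real tendsto_exp_limit_sequentially)
    have "eventually (\<lambda>n. real n \<ge> - z / 2) sequentially"
      by real_asymp
    then have "eventually (\<lambda>n. cmod (char M (s / sqrt n) ^ n - complex_of_real ((1 + z / n) ^ n))
        \<le> (\<bar>s\<bar> ^ 3 / 6 * B) / sqrt n) sequentially"
      using eventually_gt_at_top[of 0]
    proof eventually_elim
      case (elim n)
      have "\<bar>1 + z / n\<bar> \<le> 1"
        using elim by (auto simp: abs_le_iff field_simps z_def)
      then have "cmod (char M (s / sqrt n) ^ n - complex_of_real (1 + z / n) ^ n)
          \<le> n * cmod (char M (s / sqrt n) - complex_of_real (1 + z / n))"
        by (intro norm_power_diff cmod_char_le_1) (auto simp del: of_real_add simp: norm_of_real)
      also have "\<dots> \<le> n * (\<bar>s / sqrt n\<bar> ^ 3 / 6 * B)"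
      proof -
        have "1 + z / n = 1 - \<sigma>\<^sup>2 * (s / sqrt n)\<^sup>2 / 2"
          by (simp add: z_def power_divide)
        then show ?thesis
          unfolding B_def by (intro mult_left_mono) (simp_all only: char_second_order of_nat_0_le_iff)
      qed
      also have "n * (\<bar>s / sqrt n\<bar> ^ 3 / 6 * B) = (\<bar>s\<bar> ^ 3 / 6 * B) / sqrt n * (real n / (sqrt n)\<^sup>2)"
        using elim by (simp add: power_divide abs_divide power3_eq_cube power2_eq_square)
      also have "real n / (sqrt n)\<^sup>2 = 1" using elim by simp
      finally show ?case by simp
    qed
    moreover have "(\<lambda>n. (\<bar>s\<bar> ^ 3 / 6 * B) / sqrt (real n)) \<longlonglongrightarrow> 0" by real_asymp
    ultimately show "(\<lambda>n. char M (s / sqrt n) ^ n - complex_of_real ((1 + z / n) ^ n)) \<longlonglongrightarrow> 0"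
      by (rule Lim_null_comparison)
  qed
  from filterlim_compose[OF this N] show ?thesis by (simp add: z_def exp_of_real)
qed

end

section \<open>The Fejer kernel\<close>

text \<open>
  The Fejer kernel is a probability density whose characteristic function, the triangle, has compact
  support.  Integrals of the kernel against a law therefore only see the characteristic function of
  that law on a bounded set, where it is under control.
\<close>

definition triangle :: "real \<Rightarrow> real \<Rightarrow> real" where
  "triangle \<delta> t = max 0 (1 - \<bar>t\<bar> / \<delta>)"

text \<open>
  The value at 0 is the continuous extension of the quotient.
\<close>

definition fejer :: "real \<Rightarrow> real \<Rightarrow> real" where
  "fejer \<delta> y = (if y = 0 then \<delta> / (2 * pi) else (1 - cos (\<delta> * y)) / (pi * \<delta> * y\<^sup>2))"

lemma triangle_measurable [measurable]: "triangle \<delta> \<in> borel_measurable borel"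
  unfolding triangle_def[abs_def] by measurable

lemma fejer_measurable [measurable]: "fejer \<delta> \<in> borel_measurable borel"
  unfolding fejer_def[abs_def] by measurable

lemma triangle_bounds:
  assumes "\<delta> > 0" shows "0 \<le> triangle \<delta> t" "triangle \<delta> t \<le> 1"
    "\<bar>t\<bar> > \<delta> \<Longrightarrow> triangle \<delta> t = 0"
  using assms by (auto simp: triangle_def max_def field_simps)

lemma fejer_nonneg: "\<delta> > 0 \<Longrightarrow> 0 \<le> fejer \<delta> y"
  by (auto simp: fejer_def)

lemma isCont_triangle: "\<delta> > 0 \<Longrightarrow> isCont (triangle \<delta>) t"
  unfolding triangle_def[abs_def] by (intro continuous_intros) auto

lemma isCont_fejer: assumes "y \<noteq> 0" "\<delta> > 0" shows "isCont (fejer \<delta>) y"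
proof -
  have "isCont (\<lambda>y. (1 - cos (\<delta> * y)) / (pi * \<delta> * y\<^sup>2)) y"
    using assms by (intro continuous_intros) auto
  moreover have "eventually (\<lambda>y. fejer \<delta> y = (1 - cos (\<delta> * y)) / (pi * \<delta> * y\<^sup>2)) (nhds y)"
    using t1_space_nhds[OF assms(1)] by eventually_elim (simp add: fejer_def)
  ultimately show ?thesis using isCont_cong[of "fejer \<delta>"] by simp
qed

lemma integrable_triangle_mult:
  fixes f :: "real \<Rightarrow> 'b::{banach,second_countable_topology}"
  assumes "\<delta> > 0" and [measurable]: "f \<in> borel_measurable borel" and "\<And>t. norm (f t) \<le> B"
  shows "integrable lborel (\<lambda>t. triangle \<delta> t *\<^sub>R f t)"
proof (rule Bochner_Integration.integrable_bound[where f="\<lambda>t. B * indicator {-\<delta>..\<delta>} t"])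
  show "integrable lborel (\<lambda>t. B * indicator {-\<delta>..\<delta>} t :: real)"
    using assms(1) by (intro integrable_mult_right) (auto simp: integrable_indicator_iff)
  have "B \<ge> 0" using assms(3)[of 0] norm_ge_zero order_trans by blast
  show "AE t in lborel. norm (triangle \<delta> t *\<^sub>R f t) \<le> norm (B * indicator {- \<delta>..\<delta>} t)"
  proof (rule AE_I2)
    fix t
    have "\<bar>triangle \<delta> t\<bar> * norm (f t) \<le> 1 * B" if "\<bar>t\<bar> \<le> \<delta>"
      using assms triangle_bounds[OF assms(1), of t] by (intro mult_mono) auto
    then show "norm (triangle \<delta> t *\<^sub>R f t) \<le> norm (B * indicator {- \<delta>..\<delta>} t)"
      using triangle_bounds(3)[OF assms(1), of t] \<open>B \<ge> 0\<close>
      by (cases "\<bar>t\<bar> \<le> \<delta>") (auto simp: indicator_def abs_le_iff)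
  qed
qed auto

text \<open>
  The half of the triangle on the positive axis is integrated by parts; the other half follows by
  reflection.
\<close>

lemma fejer_eq_integral_cos:
  assumes "\<delta> > 0"
  shows "(LINT t|lborel. triangle \<delta> t * cos (t * y)) = 2 * pi * fejer \<delta> y"
proof -
  define g where "g t = (1 - t / \<delta>) * cos (t * y)" for t
  have pos: "has_bochner_integral lborel (\<lambda>t. g t * indicator {0..\<delta>} t) (pi * fejer \<delta> y)"
  proof (cases "y = 0")
    case True
    have "has_bochner_integral lborel (\<lambda>t. g t * indicator {0..\<delta>} t)
        ((\<delta> - \<delta>\<^sup>2 / (2 * \<delta>)) - (0 - 0\<^sup>2 / (2 * \<delta>)))"
      using assms unfolding g_def True
      by (intro has_bochner_integral_FTC_Icc_real[where F="\<lambda>t. t - t\<^sup>2 / (2 * \<delta>)"])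
         (auto intro!: derivative_eq_intros continuous_intros simp: field_simps)
    moreover have "(\<delta> - \<delta>\<^sup>2 / (2 * \<delta>)) - (0 - 0\<^sup>2 / (2 * \<delta>)) = pi * fejer \<delta> y"
      using assms True by (simp add: fejer_def field_simps power2_eq_square)
    ultimately show ?thesis by simp
  next
    case False
    define F where "F t = (1 - t / \<delta>) * (sin (t * y) / y) - cos (t * y) / (\<delta> * y\<^sup>2)" for t
    have "has_bochner_integral lborel (\<lambda>t. g t * indicator {0..\<delta>} t) (F \<delta> - F 0)"
      using assms False unfolding g_def F_def
      by (intro has_bochner_integral_FTC_Icc_real)
         (auto intro!: derivative_eq_intros continuous_intros simp: field_simps power2_eq_square)
    moreover have "F \<delta> - F 0 = pi * fejer \<delta> y"
      using assms False by (simp add: fejer_def F_def field_simps power2_eq_square)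
    ultimately show ?thesis by simp
  qed
  have neg: "has_bochner_integral lborel (\<lambda>t. g (-t) * indicator {0..\<delta>} (-t)) (pi * fejer \<delta> y)"
    using pos lborel_has_bochner_integral_real_affine_iff[of "-1" "\<lambda>t. g t * indicator {0..\<delta>} t" "pi * fejer \<delta> y" 0]
    by simp
  have "has_bochner_integral lborel
      (\<lambda>t. g t * indicator {0..\<delta>} t + g (-t) * indicator {0..\<delta>} (-t)) (pi * fejer \<delta> y + pi * fejer \<delta> y)"
    by (rule has_bochner_integral_add[OF pos neg])
  then have "(LINT t|lborel. g t * indicator {0..\<delta>} t + g (-t) * indicator {0..\<delta>} (-t)) = 2 * pi * fejer \<delta> y"
    by (simp add: has_bochner_integral_iff)
  moreover have "(LINT t|lborel. triangle \<delta> t * cos (t * y)) =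
      (LINT t|lborel. g t * indicator {0..\<delta>} t + g (-t) * indicator {0..\<delta>} (-t))"
  proof (rule integral_cong_AE)
    have "AE t in lborel. t \<noteq> (0::real)" by (rule AE_lborel_singleton)
    then show "AE t in lborel. triangle \<delta> t * cos (t * y) =
        g t * indicator {0..\<delta>} t + g (-t) * indicator {0..\<delta>} (-t)"
      by eventually_elim
         (use assms in \<open>auto simp: triangle_def g_def indicator_def max_def field_simps split: if_splits\<close>)
  qed (auto simp: g_def)
  ultimately show ?thesis by simp
qed

lemma fejer_eq_integral_iexp:
  assumes "\<delta> > 0"
  shows "complex_of_real (fejer \<delta> y) = (CLINT t|lborel. triangle \<delta> t *\<^sub>R iexp (- (t * y))) / (2 * pi)"
proof -
  have int: "integrable lborel (\<lambda>t. triangle \<delta> t *\<^sub>R iexp (- (t * y)))"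
    using assms by (intro integrable_triangle_mult[where B=1]) auto
  let ?I = "CLINT t|lborel. triangle \<delta> t *\<^sub>R iexp (- (t * y))"
  have "Re ?I = (LINT t|lborel. triangle \<delta> t * cos (t * y))"
    using int by (subst integral_Re[symmetric]) (auto simp: Re_exp)
  moreover have "Im ?I = (LINT t|lborel. - triangle \<delta> t * sin (t * y))"
    using int by (subst integral_Im[symmetric]) (auto simp: Im_exp)
  moreover have "(LINT t|lborel. - triangle \<delta> t * sin (t * y)) = 0"
  proof -
    have "(LINT t|lborel. - triangle \<delta> t * sin (t * y)) = (LINT t|lborel. - triangle \<delta> (-t) * sin ((-t) * y))"
      using lborel_integral_real_affine[of "-1" "\<lambda>t. - triangle \<delta> t * sin (t * y)" 0] by simp
    also have "\<dots> = - (LINT t|lborel. - triangle \<delta> t * sin (t * y))"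
      by (simp add: triangle_def)
    finally show ?thesis by linarith
  qed
  ultimately have "?I = complex_of_real (2 * pi * fejer \<delta> y)"
    using fejer_eq_integral_cos[OF assms] by (simp add: complex_eq_iff)
  then show ?thesis by simp
qed

text \<open>
  Parseval's identity for the kernel: insert its Fourier representation and exchange the integrals.
\<close>

lemma (in real_distribution) integral_fejer_eq:
  assumes "\<delta> > 0"
  shows "(CLINT y|M. fejer \<delta> y *\<^sub>R iexp (\<theta> * y)) =
     (CLINT t|lborel. triangle \<delta> (\<theta> - t) *\<^sub>R char M t) / (2 * pi)"
proof -
  interpret P: pair_sigma_finite M lborel ..
  have "(CLINT y|M. fejer \<delta> y *\<^sub>R iexp (\<theta> * y)) =
      (CLINT y|M. (CLINT t|lborel. triangle \<delta> t *\<^sub>R iexp ((\<theta> - t) * y)) / (2 * pi))"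
  proof (rule Bochner_Integration.integral_cong[OF refl])
    fix y
    have "fejer \<delta> y *\<^sub>R iexp (\<theta> * y) = complex_of_real (fejer \<delta> y) * iexp (\<theta> * y)"
      by (simp add: scaleR_conv_of_real)
    also have "\<dots> = (CLINT t|lborel. triangle \<delta> t *\<^sub>R iexp (- (t * y))) * iexp (\<theta> * y) / (2 * pi)"
      by (subst fejer_eq_integral_iexp[OF assms]) simp
    also have "(CLINT t|lborel. triangle \<delta> t *\<^sub>R iexp (- (t * y))) * iexp (\<theta> * y) =
        (CLINT t|lborel. triangle \<delta> t *\<^sub>R iexp (- (t * y)) * iexp (\<theta> * y))"
      by (subst Bochner_Integration.integral_mult_left_zero) simp
    also have "\<dots> = (CLINT t|lborel. triangle \<delta> t *\<^sub>R iexp ((\<theta> - t) * y))"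
      by (intro Bochner_Integration.integral_cong refl) (simp add: exp_add[symmetric] algebra_simps)
    finally show "fejer \<delta> y *\<^sub>R iexp (\<theta> * y) =
       (CLINT t|lborel. triangle \<delta> t *\<^sub>R iexp ((\<theta> - t) * y)) / (2 * pi)" .
  qed
  also have "\<dots> = (CLINT y|M. (CLINT t|lborel. triangle \<delta> t *\<^sub>R iexp ((\<theta> - t) * y))) / (2 * pi)"
    by simp
  also have "(CLINT y|M. (CLINT t|lborel. triangle \<delta> t *\<^sub>R iexp ((\<theta> - t) * y))) =
      (CLINT t|lborel. (CLINT y|M. triangle \<delta> t *\<^sub>R iexp ((\<theta> - t) * y)))"
  proof (rule P.Fubini_integral[symmetric])
    show "integrable (M \<Otimes>\<^sub>M lborel) (\<lambda>(y, t). triangle \<delta> t *\<^sub>R iexp ((\<theta> - t) * y))"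
    proof (rule P.Fubini_integrable)
      have "integrable lborel (\<lambda>t. triangle \<delta> t *\<^sub>R (1::real))"
        using assms by (intro integrable_triangle_mult[where B=1]) auto
      then show "integrable M (\<lambda>x. LINT y|lborel. norm (case (x, y) of (y, t) \<Rightarrow> triangle \<delta> t *\<^sub>R iexp ((\<theta> - t) * y)))"
        by simp
      show "AE x in M. integrable lborel (\<lambda>y. case (x, y) of (y, t) \<Rightarrow> triangle \<delta> t *\<^sub>R iexp ((\<theta> - t) * y))"
        using assms by (auto intro!: AE_I2 integrable_triangle_mult[where B=1])
    qed measurable
  qed
  also have "\<dots> = (CLINT t|lborel. triangle \<delta> t *\<^sub>R char M (\<theta> - t))"
    by (simp add: char_def)
  also have "\<dots> = (CLINT t|lborel. triangle \<delta> (\<theta> - t) *\<^sub>R char M t)"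
    using lborel_integral_real_affine[of "-1" "\<lambda>t. triangle \<delta> t *\<^sub>R char M (\<theta> - t)" \<theta>] by simp
  finally show ?thesis .
qed

lemma gaussian_integral:
  fixes a :: real
  assumes "a > 0"
  shows "integrable lborel (\<lambda>s. exp (- a * s\<^sup>2))"
    and "(LINT s|lborel. exp (- a * s\<^sup>2)) = sqrt (pi / a)"
proof -
  have eq: "exp (- a * s\<^sup>2) = sqrt (pi / a) * normal_density 0 (1 / sqrt (2 * a)) s" for s
    using assms by (simp add: normal_density_def power_divide field_simps real_sqrt_divide real_sqrt_mult)
  show "integrable lborel (\<lambda>s. exp (- a * s\<^sup>2))"
    unfolding eq using assms by (intro integrable_mult_right integrable_normal_density) auto
  show "(LINT s|lborel. exp (- a * s\<^sup>2)) = sqrt (pi / a)"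
    unfolding eq using assms by (subst integral_mult_right_zero) (simp add: integral_normal_density)
qed

text \<open>
  The local limit theorem tested on exponentials times the kernel.  In Parseval's identity
  (\<open>integral_fejer_eq\<close>) substitute t = s / sqrt N; the factor sqrt N cancels, the triangle tends to its value at theta, the
  shift by the bounded x disappears, and the power of phi becomes a Gaussian whose integral is
  sqrt(2 pi) / sigma.  The conditions on phi are those established above for centered nonlattice
  laws, but they are stated for an arbitrary function so that the lemma also applies to the normal
  distribution, which yields the inversion formula for the kernel.
\<close>

lemma fejer_local_limit:
  fixes W :: "nat \<Rightarrow> real measure" and \<phi> :: "real \<Rightarrow> complex" and N :: "nat \<Rightarrow> nat" and x :: "nat \<Rightarrow> real"
  assumes W: "\<And>i. real_distribution (W i)"
    and char_W: "\<And>i t. char (W i) t = iexp (- (t * x i)) * \<phi> t ^ N i"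
    and [measurable]: "\<phi> \<in> borel_measurable borel"
    and bound: "\<And>T. T > 0 \<Longrightarrow> \<exists>c>0. \<forall>t. \<bar>t\<bar> \<le> T \<longrightarrow> cmod (\<phi> t) \<le> exp (- c * t\<^sup>2)"
    and lim: "\<And>s. (\<lambda>i. \<phi> (s / sqrt (N i)) ^ N i) \<longlonglongrightarrow> exp (- (\<sigma>\<^sup>2 * s\<^sup>2 / 2))"
    and N: "filterlim N at_top sequentially"
    and x: "\<And>i. \<bar>x i\<bar> \<le> B"
    and "\<sigma> > 0" "\<delta> > 0"
  shows "(\<lambda>i. sqrt (N i) *\<^sub>R (CLINT y|W i. fejer \<delta> y *\<^sub>R iexp (\<theta> * y)))
    \<longlonglongrightarrow> triangle \<delta> \<theta> / (\<sigma> * sqrt (2 * pi))"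
proof -
  \<comment> \<open>f is the integrand of Parseval's identity after the substitution t = s / sqrt N.\<close>
  define f where "f i s = triangle \<delta> (\<theta> - s / sqrt (N i)) *\<^sub>R (iexp (- (s / sqrt (N i) * x i)) * \<phi> (s / sqrt (N i)) ^ N i)" for i s
  define T where "T = \<bar>\<theta>\<bar> + \<delta>"
  have "T > 0" using assms by (simp add: T_def)
  from bound[OF this] obtain c where c: "c > 0" "\<And>t. \<bar>t\<bar> \<le> T \<Longrightarrow> cmod (\<phi> t) \<le> exp (- c * t\<^sup>2)" by blast
  have Npos: "eventually (\<lambda>i. N i > 0) sequentially"
    using N eventually_gt_at_top[of 0] unfolding filterlim_iff by blast
  have sqrtN: "filterlim (\<lambda>i. sqrt (N i)) at_top sequentially"
    by (intro filterlim_compose[OF sqrt_at_top] filterlim_compose[OF filterlim_real_sequentially] N)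
  have inv: "(\<lambda>i. s / sqrt (N i)) \<longlonglongrightarrow> 0" for s
    by (intro tendsto_divide_0[OF tendsto_const] filterlim_at_top_imp_at_infinity sqrtN)
  have dom: "cmod (f i s) \<le> exp (- c * s\<^sup>2)" if "N i > 0" for i s
  proof (cases "\<bar>s / sqrt (N i)\<bar> \<le> T")
    case True
    have "cmod (\<phi> (s / sqrt (N i)) ^ N i) \<le> exp (- c * (s / sqrt (N i))\<^sup>2) ^ N i"
      unfolding norm_power by (intro power_mono c True) auto
    also have "\<dots> = exp (- c * s\<^sup>2)"
      using that by (subst exp_of_nat_mult[symmetric]) (simp add: power_divide)
    finally have "cmod (\<phi> (s / sqrt (N i)) ^ N i) \<le> exp (- c * s\<^sup>2)" .
    moreover have "cmod (f i s) \<le> 1 * cmod (\<phi> (s / sqrt (N i)) ^ N i)"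
      unfolding f_def using triangle_bounds[OF \<open>\<delta> > 0\<close>]
      by (simp only: norm_scaleR norm_mult norm_exp_i_times) (auto intro!: mult_left_le_one_le)
    ultimately show ?thesis by linarith
  next
    case False
    then have "\<bar>\<theta> - s / sqrt (N i)\<bar> > \<delta>" unfolding T_def by linarith
    then show ?thesis using triangle_bounds(3)[OF \<open>\<delta> > 0\<close>] by (simp add: f_def)
  qed
  have "(\<lambda>i. CLINT s|lborel. f i s) \<longlonglongrightarrow> (CLINT s|lborel. triangle \<delta> \<theta> *\<^sub>R complex_of_real (exp (- (\<sigma>\<^sup>2 * s\<^sup>2 / 2))))"
  proof -
    have "\<exists>i0. \<forall>i\<ge>i0. N i > 0" using Npos by (simp add: eventually_sequentially)
    then obtain i0 where i0: "\<And>i. i \<ge> i0 \<Longrightarrow> N i > 0" by blast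
    have "(\<lambda>i. CLINT s|lborel. f (i + i0) s) \<longlonglongrightarrow> (CLINT s|lborel. triangle \<delta> \<theta> *\<^sub>R complex_of_real (exp (- (\<sigma>\<^sup>2 * s\<^sup>2 / 2))))"
    proof (rule integral_dominated_convergence[where w="\<lambda>s. exp (- c * s\<^sup>2)"])
      show "AE s in lborel. (\<lambda>i. f (i + i0) s) \<longlonglongrightarrow> triangle \<delta> \<theta> *\<^sub>R complex_of_real (exp (- (\<sigma>\<^sup>2 * s\<^sup>2 / 2)))"
      proof (rule AE_I2)
        fix s
        have 1: "(\<lambda>i. triangle \<delta> (\<theta> - s / sqrt (N i))) \<longlonglongrightarrow> triangle \<delta> (\<theta> - 0)"
          by (intro isCont_tendsto_compose[OF isCont_triangle[OF \<open>\<delta> > 0\<close>]] tendsto_intros inv)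
        have "(\<lambda>i. s / sqrt (N i) * x i) \<longlonglongrightarrow> 0"
          by (rule tendsto_0_le[where K=B, OF inv[of s]])
             (use x in \<open>auto intro!: always_eventually mult_left_mono divide_right_mono simp: abs_mult\<close>)
        then have 2: "(\<lambda>i. iexp (- (s / sqrt (N i) * x i))) \<longlonglongrightarrow> iexp (- 0)"
          by (intro tendsto_intros)
        have "(\<lambda>i. f i s) \<longlonglongrightarrow> triangle \<delta> (\<theta> - 0) *\<^sub>R (iexp (- 0) * exp (- (\<sigma>\<^sup>2 * s\<^sup>2 / 2)))"
          unfolding f_def by (intro tendsto_intros 1 2 lim)
        then show "(\<lambda>i. f (i + i0) s) \<longlonglongrightarrow> triangle \<delta> \<theta> *\<^sub>R complex_of_real (exp (- (\<sigma>\<^sup>2 * s\<^sup>2 / 2)))"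
          by (intro LIMSEQ_ignore_initial_segment) (simp add: exp_of_real)
      qed
      show "AE s in lborel. cmod (f (i + i0) s) \<le> exp (- c * s\<^sup>2)" for i
        using i0 dom by (intro AE_I2) auto
      show "integrable lborel (\<lambda>s. exp (- c * s\<^sup>2))" by (rule gaussian_integral(1)[OF c(1)])
    qed (auto simp: f_def)
    then show ?thesis by (rule LIMSEQ_offset)
  qed
  also have "(CLINT s|lborel. triangle \<delta> \<theta> *\<^sub>R complex_of_real (exp (- (\<sigma>\<^sup>2 * s\<^sup>2 / 2)))) =
      triangle \<delta> \<theta> *\<^sub>R complex_of_real (LINT s|lborel. exp (- (\<sigma>\<^sup>2 / 2) * s\<^sup>2))"
    by (simp only: integral_scaleR_right integral_complex_of_real) simp
  also have "(LINT s|lborel. exp (- (\<sigma>\<^sup>2 / 2) * s\<^sup>2)) = sqrt (2 * pi) / \<sigma>"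
    using \<open>\<sigma> > 0\<close> by (subst gaussian_integral(2)) (auto simp: real_sqrt_divide real_sqrt_mult)
  finally have lim1: "(\<lambda>i. (CLINT s|lborel. f i s) / (2 * pi)) \<longlonglongrightarrow>
      (triangle \<delta> \<theta> *\<^sub>R complex_of_real (sqrt (2 * pi) / \<sigma>)) / (2 * pi)"
    by (intro tendsto_intros) auto
  have "(triangle \<delta> \<theta> *\<^sub>R complex_of_real (sqrt (2 * pi) / \<sigma>)) / (2 * pi) =
      complex_of_real (triangle \<delta> \<theta> * ((sqrt (2 * pi) / \<sigma>) / (2 * pi)))"
    by (simp add: scaleR_conv_of_real)
  also have "(sqrt (2 * pi) / \<sigma>) / (2 * pi) = 1 / (\<sigma> * sqrt (2 * pi))"
    using \<open>\<sigma> > 0\<close> by (simp add: field_simps)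
  finally have "(triangle \<delta> \<theta> *\<^sub>R complex_of_real (sqrt (2 * pi) / \<sigma>)) / (2 * pi) =
      complex_of_real (triangle \<delta> \<theta> / (\<sigma> * sqrt (2 * pi)))"
    by simp
  with lim1 have lim2: "(\<lambda>i. (CLINT s|lborel. f i s) / (2 * pi)) \<longlonglongrightarrow> triangle \<delta> \<theta> / (\<sigma> * sqrt (2 * pi))"
    by simp
  have "eventually (\<lambda>i. (CLINT s|lborel. f i s) / (2 * pi) =
      sqrt (N i) *\<^sub>R (CLINT y|W i. fejer \<delta> y *\<^sub>R iexp (\<theta> * y))) sequentially"
    using Npos
  proof eventually_elim
    case (elim i)
    then have s: "sqrt (real (N i)) > 0" by simp
    have "(CLINT t|lborel. triangle \<delta> (\<theta> - t) *\<^sub>R char (W i) t) = (1 / sqrt (N i)) *\<^sub>R (CLINT s|lborel. f i s)"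
      using s lborel_integral_real_affine[of "1 / sqrt (N i)" "\<lambda>t. triangle \<delta> (\<theta> - t) *\<^sub>R char (W i) t" 0]
      by (simp add: f_def char_W)
    then show ?case using s
      by (subst real_distribution.integral_fejer_eq[OF W \<open>\<delta> > 0\<close>]) (simp add: scaleR_conv_of_real)
  qed
  from Lim_transform_eventually[OF lim2 this] show ?thesis .
qed

text \<open>
  For the normal law with variance n + 1 the scaled integral of the preceding limit theorem can also
  be written with the normal density, which after multiplication by sqrt(2 pi (n + 1)) is
  exp(- y^2 / (2 (n + 1))).  Comparing the two forms is Fourier inversion with Gaussian summation.
\<close>

lemma gaussian_smoothing_fejer:
  assumes "\<delta> > 0"
  shows "(\<lambda>n. LINT y|lborel. exp (- y\<^sup>2 / (2 * real (Suc n))) *\<^sub>R (fejer \<delta> y *\<^sub>R iexp (\<theta> * y)))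
           \<longlonglongrightarrow> complex_of_real (triangle \<delta> \<theta>)"
proof -
  interpret N: real_distribution std_normal_distribution by (rule real_dist_normal_dist)
  define W where "W n = distr std_normal_distribution borel (\<lambda>x. sqrt (Suc n) * x)" for n
  define \<phi> where "\<phi> t = complex_of_real (exp (- t\<^sup>2 / 2))" for t :: real
  have W: "real_distribution (W n)" for n unfolding W_def by (rule N.real_distribution_distr) auto
  have char_W: "char (W n) t = iexp (- (t * 0)) * \<phi> t ^ Suc n" for n t
  proof -
    have "char (W n) t = char std_normal_distribution (sqrt (Suc n) * t)"
      unfolding W_def char_def by (subst integral_distr) (auto simp: mult.assoc mult.commute mult.left_commute)
    also have "\<dots> = complex_of_real (exp (real (Suc n) * (- t\<^sup>2 / 2)))"
      by (simp only: char_std_normal_distribution power_mult_distrib) simp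
    also have "exp (real (Suc n) * (- t\<^sup>2 / 2)) = exp (- t\<^sup>2 / 2) ^ Suc n"
      by (rule exp_of_nat_mult)
    finally show ?thesis by (simp add: \<phi>_def)
  qed
  have "(\<lambda>n. sqrt (Suc n) *\<^sub>R (CLINT y|W n. fejer \<delta> y *\<^sub>R iexp (\<theta> * y)))
    \<longlonglongrightarrow> triangle \<delta> \<theta> / (1 * sqrt (2 * pi))"
  proof (rule fejer_local_limit[OF W char_W])
    show "\<phi> \<in> borel_measurable borel" unfolding \<phi>_def by measurable
    show "\<exists>c>0. \<forall>t. \<bar>t\<bar> \<le> T \<longrightarrow> cmod (\<phi> t) \<le> exp (- c * t\<^sup>2)" for T
      by (intro exI[of _ "1/2"]) (simp add: \<phi>_def)
    show "(\<lambda>i. \<phi> (s / sqrt (Suc i)) ^ Suc i) \<longlonglongrightarrow> exp (- (1\<^sup>2 * s\<^sup>2 / 2))" for s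
    proof -
      have "\<phi> (s / sqrt (Suc i)) ^ Suc i = exp (- (1\<^sup>2 * s\<^sup>2 / 2))" for i
      proof -
        have "\<phi> (s / sqrt (Suc i)) ^ Suc i = complex_of_real (exp (- (s / sqrt (Suc i))\<^sup>2 / 2) ^ Suc i)"
          unfolding \<phi>_def by (simp only: of_real_power)
        also have "exp (- (s / sqrt (Suc i))\<^sup>2 / 2) ^ Suc i = exp (real (Suc i) * (- (s / sqrt (Suc i))\<^sup>2 / 2))"
          by (rule exp_of_nat_mult[symmetric])
        also have "real (Suc i) * (- (s / sqrt (Suc i))\<^sup>2 / 2) = - (1\<^sup>2 * s\<^sup>2 / 2)"
          by (simp add: power_divide del: of_nat_Suc)
        finally show ?thesis by (simp add: exp_of_real)
      qed
      then show ?thesis by simp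
    qed
    show "filterlim Suc at_top sequentially" by (rule filterlim_Suc)
  qed (use assms in auto)
  then have "(\<lambda>n. complex_of_real (sqrt (2 * pi)) * (sqrt (Suc n) *\<^sub>R (CLINT y|W n. fejer \<delta> y *\<^sub>R iexp (\<theta> * y))))
    \<longlonglongrightarrow> complex_of_real (sqrt (2 * pi)) * (triangle \<delta> \<theta> / (1 * sqrt (2 * pi)))"
    by (intro tendsto_intros)
  moreover have "complex_of_real (sqrt (2 * pi)) * (triangle \<delta> \<theta> / (1 * sqrt (2 * pi))) = complex_of_real (triangle \<delta> \<theta>)"
    by (simp add: field_simps)
  moreover have "complex_of_real (sqrt (2 * pi)) * (sqrt (Suc n) *\<^sub>R (CLINT y|W n. fejer \<delta> y *\<^sub>R iexp (\<theta> * y)))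
      = (LINT y|lborel. exp (- y\<^sup>2 / (2 * real (Suc n))) *\<^sub>R (fejer \<delta> y *\<^sub>R iexp (\<theta> * y)))" for n
  proof -
    define r where "r = sqrt (Suc n)"
    have r: "r > 0" "r\<^sup>2 = Suc n" by (simp_all add: r_def)
    define h where "h y = fejer \<delta> y *\<^sub>R iexp (\<theta> * y)" for y
    have [measurable]: "h \<in> borel_measurable borel" unfolding h_def by measurable
    have "(CLINT y|W n. h y) = (LINT x|lborel. std_normal_density x *\<^sub>R h (r * x))"
      unfolding W_def r_def[symmetric] by (simp add: integral_distr integral_density)
    also have "\<dots> = (1 / r) *\<^sub>R (LINT y|lborel. std_normal_density (y / r) *\<^sub>R h y)"
      using r lborel_integral_real_affine[of "1 / r" "\<lambda>x. std_normal_density x *\<^sub>R h (r * x)" 0] by simp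
    also have "(LINT y|lborel. std_normal_density (y / r) *\<^sub>R h y) =
        (LINT y|lborel. (1 / sqrt (2 * pi)) *\<^sub>R (exp (- y\<^sup>2 / (2 * real (Suc n))) *\<^sub>R h y))"
    proof (intro Bochner_Integration.integral_cong refl)
      fix y :: real
      have "- (y / r)\<^sup>2 / 2 = - y\<^sup>2 / (2 * real (Suc n))"
        by (simp add: power_divide r(2) mult.commute del: of_nat_Suc)
      then show "std_normal_density (y / r) *\<^sub>R h y =
          (1 / sqrt (2 * pi)) *\<^sub>R (exp (- y\<^sup>2 / (2 * real (Suc n))) *\<^sub>R h y)"
        by (simp only: std_normal_density_def scaleR_scaleR)
    qed
    also have "\<dots> = (1 / sqrt (2 * pi)) *\<^sub>R (LINT y|lborel. exp (- y\<^sup>2 / (2 * real (Suc n))) *\<^sub>R h y)"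
      by (rule integral_scaleR_right)
    finally show ?thesis using r(1) unfolding h_def[symmetric] r_def[symmetric]
      by (simp add: scaleR_conv_of_real)
  qed
  ultimately show ?thesis by simp
qed

lemma fejer_le_at_0:
  assumes "\<delta> > 0"
  shows "fejer \<delta> y \<le> \<delta> / (2 * pi)"
proof -
  have int: "integrable lborel (\<lambda>t. triangle \<delta> t *\<^sub>R cos (t * z))" for z
    using assms by (intro integrable_triangle_mult[where B=1]) auto
  have "2 * pi * fejer \<delta> y = (LINT t|lborel. triangle \<delta> t * cos (t * y))"
    by (rule fejer_eq_integral_cos[OF assms, symmetric])
  also have "\<dots> \<le> (LINT t|lborel. triangle \<delta> t * cos (t * 0))"
    using int[of y] int[of 0] triangle_bounds[OF assms]
    by (intro integral_mono) (auto intro!: mult_left_le)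
  also have "\<dots> = 2 * pi * fejer \<delta> 0"
    by (rule fejer_eq_integral_cos[OF assms])
  finally have "fejer \<delta> y \<le> fejer \<delta> 0" by simp
  then show ?thesis by (simp add: fejer_def)
qed

text \<open>
  The Gaussian factors increase to 1, so monotone convergence in the case theta = 0 gives
  integrability and the total mass at once.
\<close>

lemma fejer_total_mass:
  assumes "\<delta> > 0"
  shows "integrable lborel (fejer \<delta>)" "(LINT y|lborel. fejer \<delta> y) = 1"
proof -
  define f where "f n y = exp (- y\<^sup>2 / (2 * real (Suc n))) * fejer \<delta> y" for n :: nat and y
  have "(\<lambda>n. LINT y|lborel. complex_of_real (f n y)) \<longlonglongrightarrow> 1"
    using gaussian_smoothing_fejer[OF assms, of 0] by (simp add: f_def triangle_def scaleR_conv_of_real)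
  then have lim: "(\<lambda>n. LINT y|lborel. f n y) \<longlonglongrightarrow> 1"
    unfolding integral_complex_of_real using tendsto_of_real_iff[of _ 1] by fastforce
  have int: "integrable lborel (f n)" for n
  proof (rule Bochner_Integration.integrable_bound)
    have "exp (- y\<^sup>2 / (2 * real (Suc n))) = sqrt (2 * pi * Suc n) * normal_density 0 (sqrt (Suc n)) y" for y
      by (simp add: normal_density_def del: of_nat_Suc)
    then show "integrable lborel (\<lambda>y. \<delta> / (2 * pi) * exp (- y\<^sup>2 / (2 * real (Suc n))))"
      by (simp del: of_nat_Suc add: integrable_normal_density)
    show "AE y in lborel. norm (f n y) \<le> norm (\<delta> / (2 * pi) * exp (- y\<^sup>2 / (2 * real (Suc n))))"
    proof (rule AE_I2)
      fix y
      have "exp (- y\<^sup>2 / (2 * real (Suc n))) * fejer \<delta> y \<le> exp (- y\<^sup>2 / (2 * real (Suc n))) * (\<delta> / (2 * pi))"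
        by (intro mult_left_mono fejer_le_at_0 assms) auto
      then show "norm (f n y) \<le> norm (\<delta> / (2 * pi) * exp (- y\<^sup>2 / (2 * real (Suc n))))"
        using fejer_nonneg[OF assms, of y] assms unfolding f_def
        by (simp add: abs_mult mult.commute del: of_nat_Suc)
    qed
  qed (auto simp: f_def[abs_def])
  have "has_bochner_integral lborel (fejer \<delta>) 1"
  proof (rule has_bochner_integral_monotone_convergence[OF int _ _ lim])
    show "AE y in lborel. mono (\<lambda>n. f n y)"
    proof (rule AE_I2, rule monoI)
      fix y :: real and m n :: nat assume "m \<le> n"
      then have "y\<^sup>2 / (2 * real (Suc n)) \<le> y\<^sup>2 / (2 * real (Suc m))" by (intro divide_left_mono) auto
      then show "f m y \<le> f n y" unfolding f_def
        using fejer_nonneg[OF assms, of y] by (intro mult_right_mono) (auto simp del: of_nat_Suc)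
    qed
    show "AE y in lborel. (\<lambda>n. f n y) \<longlonglongrightarrow> fejer \<delta> y"
    proof (rule AE_I2)
      fix y :: real
      have "(\<lambda>n. exp (- y\<^sup>2 / (2 * real (Suc n)))) \<longlonglongrightarrow> 1" by real_asymp
      then have "(\<lambda>n. f n y) \<longlonglongrightarrow> 1 * fejer \<delta> y" unfolding f_def by (intro tendsto_intros)
      then show "(\<lambda>n. f n y) \<longlonglongrightarrow> fejer \<delta> y" by simp
    qed
  qed auto
  then show "integrable lborel (fejer \<delta>)" "(LINT y|lborel. fejer \<delta> y) = 1"
    by (auto simp: has_bochner_integral_iff)
qed

definition fejer_distribution :: "real \<Rightarrow> real measure" where
  "fejer_distribution \<delta> = density lborel (fejer \<delta>)"

lemma real_distribution_density:
  fixes f :: "real \<Rightarrow> real"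
  assumes [measurable_cong]: "sets M = sets borel" and "integrable M f" "\<And>y. 0 \<le> f y" "(LINT y|M. f y) = 1"
  shows "real_distribution (density M f)"
proof -
  have "f \<in> borel_measurable M" using assms(2) by auto
  then have "emeasure (density M f) (space (density M f)) = 1"
    using assms by (subst emeasure_density) (auto simp: nn_integral_eq_integral)
  then have "prob_space (density M f)" by (rule prob_spaceI)
  then show ?thesis unfolding real_distribution_def real_distribution_axioms_def
    using assms(1) by (auto dest: sets_eq_imp_space_eq)
qed

lemma real_distribution_fejer: "\<delta> > 0 \<Longrightarrow> real_distribution (fejer_distribution \<delta>)"
  unfolding fejer_distribution_def
  by (intro real_distribution_density fejer_total_mass fejer_nonneg) auto

text \<open>
  With integrability at hand, the Gaussian factors can be removed for every theta by dominated
  convergence.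
\<close>

lemma char_fejer:
  assumes "\<delta> > 0"
  shows "char (fejer_distribution \<delta>) \<theta> = triangle \<delta> \<theta>"
proof -
  have "(\<lambda>n. LINT y|lborel. exp (- y\<^sup>2 / (2 * real (Suc n))) *\<^sub>R (fejer \<delta> y *\<^sub>R iexp (\<theta> * y)))
           \<longlonglongrightarrow> (LINT y|lborel. fejer \<delta> y *\<^sub>R iexp (\<theta> * y))"
  proof (rule integral_dominated_convergence[where w="fejer \<delta>"])
    show "AE y in lborel. (\<lambda>n. exp (- y\<^sup>2 / (2 * real (Suc n))) *\<^sub>R (fejer \<delta> y *\<^sub>R iexp (\<theta> * y)))
           \<longlonglongrightarrow> (fejer \<delta> y *\<^sub>R iexp (\<theta> * y))"
    proof (rule AE_I2)
      fix y :: real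
      have "(\<lambda>n. exp (- y\<^sup>2 / (2 * real (Suc n)))) \<longlonglongrightarrow> 1" by real_asymp
      then have "(\<lambda>n. exp (- y\<^sup>2 / (2 * real (Suc n))) *\<^sub>R (fejer \<delta> y *\<^sub>R iexp (\<theta> * y)))
           \<longlonglongrightarrow> 1 *\<^sub>R (fejer \<delta> y *\<^sub>R iexp (\<theta> * y))" by (intro tendsto_intros)
      then show "(\<lambda>n. exp (- y\<^sup>2 / (2 * real (Suc n))) *\<^sub>R (fejer \<delta> y *\<^sub>R iexp (\<theta> * y)))
           \<longlonglongrightarrow> (fejer \<delta> y *\<^sub>R iexp (\<theta> * y))" by simp
    qed
    show "AE y in lborel. norm (exp (- y\<^sup>2 / (2 * real (Suc n))) *\<^sub>R (fejer \<delta> y *\<^sub>R iexp (\<theta> * y))) \<le> fejer \<delta> y" for n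
      using fejer_nonneg[OF assms] by (auto intro!: AE_I2 mult_left_le_one_le simp del: of_nat_Suc)
  qed (use fejer_total_mass[OF assms] in auto)
  then have "(LINT y|lborel. fejer \<delta> y *\<^sub>R iexp (\<theta> * y)) = triangle \<delta> \<theta>"
    by (rule LIMSEQ_unique[OF _ gaussian_smoothing_fejer[OF assms]])
  then show ?thesis
    unfolding char_def fejer_distribution_def
    using fejer_nonneg[OF assms] by (subst integral_density) auto
qed

text \<open>
  In the integral representation |t y| \<le> 1 on the support of the triangle, so that
  cos(t y) \<ge> cos 1 there.
\<close>

lemma fejer_lower_bound:
  assumes "\<delta> > 0" "\<bar>\<delta> * y\<bar> \<le> 1"
  shows "\<delta> * cos 1 / (2 * pi) \<le> fejer \<delta> y"
proof -
  have int: "integrable lborel (\<lambda>t. triangle \<delta> t *\<^sub>R cos (t * z))" for z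
    using assms by (intro integrable_triangle_mult[where B=1]) auto
  have "cos 1 * (2 * pi * fejer \<delta> 0) = cos 1 * (LINT t|lborel. triangle \<delta> t * cos (t * 0))"
    by (simp only: fejer_eq_integral_cos[OF assms(1)])
  also have "\<dots> = (LINT t|lborel. triangle \<delta> t * cos 1)" by simp
  also have "\<dots> \<le> (LINT t|lborel. triangle \<delta> t * cos (t * y))"
  proof (rule integral_mono)
    show "integrable lborel (\<lambda>t. triangle \<delta> t * cos 1)"
      using integrable_mult_left[OF int[of 0], of "cos 1"] by simp
    show "integrable lborel (\<lambda>t. triangle \<delta> t * cos (t * y))" using int by simp
    fix t
    show "triangle \<delta> t * cos 1 \<le> triangle \<delta> t * cos (t * y)"
    proof (cases "\<bar>t\<bar> \<le> \<delta>")
      case True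
      have "\<bar>t * y\<bar> \<le> \<bar>\<delta> * y\<bar>" using True by (auto simp: abs_mult intro!: mult_right_mono)
      then have "\<bar>t * y\<bar> \<le> 1" using assms by simp
      then have "cos 1 \<le> cos \<bar>t * y\<bar>" using pi_gt3 by (intro cos_monotone_0_pi_le) auto
      then show ?thesis using triangle_bounds[OF assms(1)] by (intro mult_left_mono) auto
    next
      case False then show ?thesis using triangle_bounds[OF assms(1)] by simp
    qed
  qed
  also have "\<dots> = 2 * pi * fejer \<delta> y" by (rule fejer_eq_integral_cos[OF assms(1)])
  finally show ?thesis by (simp add: fejer_def field_simps)
qed

section \<open>Concentration and Stone's local limit theorem\<close>

text \<open>
  On the unit interval the kernel is bounded below, hence the probability is at most a constant times
  the integral of the kernel, which Parseval's identity bounds by the integral of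
  exp(- c n t^2).  Only moduli of characteristic functions enter; therefore the bound is uniform over
  all translates.
\<close>

lemma concentration_bound:
  fixes \<phi> :: "real \<Rightarrow> complex"
  assumes "c > 0" and bound: "\<And>t. \<bar>t\<bar> \<le> 1 \<Longrightarrow> cmod (\<phi> t) \<le> exp (- c * t\<^sup>2)"
  shows "\<exists>K>0. \<forall>n\<ge>1. \<forall>W. real_distribution W \<longrightarrow> (\<forall>t. cmod (char W t) = cmod (\<phi> t) ^ n) \<longrightarrow>
           measure W {0..1} \<le> K / sqrt (real n)"
proof -
  have gauss: "integrable lborel (\<lambda>s. exp (- c * n * s\<^sup>2))"
     "(LINT s|lborel. exp (- c * n * s\<^sup>2)) = sqrt (pi / c) / sqrt n" if "n \<ge> 1" for n :: nat
    using gaussian_integral[of "c * n"] that assms by (simp_all add: real_sqrt_divide real_sqrt_mult)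
  define K where "K = sqrt (pi / c) / cos 1"
  have "cos 1 > (0::real)" by (rule cos_gt_zero) (use pi_gt3 in auto)
  then have "K > 0" using assms by (simp add: K_def)
  moreover have "measure W {0..1} \<le> K / sqrt (real n)"
    if n: "n \<ge> 1" and W: "real_distribution W" and cW: "\<And>t. cmod (char W t) = cmod (\<phi> t) ^ n" for n W
  proof -
    interpret W: real_distribution W by fact
    have fi: "integrable W (fejer 1)"
    proof (rule W.integrable_const_bound[of _ "1 / (2 * pi)"])
      show "AE y in W. norm (fejer 1 y) \<le> 1 / (2 * pi)"
        using fejer_nonneg[of 1] fejer_le_at_0[of 1] by auto
    qed auto
    have "(cos 1 / (2 * pi)) * measure W {0..1} = (LINT y|W. (cos 1 / (2 * pi)) * indicator {0..1} y)"
      by simp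
    also have "\<dots> \<le> (LINT y|W. fejer 1 y)"
    proof (rule integral_mono)
      show "(cos 1 / (2 * pi)) * indicator {0..1} y \<le> fejer 1 y" for y
        using fejer_lower_bound[of 1 y] fejer_nonneg[of 1 y] by (auto simp: indicator_def)
      show "integrable W (\<lambda>y. (cos 1 / (2 * pi)) * indicator {0..1} y)"
        by (intro integrable_mult_right integrable_real_indicator) (auto simp: less_top[symmetric])
    qed (use fi in auto)
    also have "\<dots> \<le> cmod (CLINT y|W. fejer 1 y *\<^sub>R iexp (0 * y))"
      by (simp add: scaleR_conv_of_real)
    also have "\<dots> = cmod (CLINT t|lborel. triangle 1 (0 - t) *\<^sub>R char W t) / (2 * pi)"
      by (subst W.integral_fejer_eq) (auto simp: norm_divide)
    also have "cmod (CLINT t|lborel. triangle 1 (0 - t) *\<^sub>R char W t) \<le>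
        (LINT t|lborel. exp (- c * n * t\<^sup>2))"
    proof (rule Bochner_Integration.integral_norm_bound_integral)
      have "integrable lborel (\<lambda>t. triangle 1 t *\<^sub>R char W t)"
        by (intro integrable_triangle_mult[where B=1] W.cmod_char_le_1) auto
      then show "integrable lborel (\<lambda>t. triangle 1 (0 - t) *\<^sub>R char W t)"
        by (simp add: triangle_def)
      show "integrable lborel (\<lambda>t. exp (- c * n * t\<^sup>2))" by (rule gauss[OF n])
      fix t :: real
      show "cmod (triangle 1 (0 - t) *\<^sub>R char W t) \<le> exp (- c * n * t\<^sup>2)"
      proof (cases "\<bar>t\<bar> \<le> 1")
        case True
        have "cmod (triangle 1 (0 - t) *\<^sub>R char W t) \<le> 1 * exp (- c * t\<^sup>2) ^ n"
          using triangle_bounds[of 1 "0 - t"] True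
          by (auto simp only: norm_scaleR cW abs_of_nonneg zero_less_one intro!: mult_mono power_mono bound) auto
        also have "\<dots> = exp (- c * n * t\<^sup>2)" by (simp add: exp_of_nat_mult[symmetric])
        finally show ?thesis .
      next
        case False then show ?thesis using triangle_bounds(3)[of 1 "0 - t"] by simp
      qed
    qed
    also have "\<dots> = sqrt (pi / c) / sqrt n" by (rule gauss[OF n])
    finally have "(cos 1 / (2 * pi)) * measure W {0..1} \<le> (sqrt (pi / c) / sqrt n) / (2 * pi)"
      by (simp add: divide_right_mono)
    then have "cos 1 * measure W {0..1} \<le> sqrt (pi / c) / sqrt n" by (simp add: field_simps)
    then show ?thesis using \<open>cos 1 > 0\<close> n by (simp add: K_def field_simps)
  qed
  ultimately show ?thesis by blast
qed

text \<open>
  Reweight W by the Fejer kernel and normalize.  By the limit on exponentials the characteristic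
  functions of the reweighted laws converge to the triangle, so these laws converge weakly to the
  Fejer distribution by Levy's continuity theorem.  Testing this against g / fejer, which is bounded
  and almost everywhere continuous if the kernel is chosen wide enough to be positive on the support
  of g, gives the claim for g.
\<close>

lemma stone_local_limit:
  fixes W :: "nat \<Rightarrow> real measure" and \<phi> :: "real \<Rightarrow> complex" and N :: "nat \<Rightarrow> nat" and x :: "nat \<Rightarrow> real"
    and g :: "real \<Rightarrow> real"
  assumes W: "\<And>i. real_distribution (W i)"
    and char_W: "\<And>i t. char (W i) t = iexp (- (t * x i)) * \<phi> t ^ N i"
    and [measurable]: "\<phi> \<in> borel_measurable borel"
    and bound: "\<And>T. T > 0 \<Longrightarrow> \<exists>c>0. \<forall>t. \<bar>t\<bar> \<le> T \<longrightarrow> cmod (\<phi> t) \<le> exp (- c * t\<^sup>2)"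
    and lim: "\<And>s. (\<lambda>i. \<phi> (s / sqrt (N i)) ^ N i) \<longlonglongrightarrow> exp (- (\<sigma>\<^sup>2 * s\<^sup>2 / 2))"
    and N: "filterlim N at_top sequentially"
    and x: "\<And>i. \<bar>x i\<bar> \<le> B"
    and "\<sigma> > 0"
    and g_meas[measurable]: "g \<in> borel_measurable borel"
    and g_bound: "\<And>y. \<bar>g y\<bar> \<le> G"
    and g_support: "\<And>y. \<bar>y\<bar> > m \<Longrightarrow> g y = 0"
    and g_cont: "finite D" "\<And>y. y \<notin> D \<Longrightarrow> isCont g y"
  shows "(\<lambda>i. sqrt (N i) * (LINT y|W i. g y)) \<longlonglongrightarrow> (LINT y|lborel. g y) / (\<sigma> * sqrt (2 * pi))"
proof -
  \<comment> \<open>With this width the lower bound for the kernel applies on the whole support of g.\<close>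
  define \<delta> where "\<delta> = 1 / (\<bar>m\<bar> + 1)"
  have \<delta>: "\<delta> > 0" by (simp add: \<delta>_def)
  define \<kappa> where "\<kappa> = \<delta> * cos 1 / (2 * pi)"
  have "cos 1 > (0::real)" by (rule cos_gt_zero) (use pi_gt3 in auto)
  then have \<kappa>: "\<kappa> > 0" using \<delta> by (simp add: \<kappa>_def)
  have low: "\<kappa> \<le> fejer \<delta> y" if "\<bar>y\<bar> \<le> \<bar>m\<bar> + 1" for y
  proof -
    have "\<delta> * \<bar>y\<bar> \<le> \<delta> * (\<bar>m\<bar> + 1)" using that \<delta> by (intro mult_left_mono) auto
    also have "\<dots> = 1" by (simp add: \<delta>_def)
    finally show ?thesis unfolding \<kappa>_def using \<delta> by (intro fejer_lower_bound) (auto simp: abs_mult)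
  qed
  define k where "k y = g y / fejer \<delta> y" for y
  have [measurable]: "k \<in> borel_measurable borel" unfolding k_def by measurable
  have gk: "g y = fejer \<delta> y * k y" for y
  proof (cases "\<bar>y\<bar> > m")
    case True then show ?thesis by (simp add: k_def g_support)
  next
    case False then show ?thesis using low[of y] \<kappa> by (simp add: k_def)
  qed
  have G: "G \<ge> 0" using g_bound[of 0] by linarith
  have k_bound: "norm (k y) \<le> G / \<kappa>" for y
  proof (cases "\<bar>y\<bar> > m")
    case True then show ?thesis using G \<kappa> by (simp add: k_def g_support)
  next
    case False
    then show ?thesis using low[of y] \<kappa> G g_bound[of y] by (auto simp: k_def abs_divide intro!: frac_le)
  qed
  have k_cont: "isCont k y" if "y \<notin> insert 0 D" for y
  proof (cases "\<bar>y\<bar> > \<bar>m\<bar>")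
    case True
    have "open {y::real. \<bar>m\<bar> < \<bar>y\<bar>}" by (intro open_Collect_less continuous_intros)
    then have "eventually (\<lambda>y. y \<in> {y. \<bar>m\<bar> < \<bar>y\<bar>}) (nhds y)"
      using True by (intro eventually_nhds_in_open) auto
    then have "eventually (\<lambda>y. k y = 0) (nhds y)"
      by eventually_elim (auto simp: k_def g_support)
    then have "isCont k y = isCont (\<lambda>_. 0 :: real) y" by (rule isCont_cong)
    then show ?thesis by simp
  next
    case False
    then have "fejer \<delta> y \<noteq> 0" using low[of y] \<kappa> by simp
    then show ?thesis unfolding k_def using that \<delta>
      by (intro continuous_intros g_cont isCont_fejer) auto
  qed
  have fL: "(\<lambda>i. sqrt (N i) *\<^sub>R (CLINT y|W i. fejer \<delta> y *\<^sub>R iexp (\<theta> * y)))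
      \<longlonglongrightarrow> triangle \<delta> \<theta> / (\<sigma> * sqrt (2 * pi))" for \<theta>
    by (rule fejer_local_limit[OF W char_W _ bound lim N x \<open>\<sigma> > 0\<close> \<delta>]) auto
  define a where "a i = (LINT y|W i. fejer \<delta> y)" for i
  have aL: "(\<lambda>i. sqrt (N i) * a i) \<longlonglongrightarrow> 1 / (\<sigma> * sqrt (2 * pi))"
  proof -
    have "(\<lambda>i. complex_of_real (sqrt (N i) * a i)) \<longlonglongrightarrow> complex_of_real (1 / (\<sigma> * sqrt (2 * pi)))"
      using fL[of 0] by (simp add: a_def scaleR_conv_of_real triangle_def)
    then show ?thesis unfolding tendsto_of_real_iff .
  qed
  have lim_pos: "1 / (\<sigma> * sqrt (2 * pi)) > 0" using \<open>\<sigma> > 0\<close> by simp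
  have a_nonneg: "a i \<ge> 0" for i unfolding a_def using fejer_nonneg[OF \<delta>] by (intro integral_nonneg_AE) auto
  have a_pos: "eventually (\<lambda>i. a i > 0) sequentially"
    using order_tendstoD(1)[OF aL lim_pos]
  proof eventually_elim
    case (elim i) then show ?case using a_nonneg[of i] by (cases "a i = 0") auto
  qed
  \<comment> \<open>Normalization is possible for all large i only; the default makes every V i a law.\<close>
  define V where "V i = (if a i > 0 then density (W i) (\<lambda>y. fejer \<delta> y / a i) else fejer_distribution \<delta>)" for i
  have fi: "integrable (W i) (fejer \<delta>)" if "a i > 0" for i
    using that not_integrable_integral_eq unfolding a_def by fastforce
  have sW[measurable_cong, simp]: "sets (W i) = sets borel" for i
    using W[of i] by (simp add: real_distribution.events_eq_borel)
  have V: "real_distribution (V i)" for i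
  proof (cases "a i > 0")
    case True
    then show ?thesis unfolding V_def using fi[OF True] fejer_nonneg[OF \<delta>]
      by (auto intro!: real_distribution_density simp: a_def[symmetric])
  next
    case False then show ?thesis by (simp add: V_def real_distribution_fejer \<delta>)
  qed
  have intV: "(LINT y|V i. h y) = (LINT y|W i. fejer \<delta> y *\<^sub>R h y) /\<^sub>R a i"
    if "a i > 0" and [measurable]: "h \<in> borel_measurable borel"
    for i and h :: "real \<Rightarrow> 'b::{banach, second_countable_topology}"
  proof -
    have "(LINT y|V i. h y) = (LINT y|W i. (fejer \<delta> y / a i) *\<^sub>R h y)"
      unfolding V_def using that fejer_nonneg[OF \<delta>] by (simp add: integral_density)
    also have "\<dots> = (LINT y|W i. (1 / a i) *\<^sub>R (fejer \<delta> y *\<^sub>R h y))" by simp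
    also have "\<dots> = (1 / a i) *\<^sub>R (LINT y|W i. fejer \<delta> y *\<^sub>R h y)" by (rule integral_scaleR_right)
    finally show ?thesis by (simp add: inverse_eq_divide)
  qed
  have "weak_conv_m V (fejer_distribution \<delta>)"
  proof (rule levy_continuity[OF V real_distribution_fejer[OF \<delta>]])
    fix \<theta>
    have "(\<lambda>i. (sqrt (N i) *\<^sub>R (CLINT y|W i. fejer \<delta> y *\<^sub>R iexp (\<theta> * y))) /\<^sub>R (sqrt (N i) * a i))
      \<longlonglongrightarrow> complex_of_real (triangle \<delta> \<theta> / (\<sigma> * sqrt (2 * pi))) /\<^sub>R (1 / (\<sigma> * sqrt (2 * pi)))"
      using lim_pos by (intro tendsto_intros fL aL) auto
    moreover have "complex_of_real (triangle \<delta> \<theta> / (\<sigma> * sqrt (2 * pi))) /\<^sub>R (1 / (\<sigma> * sqrt (2 * pi))) = char (fejer_distribution \<delta>) \<theta>"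
      using lim_pos \<open>\<sigma> > 0\<close> by (simp add: char_fejer[OF \<delta>] scaleR_conv_of_real field_simps)
    moreover have "eventually (\<lambda>i. (sqrt (N i) *\<^sub>R (CLINT y|W i. fejer \<delta> y *\<^sub>R iexp (\<theta> * y))) /\<^sub>R (sqrt (N i) * a i) = char (V i) \<theta>) sequentially"
      using a_pos order_tendstoD(1)[OF aL lim_pos]
    proof eventually_elim
      case (elim i)
      then have "N i \<noteq> 0" by (intro notI) simp
      then show ?case unfolding char_def using elim(1)
        by (subst intV) (auto simp: field_simps)
    qed
    ultimately show "(\<lambda>i. char (V i) \<theta>) \<longlonglongrightarrow> char (fejer_distribution \<delta>) \<theta>"
      using Lim_transform_eventually by force
  qed
  moreover have "emeasure (fejer_distribution \<delta>) {y. \<not> isCont k y} = 0"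
  proof -
    have fin: "finite {y. \<not> isCont k y}"
      by (rule finite_subset[of _ "insert 0 D"]) (use k_cont g_cont in auto)
    have "AE y in lborel. y \<notin> {y. \<not> isCont k y}"
      by (intro AE_I'[OF finite_imp_null_set_lborel[OF fin]]) auto
    then have ae: "AE y in lborel. ennreal (fejer \<delta> y) * indicator {y. \<not> isCont k y} y = 0"
      by eventually_elim (simp add: indicator_def)
    have "emeasure (fejer_distribution \<delta>) {y. \<not> isCont k y} =
        (\<integral>\<^sup>+ y. ennreal (fejer \<delta> y) * indicator {y. \<not> isCont k y} y \<partial>lborel)"
      unfolding fejer_distribution_def using finite_imp_closed[OF fin]
      by (subst emeasure_density) auto
    also have "\<dots> = (\<integral>\<^sup>+ (y::real). 0 \<partial>lborel)" by (rule nn_integral_cong_AE[OF ae])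
    finally show ?thesis by simp
  qed
  ultimately have kL: "(\<lambda>i. LINT y|V i. k y) \<longlonglongrightarrow> (LINT y|fejer_distribution \<delta>. k y)"
    by (intro weak_conv_imp_bdd_ae_continuous_conv[OF V real_distribution_fejer[OF \<delta>] _ _ k_bound]) auto
  have "(LINT y|fejer_distribution \<delta>. k y) = (LINT y|lborel. g y)"
    unfolding fejer_distribution_def using fejer_nonneg[OF \<delta>]
    by (subst integral_density) (auto simp: gk[symmetric])
  with kL have "(\<lambda>i. (sqrt (N i) * a i) * (LINT y|V i. k y)) \<longlonglongrightarrow> (1 / (\<sigma> * sqrt (2 * pi))) * (LINT y|lborel. g y)"
    by (intro tendsto_intros aL) auto
  moreover have "eventually (\<lambda>i. (sqrt (N i) * a i) * (LINT y|V i. k y) = sqrt (N i) * (LINT y|W i. g y)) sequentially"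
    using a_pos
  proof eventually_elim
    case (elim i)
    have "(LINT y|V i. k y) = (LINT y|W i. g y) /\<^sub>R a i"
      using elim by (subst intV) (simp_all add: gk[symmetric])
    then show ?case using elim by simp
  qed
  ultimately show ?thesis using Lim_transform_eventually by fastforce
qed

section \<open>Random walks on sequence space\<close>

text \<open>
  A walk is a function of a sequence of steps, and its law is studied on the product space of
  infinitely many copies of the step distribution.  There the Markov property is the invariance of
  the product measure under splicing two independent sequences at a fixed time.
\<close>

definition walk :: "nat \<Rightarrow> (nat \<Rightarrow> real) \<Rightarrow> real" where
  "walk n \<omega> = (\<Sum>i<n. \<omega> i)"

lemma walk_0 [simp]: "walk 0 \<omega> = 0" by (simp add: walk_def)

lemma walk_comb_seq_le: "j \<le> k \<Longrightarrow> walk j (comb_seq k \<omega> \<omega>') = walk j \<omega>"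
  unfolding walk_def by (intro sum.cong) (auto simp: comb_seq_less)

lemma walk_comb_seq_add: "walk (k + j) (comb_seq k \<omega> \<omega>') = walk k \<omega> + walk j \<omega>'"
proof (induction j)
  case 0 then show ?case by (simp add: walk_comb_seq_le)
next
  case (Suc j)
  then show ?case using comb_seq_add[of k \<omega> \<omega>' j] by (simp add: walk_def add.commute add.left_commute)
qed

lemma walk_measurable [measurable]:
  assumes [measurable_cong]: "sets \<nu> = sets borel"
  shows "walk n \<in> borel_measurable (PiM UNIV (\<lambda>_. \<nu>))"
  unfolding walk_def[abs_def] by measurable

locale iid_sequence = sequence_space \<nu> + nu: real_distribution \<nu> for \<nu> :: "real measure"
begin

lemma walk_measurable' [measurable]: "walk n \<in> borel_measurable S"
  by (rule walk_measurable) simp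

text \<open>
  The Markov property at time k: the steps after time k may be replaced by a fresh copy.
\<close>

lemma nn_integral_comb_seq:
  assumes [measurable]: "f \<in> borel_measurable S"
  shows "(\<integral>\<^sup>+\<omega>. f \<omega> \<partial>S) = (\<integral>\<^sup>+\<omega>. (\<integral>\<^sup>+\<omega>'. f (comb_seq k \<omega> \<omega>') \<partial>S) \<partial>S)"
proof -
  have "(\<integral>\<^sup>+\<omega>. f \<omega> \<partial>S) = (\<integral>\<^sup>+p. f (case p of (\<omega>, \<omega>') \<Rightarrow> comb_seq k \<omega> \<omega>') \<partial>(S \<Otimes>\<^sub>M S))"
    by (subst PiM_comb_seq[of k, symmetric], subst nn_integral_distr[OF measurable_comb_seq]) auto
  also have "\<dots> = (\<integral>\<^sup>+\<omega>. (\<integral>\<^sup>+\<omega>'. f (comb_seq k \<omega> \<omega>') \<partial>S) \<partial>S)"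
    by (subst P.nn_integral_fst[symmetric]) auto
  finally show ?thesis .
qed

lemma integral_comb_seq:
  fixes f :: "(nat \<Rightarrow> real) \<Rightarrow> 'b::{banach, second_countable_topology}"
  assumes [measurable]: "f \<in> borel_measurable S" and bound: "\<And>\<omega>. norm (f \<omega>) \<le> B"
  shows "(\<integral>\<omega>. f \<omega> \<partial>S) = (\<integral>\<omega>. (\<integral>\<omega>'. f (comb_seq k \<omega> \<omega>') \<partial>S) \<partial>S)"
proof -
  interpret SS: pair_prob_space S S ..
  have "(\<integral>\<omega>. f \<omega> \<partial>S) = (\<integral>p. f (case p of (\<omega>, \<omega>') \<Rightarrow> comb_seq k \<omega> \<omega>') \<partial>(S \<Otimes>\<^sub>M S))"
    by (subst PiM_comb_seq[of k, symmetric], subst integral_distr[OF measurable_comb_seq]) auto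
  also have "\<dots> = (\<integral>\<omega>. (\<integral>\<omega>'. f (comb_seq k \<omega> \<omega>') \<partial>S) \<partial>S)"
    by (subst SS.integral_fst'[symmetric])
       (auto intro!: SS.P.integrable_const_bound[of _ B] bound)
  finally show ?thesis .
qed

lemma char_walk: "char (distr S borel (walk n)) t = char \<nu> t ^ n"
proof (induction n)
  case 0
  have "char (distr S borel (walk 0)) t = (\<integral>\<omega>. 1 \<partial>S)"
    unfolding char_def by (subst integral_distr) auto
  also have "\<dots> = 1" using P.prob_space by simp
  finally show ?case by (simp only: power_0)
next
  case (Suc n)
  have c: "char \<nu> t = (CLINT \<omega>|S. iexp (t * walk 1 \<omega>))"
  proof -
    have "char \<nu> t = (CLINT x|distr S \<nu> (\<lambda>\<omega>. \<omega> 0). iexp (t * x))"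
      by (simp add: char_def PiM_component)
    also have "\<dots> = (CLINT \<omega>|S. iexp (t * \<omega> 0))" by (subst integral_distr) auto
    finally show ?thesis by (simp add: walk_def)
  qed
  have "char (distr S borel (walk (Suc n))) t = (CLINT \<omega>|S. iexp (t * walk (n + 1) \<omega>))"
    unfolding char_def by (subst integral_distr) auto
  also have "\<dots> = (CLINT \<omega>|S. (CLINT \<omega>'|S. iexp (t * walk (n + 1) (comb_seq n \<omega> \<omega>'))))"
    by (intro integral_comb_seq[where B=1]) auto
  also have "\<dots> = (CLINT \<omega>|S. (CLINT \<omega>'|S. iexp (t * walk n \<omega>) * iexp (t * walk 1 \<omega>')))"
    by (simp only: walk_comb_seq_add distrib_left of_real_add exp_add)
  also have "\<dots> = (CLINT \<omega>|S. iexp (t * walk n \<omega>)) * char \<nu> t"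
    by (simp only: integral_mult_right_zero integral_mult_left_zero c)
  also have "(CLINT \<omega>|S. iexp (t * walk n \<omega>)) = char (distr S borel (walk n)) t"
    unfolding char_def by (subst integral_distr) auto
  finally show ?case using Suc by simp
qed

lemma nn_integral_exp_walk:
  "(\<integral>\<^sup>+\<omega>. ennreal (exp (s * walk n \<omega>)) \<partial>S) = (\<integral>\<^sup>+x. ennreal (exp (s * x)) \<partial>\<nu>) ^ n"
proof (induction n)
  case 0 then show ?case using P.emeasure_space_1 by simp
next
  case (Suc n)
  have c: "(\<integral>\<^sup>+x. ennreal (exp (s * x)) \<partial>\<nu>) = (\<integral>\<^sup>+\<omega>. ennreal (exp (s * walk 1 \<omega>)) \<partial>S)"
  proof -
    have "(\<integral>\<^sup>+x. ennreal (exp (s * x)) \<partial>\<nu>) = (\<integral>\<^sup>+x. ennreal (exp (s * x)) \<partial>distr S \<nu> (\<lambda>\<omega>. \<omega> 0))"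
      by (simp add: PiM_component)
    also have "\<dots> = (\<integral>\<^sup>+\<omega>. ennreal (exp (s * \<omega> 0)) \<partial>S)" by (subst nn_integral_distr) auto
    finally show ?thesis by (simp add: walk_def)
  qed
  have "(\<integral>\<^sup>+\<omega>. ennreal (exp (s * walk (Suc n) \<omega>)) \<partial>S) =
      (\<integral>\<^sup>+\<omega>. (\<integral>\<^sup>+\<omega>'. ennreal (exp (s * walk (n + 1) (comb_seq n \<omega> \<omega>'))) \<partial>S) \<partial>S)"
    by (subst nn_integral_comb_seq[of _ n]) auto
  also have "\<dots> = (\<integral>\<^sup>+\<omega>. (\<integral>\<^sup>+\<omega>'. ennreal (exp (s * walk n \<omega>)) * ennreal (exp (s * walk 1 \<omega>')) \<partial>S) \<partial>S)"
    by (simp only: walk_comb_seq_add distrib_left exp_add ennreal_mult' exp_ge_zero)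
  also have "\<dots> = (\<integral>\<^sup>+\<omega>. ennreal (exp (s * walk n \<omega>)) * (\<integral>\<^sup>+x. ennreal (exp (s * x)) \<partial>\<nu>) \<partial>S)"
    unfolding c by (intro nn_integral_cong nn_integral_cmult) measurable
  also have "\<dots> = (\<integral>\<^sup>+\<omega>. ennreal (exp (s * walk n \<omega>)) \<partial>S) * (\<integral>\<^sup>+x. ennreal (exp (s * x)) \<partial>\<nu>)"
    by (rule nn_integral_multc) measurable
  finally show ?case using Suc by (simp add: mult.commute)
qed

end

text \<open>
  This is the weight exp(- alpha (S_n - u)) on S_n > u as a function of the overshoot S_n - u.
\<close>

definition killed_exp :: "real \<Rightarrow> real \<Rightarrow> real" where
  "killed_exp \<beta> y = (if 0 < y then exp (- \<beta> * y) else 0)"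

lemma killed_exp_measurable [measurable]: "killed_exp \<beta> \<in> borel_measurable borel"
  unfolding killed_exp_def[abs_def] by measurable

lemma killed_exp_bounds: "\<beta> \<ge> 0 \<Longrightarrow> 0 \<le> killed_exp \<beta> y" "\<beta> \<ge> 0 \<Longrightarrow> killed_exp \<beta> y \<le> 1"
  by (auto simp: killed_exp_def)

lemma integral_killed_exp_atMost:
  assumes "\<beta> > 0"
  shows "(LINT y|lborel. (if y \<le> m then killed_exp \<beta> y else 0)) = (1 - exp (- \<beta> * max 0 m)) / \<beta>"
proof -
  define F where "F y = - exp (- \<beta> * y) / \<beta>" for y
  have "has_bochner_integral lborel (\<lambda>y. exp (- \<beta> * y) * indicator {0..max 0 m} y) (F (max 0 m) - F 0)"
    using assms unfolding F_def
    by (intro has_bochner_integral_FTC_Icc_real) (auto intro!: derivative_eq_intros continuous_intros)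
  then have "(LINT y|lborel. exp (- \<beta> * y) * indicator {0..max 0 m} y) = F (max 0 m) - F 0"
    by (rule has_bochner_integral_integral_eq)
  moreover have "F (max 0 m) - F 0 = (1 - exp (- \<beta> * max 0 m)) / \<beta>"
    by (simp add: F_def diff_divide_distrib)
  moreover have "(LINT y|lborel. (if y \<le> m then killed_exp \<beta> y else 0)) =
      (LINT y|lborel. exp (- \<beta> * y) * indicator {0..max 0 m} y)"
  proof (rule integral_cong_AE)
    have "AE y in lborel. y \<noteq> (0::real)" by (rule AE_lborel_singleton)
    then show "AE y in lborel. (if y \<le> m then killed_exp \<beta> y else 0) = exp (- \<beta> * y) * indicator {0..max 0 m} y"
      by eventually_elim (auto simp: killed_exp_def indicator_def)
  qed auto
  ultimately show ?thesis by simp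
qed

section \<open>Local estimates for walks with positive drift\<close>

locale drifting_walk = iid_sequence \<nu> for \<nu> :: "real measure" +
  fixes \<rho> \<sigma> :: real
  assumes nonlattice: "nonlattice \<nu>"
    and third_moment: "integrable \<nu> (\<lambda>x. \<bar>x\<bar> ^ 3)"
    and drift: "(LINT x|\<nu>. x) = \<rho>" and drift_pos: "\<rho> > 0"
    and sd_nonneg: "\<sigma> \<ge> 0" and variance_eq: "(LINT x|\<nu>. (x - \<rho>)\<^sup>2) = \<sigma>\<^sup>2"
begin

abbreviation centered :: "real measure" where
  "centered \<equiv> distr \<nu> borel (\<lambda>x. x - \<rho>)"

sublocale C: centered_nonlattice centered \<sigma>
proof -
  interpret D: real_distribution centered by (intro prob_space.real_distribution_distr) (unfold_locales, simp)
  show "centered_nonlattice centered \<sigma>"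
  proof
    show "Defs.nonlattice centered"
    proof (rule ccontr)
      assume "\<not> ?thesis"
      then obtain a h where h: "h > 0" "measure centered (range (\<lambda>k::int. a + h * of_int k)) = 1"
        unfolding nonlattice_def by blast
      have r[measurable]: "range (\<lambda>k::int. b + h * of_int k) \<in> sets borel" for b
        by (rule sets.countable[rotated]) auto
      have "measure \<nu> ((\<lambda>x. x - \<rho>) -` range (\<lambda>k::int. a + h * of_int k) \<inter> space \<nu>) = 1"
        using h(2) by (subst (asm) measure_distr) auto
      also have "(\<lambda>x. x - \<rho>) -` range (\<lambda>k::int. a + h * of_int k) \<inter> space \<nu> =
          range (\<lambda>k::int. (a + \<rho>) + h * of_int k)"
        by (auto simp: image_iff algebra_simps)
      finally show False using nonlattice h(1) unfolding nonlattice_def by blast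
    qed
    show "integrable centered (\<lambda>x. \<bar>x\<bar> ^ 3)"
    proof -
      have "integrable \<nu> (\<lambda>x. \<bar>x - \<rho>\<bar> ^ 3)"
      proof (rule Bochner_Integration.integrable_bound)
        show "integrable \<nu> (\<lambda>x. 4 * (\<bar>x\<bar> ^ 3 + \<bar>\<rho>\<bar> ^ 3))" using third_moment by auto
        show "AE x in \<nu>. norm (\<bar>x - \<rho>\<bar> ^ 3) \<le> norm (4 * (\<bar>x\<bar> ^ 3 + \<bar>\<rho>\<bar> ^ 3))"
        proof (rule AE_I2)
          fix x
          have "\<bar>x - \<rho>\<bar> ^ 3 \<le> (\<bar>x\<bar> + \<bar>\<rho>\<bar>) ^ 3" by (intro power_mono) auto
          also have "\<dots> \<le> 4 * (\<bar>x\<bar> ^ 3 + \<bar>\<rho>\<bar> ^ 3)"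
          proof -
            have "0 \<le> 3 * (\<bar>x\<bar> + \<bar>\<rho>\<bar>) * (\<bar>x\<bar> - \<bar>\<rho>\<bar>)\<^sup>2" by auto
            also have "\<dots> = 4 * (\<bar>x\<bar> ^ 3 + \<bar>\<rho>\<bar> ^ 3) - (\<bar>x\<bar> + \<bar>\<rho>\<bar>) ^ 3"
              by (simp add: power2_eq_square power3_eq_cube algebra_simps)
            finally show ?thesis by simp
          qed
          finally show "norm (\<bar>x - \<rho>\<bar> ^ 3) \<le> norm (4 * (\<bar>x\<bar> ^ 3 + \<bar>\<rho>\<bar> ^ 3))" by simp
        qed
      qed auto
      then show ?thesis by (subst integrable_distr_eq) auto
    qed
    show "(LINT x|centered. x) = 0"
    proof -
      have "(LINT x|centered. x) = (LINT x|\<nu>. x - \<rho>)" by (subst integral_distr) auto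
      also have "\<dots> = (LINT x|\<nu>. x) - (LINT x|\<nu>. \<rho>)"
        using nu.integrable_moments_le_3[OF third_moment, of 1]
        by (intro Bochner_Integration.integral_diff) auto
      also have "(LINT x|\<nu>. \<rho>) = \<rho>"
        using M.prob_space by (simp del: nu.space_eq_univ)
      finally show ?thesis using drift by simp
    qed
    show "(LINT x|centered. x\<^sup>2) = \<sigma>\<^sup>2"
      using variance_eq by (subst integral_distr) auto
  qed (rule sd_nonneg)
qed

lemma char_centered: "char centered t = iexp (- (t * \<rho>)) * char \<nu> t"
proof -
  have "char centered t = (CLINT x|\<nu>. iexp (- (t * \<rho>)) * iexp (t * x))"
    unfolding char_def by (subst integral_distr) (auto simp: exp_add[symmetric] algebra_simps)
  also have "\<dots> = iexp (- (t * \<rho>)) * char \<nu> t"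
    unfolding char_def by (rule integral_mult_right_zero)
  finally show ?thesis .
qed

text \<open>
  This is the form of the characteristic functions that the local limit theorem asks for: a power of
  the centered characteristic function, times the phase of the distance of z from the mean n rho.
\<close>

lemma char_shifted_walk:
  "char (distr S borel (\<lambda>\<omega>. walk n \<omega> - z)) t = iexp (- (t * (z - n * \<rho>))) * char centered t ^ n"
proof -
  have "char (distr S borel (\<lambda>\<omega>. walk n \<omega> - z)) t = (CLINT \<omega>|S. iexp (- (t * z)) * iexp (t * walk n \<omega>))"
    unfolding char_def by (subst integral_distr) (auto simp: exp_add[symmetric] algebra_simps)
  also have "\<dots> = iexp (- (t * z)) * (CLINT \<omega>|S. iexp (t * walk n \<omega>))"
    by (rule integral_mult_right_zero)
  also have "(CLINT \<omega>|S. iexp (t * walk n \<omega>)) = char (distr S borel (walk n)) t"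
    unfolding char_def by (subst integral_distr) auto
  also have "iexp (- (t * z)) * char (distr S borel (walk n)) t =
      iexp (- (t * (z - n * \<rho>))) * char centered t ^ n"
    unfolding char_walk char_centered power_mult_distrib
    by (simp add: exp_of_nat_mult[symmetric] exp_add[symmetric] algebra_simps)
  finally show ?thesis .
qed

lemma real_distribution_shifted_walk: "real_distribution (distr S borel (\<lambda>\<omega>. walk n \<omega> - z))"
  by (rule P.real_distribution_distr) measurable

lemma walk_concentration:
  "\<exists>K>0. \<forall>n\<ge>1. \<forall>z. measure S {\<omega>\<in>space S. walk n \<omega> - z \<in> {0..1}} \<le> K / sqrt (real n)"
proof -
  obtain c where c: "c > 0" "\<And>t. \<bar>t\<bar> \<le> 1 \<Longrightarrow> cmod (char centered t) \<le> exp (- c * t\<^sup>2)"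
    using C.char_gaussian_bound[of 1] by auto
  obtain K where K: "K > 0" and bnd: "\<forall>n\<ge>1. \<forall>W. real_distribution W \<longrightarrow>
      (\<forall>t. cmod (char W t) = cmod (char centered t) ^ n) \<longrightarrow> measure W {0..1} \<le> K / sqrt (real n)"
    using concentration_bound[of c "char centered"] c that by metis
  have "measure S {\<omega>\<in>space S. walk n \<omega> - z \<in> {0..1}} \<le> K / sqrt (real n)" if "n \<ge> 1" for n z
  proof -
    have "measure S {\<omega>\<in>space S. walk n \<omega> - z \<in> {0..1}} = measure (distr S borel (\<lambda>\<omega>. walk n \<omega> - z)) {0..1}"
      by (subst measure_distr) (auto simp: vimage_def Int_def conj_commute)
    also have "\<dots> \<le> K / sqrt (real n)"
      using bnd that real_distribution_shifted_walk[of n z]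
      by (simp add: char_shifted_walk norm_mult norm_power)
    finally show ?thesis .
  qed
  with K show ?thesis by blast
qed

text \<open>
  Cut the positive half line into unit intervals: on the i-th one the weight is at most exp(- beta i)
  and the probability is of order 1 / sqrt n.  The denominator sqrt(n + 1) makes the bound valid at
  n = 0 as well.
\<close>

lemma killed_exp_walk_bound:
  assumes "\<beta> > 0"
  shows "\<exists>K>0. \<forall>n z. (\<integral>\<^sup>+\<omega>. ennreal (killed_exp \<beta> (walk n \<omega> - z)) \<partial>S) \<le> ennreal (K / sqrt (real (n + 1)))"
proof -
  obtain K where K: "K > 0" and conc: "\<And>n z. n \<ge> 1 \<Longrightarrow>
      measure S {\<omega>\<in>space S. walk n \<omega> - z \<in> {0..1}} \<le> K / sqrt (real n)"
    using walk_concentration by blast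
  define g where "g = 1 / (1 - exp (- \<beta>))"
  have g: "g > 0" using assms by (simp add: g_def)
  define K' where "K' = sqrt 2 * g * K + 1"
  have K': "K' > 0" using K g by (simp add: K'_def add_nonneg_pos)
  have "(\<integral>\<^sup>+\<omega>. ennreal (killed_exp \<beta> (walk n \<omega> - z)) \<partial>S) \<le> ennreal (K' / sqrt (real (n + 1)))" for n z
  proof (cases "n = 0")
    case True
    have "(\<integral>\<^sup>+\<omega>. ennreal (killed_exp \<beta> (walk n \<omega> - z)) \<partial>S) \<le> (\<integral>\<^sup>+\<omega>. 1 \<partial>S)"
      using killed_exp_bounds[of \<beta>] assms by (intro nn_integral_mono) auto
    also have "\<dots> = 1" using P.emeasure_space_1 by simp
    also have "1 \<le> ennreal (K' / sqrt (real (n + 1)))"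
      using True K g by (simp add: K'_def)
    finally show ?thesis .
  next
    case False
    define A where "A i = {\<omega>\<in>space S. walk n \<omega> - (z + real i) \<in> {0..1}}" for i :: nat
    have [measurable]: "A i \<in> sets S" for i unfolding A_def by measurable
    have "(\<integral>\<^sup>+\<omega>. ennreal (killed_exp \<beta> (walk n \<omega> - z)) \<partial>S) \<le>
        (\<integral>\<^sup>+\<omega>. (\<Sum>i. ennreal (exp (- \<beta>) ^ i) * indicator (A i) \<omega>) \<partial>S)"
    proof (rule nn_integral_mono)
      fix \<omega> assume \<omega>: "\<omega> \<in> space S"
      define y where "y = walk n \<omega> - z"
      show "ennreal (killed_exp \<beta> (walk n \<omega> - z)) \<le> (\<Sum>i. ennreal (exp (- \<beta>) ^ i) * indicator (A i) \<omega>)"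
      proof (cases "y > 0")
        case True
        \<comment> \<open>The unit interval that contains y already contributes enough.\<close>
        define i where "i = nat \<lfloor>y\<rfloor>"
        have i: "real i \<le> y" "y \<le> real i + 1" using True unfolding i_def by linarith+
        then have "\<omega> \<in> A i" using \<omega> by (simp add: A_def y_def)
        have "exp (- \<beta> * y) \<le> exp (real i * (- \<beta>))" using i assms by (simp add: mult.commute)
        also have "\<dots> = exp (- \<beta>) ^ i" by (rule exp_of_nat_mult)
        finally have "ennreal (killed_exp \<beta> y) \<le> ennreal (exp (- \<beta>) ^ i) * indicator (A i) \<omega>"
          using True \<open>\<omega> \<in> A i\<close> by (simp add: killed_exp_def)
        also have "\<dots> \<le> (\<Sum>i. ennreal (exp (- \<beta>) ^ i) * indicator (A i) \<omega>)"
        proof -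
          define f where "f = (\<lambda>i. ennreal (exp (- \<beta>) ^ i) * indicator (A i) \<omega>)"
          have "f i \<le> suminf f" using sum_le_suminf[of f "{i}"] by simp
          then show ?thesis by (simp only: f_def)
        qed
        finally show ?thesis by (simp add: y_def)
      qed (simp add: killed_exp_def y_def)
    qed
    also have "\<dots> = (\<Sum>i. \<integral>\<^sup>+\<omega>. ennreal (exp (- \<beta>) ^ i) * indicator (A i) \<omega> \<partial>S)"
      by (rule nn_integral_suminf) measurable
    also have "\<dots> = (\<Sum>i. ennreal (exp (- \<beta>) ^ i) * emeasure S (A i))"
      by (simp add: nn_integral_cmult_indicator)
    also have "\<dots> \<le> (\<Sum>i. ennreal (exp (- \<beta>) ^ i * (K / sqrt n)))"
    proof (intro suminf_le allI)
      fix i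
      have "emeasure S (A i) \<le> ennreal (K / sqrt n)"
        using conc[of n "z + real i"] False unfolding A_def P.emeasure_eq_measure
        by (intro ennreal_leI) auto
      then show "ennreal (exp (- \<beta>) ^ i) * emeasure S (A i) \<le> ennreal (exp (- \<beta>) ^ i * (K / sqrt n))"
        using K by (subst ennreal_mult) (auto intro!: mult_left_mono)
    qed auto
    also have "\<dots> = ennreal (g * (K / sqrt n))"
    proof (intro suminf_ennreal_eq)
      have "(\<lambda>i. exp (- \<beta>) ^ i) sums g" unfolding g_def using assms by (intro geometric_sums) auto
      then show "(\<lambda>i. exp (- \<beta>) ^ i * (K / sqrt n)) sums (g * (K / sqrt n))" by (rule sums_mult2)
    qed (use K in auto)
    also have "g * (K / sqrt n) \<le> K' / sqrt (real (n + 1))"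
    proof -
      have "sqrt (real (n + 1)) \<le> sqrt (2 * real n)" using False by (intro real_sqrt_le_mono) auto
      then have "g * K * sqrt (real (n + 1)) \<le> g * K * (sqrt 2 * sqrt n)"
        using g K by (intro mult_left_mono) (auto simp: real_sqrt_mult)
      also have "\<dots> \<le> K' * sqrt n" by (simp add: K'_def algebra_simps)
      finally show ?thesis using False by (simp add: field_simps)
    qed
    finally show ?thesis by (simp add: ennreal_leI)
  qed
  with K' show ?thesis by blast
qed

lemma walk_local_limit:
  assumes "\<beta> > 0" and N: "filterlim N at_top sequentially"
    and z: "\<And>i. \<bar>z i - real (N i) * \<rho>\<bar> \<le> B"
  shows "(\<lambda>i. sqrt (N i) * (\<integral>\<omega>. (if walk (N i) \<omega> - z i \<le> m then killed_exp \<beta> (walk (N i) \<omega> - z i) else 0) \<partial>S))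
     \<longlonglongrightarrow> (1 - exp (- \<beta> * max 0 m)) / \<beta> / (\<sigma> * sqrt (2 * pi))"
proof -
  define g where "g y = (if y \<le> m then killed_exp \<beta> y else 0)" for y
  have [measurable]: "g \<in> borel_measurable borel" unfolding g_def by measurable
  have "(\<lambda>i. sqrt (N i) * (LINT y|distr S borel (\<lambda>\<omega>. walk (N i) \<omega> - z i). g y))
     \<longlonglongrightarrow> (LINT y|lborel. g y) / (\<sigma> * sqrt (2 * pi))"
  proof (rule stone_local_limit[OF real_distribution_shifted_walk char_shifted_walk _ C.char_gaussian_bound
        C.char_power_tendsto[OF N] N z C.sd_pos])
    show "\<bar>g y\<bar> \<le> 1" for y using killed_exp_bounds[of \<beta> y] assms(1) by (auto simp: g_def)
    show "g y = 0" if "\<bar>y\<bar> > \<bar>m\<bar>" for y using that by (auto simp: g_def killed_exp_def)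
    show "finite {0, m}" by simp
    show "isCont g y" if "y \<notin> {0, m}" for y
    proof -
      have "y \<noteq> 0" "y \<noteq> m" using that by auto
      then consider "y < 0 \<or> m < y" | "0 < y" "y < m" by linarith
      then show ?thesis
      proof cases
        case 1
        have "eventually (\<lambda>y. y \<in> {..<0} \<union> {m<..}) (nhds y)"
          using 1 by (intro eventually_nhds_in_open) auto
        then have "eventually (\<lambda>y. g y = 0) (nhds y)"
          by eventually_elim (auto simp: g_def killed_exp_def)
        then have "isCont g y = isCont (\<lambda>_. 0 :: real) y" by (rule isCont_cong)
        then show ?thesis by simp
      next
        case 2
        have "eventually (\<lambda>y. y \<in> {0<..<m}) (nhds y)"
          using 2 by (intro eventually_nhds_in_open) auto
        then have "eventually (\<lambda>y. g y = exp (- \<beta> * y)) (nhds y)"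
          by eventually_elim (auto simp: g_def killed_exp_def)
        then have "isCont g y = isCont (\<lambda>y. exp (- \<beta> * y)) y" by (rule isCont_cong)
        then show ?thesis by simp
      qed
    qed
  qed auto
  moreover have "(LINT y|distr S borel (\<lambda>\<omega>. walk n \<omega> - c). g y) = (\<integral>\<omega>. g (walk n \<omega> - c) \<partial>S)" for n c
    by (rule integral_distr) auto
  ultimately show ?thesis
    using integral_killed_exp_atMost[OF assms(1), of m] by (simp add: g_def)
qed

end

section \<open>Staying below the running minimum\<close>

text \<open>
  An exchange of limits: the errors e k do not depend on i, so that the limits c k of the
  approximations b k determine the limit of a.
\<close>

lemma tendsto_of_approximations:
  fixes a :: "nat \<Rightarrow> real" and b :: "nat \<Rightarrow> nat \<Rightarrow> real"
  assumes b: "\<And>k. b k \<longlonglongrightarrow> c k" and c: "c \<longlonglongrightarrow> l" and e: "e \<longlonglongrightarrow> 0"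
    and upper: "\<And>k. eventually (\<lambda>i. a i \<le> b k i) sequentially"
    and lower: "\<And>k. eventually (\<lambda>i. b k i - e k \<le> a i) sequentially"
  shows "a \<longlonglongrightarrow> l"
proof (rule LIMSEQ_I)
  fix r :: real assume r: "r > 0"
  have "eventually (\<lambda>k. \<bar>c k - l\<bar> < r / 3) sequentially"
    using tendstoD[OF c, of "r / 3"] r unfolding dist_real_def by simp
  moreover have "eventually (\<lambda>k. \<bar>e k\<bar> < r / 3) sequentially"
    using tendstoD[OF e, of "r / 3"] r unfolding dist_real_def by simp
  ultimately have "eventually (\<lambda>k. \<bar>c k - l\<bar> < r / 3 \<and> \<bar>e k\<bar> < r / 3) sequentially"
    by eventually_elim auto
  then obtain k where k: "\<bar>c k - l\<bar> < r / 3" "\<bar>e k\<bar> < r / 3"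
    using eventually_happens' sequentially_bot by blast
  have "eventually (\<lambda>i. \<bar>b k i - c k\<bar> < r / 3) sequentially"
    using tendstoD[OF b[of k], of "r / 3"] r unfolding dist_real_def by simp
  then have "eventually (\<lambda>i. norm (a i - l) < r) sequentially"
    using upper[of k] lower[of k] by eventually_elim (use k in \<open>unfold real_norm_def, linarith\<close>)
  then show "\<exists>no. \<forall>n\<ge>no. norm (a n - l) < r" by (simp add: eventually_sequentially)
qed

text \<open>
  The integrand that tilting and time reversal produce has k = n.  For fixed k and large n the
  constraint only involves the first k steps, and this truncation is accessible to the local limit
  theorem.
\<close>

definition staying_weight :: "real \<Rightarrow> nat \<Rightarrow> nat \<Rightarrow> real \<Rightarrow> (nat \<Rightarrow> real) \<Rightarrow> real" where
  "staying_weight \<beta> k n u \<omega> =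
     (if \<forall>j\<in>{1..k}. walk n \<omega> - u \<le> walk j \<omega> then killed_exp \<beta> (walk n \<omega> - u) else 0)"

definition running_min :: "nat \<Rightarrow> (nat \<Rightarrow> real) \<Rightarrow> real" where
  "running_min k \<omega> = Min ((\<lambda>j. walk j \<omega>) ` {1..k})"

lemma le_running_min_iff: "k \<ge> 1 \<Longrightarrow> y \<le> running_min k \<omega> \<longleftrightarrow> (\<forall>j\<in>{1..k}. y \<le> walk j \<omega>)"
  by (simp add: running_min_def)

lemma staying_weight_bounds:
  assumes "\<beta> \<ge> 0" shows "0 \<le> staying_weight \<beta> k n u \<omega>" "staying_weight \<beta> k n u \<omega> \<le> 1"
  using killed_exp_bounds[OF assms] by (auto simp: staying_weight_def)

lemma (in iid_sequence) running_min_measurable [measurable]: "running_min k \<in> borel_measurable S"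
  unfolding running_min_def[abs_def] by measurable

lemma (in iid_sequence) staying_weight_measurable [measurable]:
  "staying_weight \<beta> k n u \<in> borel_measurable S"
proof -
  have "{\<omega>\<in>space S. walk n \<omega> - u \<le> walk j \<omega>} \<in> sets S" for j by measurable
  then have [measurable]: "{\<omega>\<in>space S. \<forall>j\<in>{1..k}. walk n \<omega> - u \<le> walk j \<omega>} \<in> sets S"
    by (intro sets.sets_Collect_finite_All) auto
  show ?thesis unfolding staying_weight_def[abs_def]
    by (rule measurable_If) measurable
qed

lemma (in iid_sequence) integrable_staying_weight:
  "\<beta> \<ge> 0 \<Longrightarrow> integrable S (staying_weight \<beta> k n u)"
  using staying_weight_bounds[of \<beta>] by (intro P.integrable_const_bound[of _ 1]) auto

text \<open>
  A walk with positive drift and exponential moments on the negative side satisfies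
  E[exp(- t X)] < 1 for small t > 0.  The requirement t < beta leaves the exponential decay
  beta - t > 0 in the weight after a factor exp(t y) has been spent.
\<close>

locale contracting_walk = drifting_walk +
  fixes \<beta> t :: real
  assumes t_pos: "0 < t" and t_less: "t < \<beta>"
    and contraction: "(\<integral>\<^sup>+x. ennreal (exp (- t * x)) \<partial>\<nu>) < 1"
begin

lemma \<beta>_pos: "\<beta> > 0" using t_pos t_less by simp

definition rate :: real where "rate = enn2real (\<integral>\<^sup>+x. ennreal (exp (- t * x)) \<partial>\<nu>)"

lemma rate: "0 \<le> rate" "rate < 1" "(\<integral>\<^sup>+x. ennreal (exp (- t * x)) \<partial>\<nu>) = ennreal rate"
proof -
  have fin: "(\<integral>\<^sup>+x. ennreal (exp (- t * x)) \<partial>\<nu>) < \<top>" using contraction by (rule less_trans) simp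
  then show eq: "(\<integral>\<^sup>+x. ennreal (exp (- t * x)) \<partial>\<nu>) = ennreal rate" by (simp add: rate_def less_top)
  show "0 \<le> rate" by (simp add: rate_def)
  show "rate < 1" using contraction unfolding eq by simp
qed

lemma nn_integral_exp_neg_walk: "(\<integral>\<^sup>+\<omega>. ennreal (exp (- t * walk j \<omega>)) \<partial>S) = ennreal (rate ^ j)"
  using nn_integral_exp_walk[of "- t" j] rate by (simp add: ennreal_power)

definition prefix_constant :: "nat \<Rightarrow> real" where
  "prefix_constant k = (\<integral>\<omega>. (1 - exp (- \<beta> * max 0 (running_min k \<omega>))) / \<beta> \<partial>S) / (\<sigma> * sqrt (2 * pi))"

lemma integral_killed_exp_walk_bound:
  "\<exists>K>0. \<forall>n z. (\<integral>\<omega>. killed_exp \<beta> (walk n \<omega> - z) \<partial>S) \<le> K / sqrt (real (n + 1))"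
proof -
  obtain K where K: "K > 0" "\<And>n z. (\<integral>\<^sup>+\<omega>. ennreal (killed_exp \<beta> (walk n \<omega> - z)) \<partial>S) \<le> ennreal (K / sqrt (real (n + 1)))"
    using killed_exp_walk_bound[OF \<beta>_pos] by blast
  have "(\<integral>\<omega>. killed_exp \<beta> (walk n \<omega> - z) \<partial>S) \<le> K / sqrt (real (n + 1))" for n z
  proof -
    have "integrable S (\<lambda>\<omega>. killed_exp \<beta> (walk n \<omega> - z))"
      using killed_exp_bounds[of \<beta>] \<beta>_pos by (intro P.integrable_const_bound[of _ 1]) auto
    then have "ennreal (\<integral>\<omega>. killed_exp \<beta> (walk n \<omega> - z) \<partial>S) \<le> ennreal (K / sqrt (real (n + 1)))"
      using K(2)[of n z] killed_exp_bounds[of \<beta>] \<beta>_pos by (subst nn_integral_eq_integral[symmetric]) auto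
    then show ?thesis using K(1) by simp
  qed
  with K(1) show ?thesis by blast
qed

text \<open>
  Condition on the first k steps.  Given these, the weight is a function of the remaining n - k steps
  to which the local limit theorem applies with the running minimum as cutoff.  The uniform bound of
  order 1 / sqrt(n - k) lets dominated convergence carry the limit through the expectation over the
  first k steps.
\<close>

lemma prefix_limit:
  assumes k: "k \<ge> 1" and N: "filterlim N at_top sequentially"
    and u: "\<And>i. \<bar>u i - real (N i) * \<rho>\<bar> \<le> B"
  shows "(\<lambda>i. sqrt (N i) * (\<integral>\<omega>. staying_weight \<beta> k (N i) (u i) \<omega> \<partial>S)) \<longlonglongrightarrow> prefix_constant k"
proof -
  define h where "h m y = (if y \<le> m then killed_exp \<beta> y else 0)" for m y
  have [measurable]: "case_prod h \<in> borel_measurable (borel \<Otimes>\<^sub>M borel)"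
    unfolding h_def by measurable
  have h_bounds: "0 \<le> h m y" "h m y \<le> killed_exp \<beta> y" "h m y \<le> 1" for m y
    using killed_exp_bounds[of \<beta> y] \<beta>_pos by (auto simp: h_def)
  define F where "F i \<omega> = (\<integral>\<omega>'. h (running_min k \<omega>) (walk (N i - k) \<omega>' - (u i - walk k \<omega>)) \<partial>S)" for i \<omega>
  have [measurable]: "F i \<in> borel_measurable S" for i unfolding F_def by measurable
  obtain K where K: "K > 0" "\<And>n z. (\<integral>\<omega>. killed_exp \<beta> (walk n \<omega> - z) \<partial>S) \<le> K / sqrt (real (n + 1))"
    using integral_killed_exp_walk_bound by blast
  have M: "filterlim (\<lambda>i. N i - k) at_top sequentially"
  proof (rule filterlim_at_top[THEN iffD2], rule allI)
    fix Z
    have "eventually (\<lambda>i. N i \<ge> Z + k) sequentially" using N by (simp add: filterlim_at_top)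
    then show "eventually (\<lambda>i. Z \<le> N i - k) sequentially" by eventually_elim simp
  qed
  have FL: "(\<lambda>i. sqrt (real (N i - k)) * F i \<omega>) \<longlonglongrightarrow>
      (1 - exp (- \<beta> * max 0 (running_min k \<omega>))) / \<beta> / (\<sigma> * sqrt (2 * pi))" for \<omega>
    unfolding F_def h_def
  proof (rule walk_local_limit[OF \<beta>_pos M])
    fix i
    have "real k * \<rho> \<ge> 0" using drift_pos by simp
    moreover have "\<bar>real (N i) * \<rho> - real (N i - k) * \<rho>\<bar> \<le> real k * \<rho>"
    proof -
      have "\<bar>real (N i) - real (N i - k)\<bar> \<le> real k" by linarith
      then have "\<bar>real (N i) - real (N i - k)\<bar> * \<rho> \<le> real k * \<rho>" using drift_pos by (intro mult_right_mono) auto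
      then show ?thesis using drift_pos by (simp add: abs_mult left_diff_distrib[symmetric])
    qed
    ultimately show "\<bar>u i - walk k \<omega> - real (N i - k) * \<rho>\<bar> \<le> B + \<bar>walk k \<omega>\<bar> + real k * \<rho>"
      using u[of i] by linarith
  qed
  have "(\<lambda>i. \<integral>\<omega>. sqrt (real (N i - k)) * F i \<omega> \<partial>S) \<longlonglongrightarrow>
      (\<integral>\<omega>. (1 - exp (- \<beta> * max 0 (running_min k \<omega>))) / \<beta> / (\<sigma> * sqrt (2 * pi)) \<partial>S)"
  proof (rule integral_dominated_convergence[where w="\<lambda>_. K"])
    show "AE \<omega> in S. norm (sqrt (real (N i - k)) * F i \<omega>) \<le> K" for i
    proof (rule AE_I2)
      fix \<omega>
      let ?n = "N i - k" and ?z = "u i - walk k \<omega>"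
      have F0: "0 \<le> F i \<omega>" unfolding F_def by (intro integral_nonneg_AE AE_I2 h_bounds)
      have "F i \<omega> \<le> (\<integral>\<omega>'. killed_exp \<beta> (walk ?n \<omega>' - ?z) \<partial>S)"
        unfolding F_def using h_bounds killed_exp_bounds[of \<beta>] \<beta>_pos
        by (intro integral_mono P.integrable_const_bound[of _ 1]) auto
      also have "\<dots> \<le> K / sqrt (real (?n + 1))" by (rule K)
      finally have "sqrt (real ?n) * F i \<omega> \<le> sqrt (real (?n + 1)) * (K / sqrt (real (?n + 1)))"
        using F0 by (intro mult_mono) auto
      then show "norm (sqrt (real ?n) * F i \<omega>) \<le> K" using F0 by (simp add: abs_mult)
    qed
    show "AE \<omega> in S. (\<lambda>i. sqrt (real (N i - k)) * F i \<omega>) \<longlonglongrightarrow>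
      (1 - exp (- \<beta> * max 0 (running_min k \<omega>))) / \<beta> / (\<sigma> * sqrt (2 * pi))"
      by (intro AE_I2 FL)
  qed auto
  then have lim: "(\<lambda>i. sqrt (real (N i - k)) * (\<integral>\<omega>. F i \<omega> \<partial>S)) \<longlonglongrightarrow> prefix_constant k"
    by (simp add: prefix_constant_def)
  have ratio: "(\<lambda>i. sqrt (N i) / sqrt (real (N i - k))) \<longlonglongrightarrow> 1"
  proof -
    have "(\<lambda>n::nat. sqrt (real n) / sqrt (real n - real k)) \<longlonglongrightarrow> 1" by real_asymp
    from filterlim_compose[OF this N]
    have "(\<lambda>i. sqrt (N i) / sqrt (real (N i) - real k)) \<longlonglongrightarrow> 1" .
    moreover have "eventually (\<lambda>i. N i \<ge> k) sequentially" using N by (simp add: filterlim_at_top)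
    then have "eventually (\<lambda>i. sqrt (N i) / sqrt (real (N i) - real k) = sqrt (N i) / sqrt (real (N i - k))) sequentially"
      by eventually_elim (simp add: of_nat_diff)
    ultimately show ?thesis by (rule Lim_transform_eventually)
  qed
  have "(\<lambda>i. (sqrt (N i) / sqrt (real (N i - k))) * (sqrt (real (N i - k)) * (\<integral>\<omega>. F i \<omega> \<partial>S))) \<longlonglongrightarrow> 1 * prefix_constant k"
    by (intro tendsto_mult ratio lim)
  moreover have "eventually (\<lambda>i. N i > k) sequentially" using N eventually_gt_at_top[of k] unfolding filterlim_iff by blast
  then have "eventually (\<lambda>i. (sqrt (N i) / sqrt (real (N i - k))) * (sqrt (real (N i - k)) * (\<integral>\<omega>. F i \<omega> \<partial>S)) =
      sqrt (N i) * (\<integral>\<omega>. staying_weight \<beta> k (N i) (u i) \<omega> \<partial>S)) sequentially"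
  proof eventually_elim
    case (elim i)
    have "(\<integral>\<omega>. staying_weight \<beta> k (N i) (u i) \<omega> \<partial>S) =
        (\<integral>\<omega>. (\<integral>\<omega>'. staying_weight \<beta> k (N i) (u i) (comb_seq k \<omega> \<omega>') \<partial>S) \<partial>S)"
      using staying_weight_bounds[of \<beta>] \<beta>_pos by (intro integral_comb_seq[where B=1]) auto
    also have "\<dots> = (\<integral>\<omega>. F i \<omega> \<partial>S)"
    proof -
      have "staying_weight \<beta> k (N i) (u i) (comb_seq k \<omega> \<omega>') =
          h (running_min k \<omega>) (walk (N i - k) \<omega>' - (u i - walk k \<omega>))" for \<omega> \<omega>'
      proof -
        have "walk (N i) (comb_seq k \<omega> \<omega>') = walk k \<omega> + walk (N i - k) \<omega>'"
          using walk_comb_seq_add[of k "N i - k" \<omega> \<omega>'] elim by simp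
        then show ?thesis
          unfolding staying_weight_def h_def le_running_min_iff[OF k]
          by (simp add: walk_comb_seq_le algebra_simps)
      qed
      then show ?thesis unfolding F_def by simp
    qed
    finally show ?case using elim by simp
  qed
  ultimately show ?thesis using Lim_transform_eventually by fastforce
qed

text \<open>
  Suppose that the overshoot y satisfies the first k constraints but exceeds S_j for some j > k.  Then
  exp(- beta y) \<le> exp(- (beta - t) y) exp(- t S_j).  The expectation of the right-hand side
  is computed by conditioning on the first j steps: the first factor contributes 1 / sqrt(n - j + 1)
  uniformly in S_j, the second one rate^j.
\<close>

lemma prefix_error:
  "\<exists>K>0. \<forall>k n u. k \<le> n \<longrightarrow> (\<integral>\<omega>. staying_weight \<beta> k n u \<omega> \<partial>S) \<le>
     (\<integral>\<omega>. staying_weight \<beta> n n u \<omega> \<partial>S) + (\<Sum>j\<in>{k<..n}. rate ^ j * (K / sqrt (real (n - j + 1))))"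
proof -
  obtain K where K: "K > 0" and bnd: "\<And>n z. (\<integral>\<^sup>+\<omega>. ennreal (killed_exp (\<beta> - t) (walk n \<omega> - z)) \<partial>S) \<le> ennreal (K / sqrt (real (n + 1)))"
    using killed_exp_walk_bound[of "\<beta> - t"] t_less by auto
  have "(\<integral>\<omega>. staying_weight \<beta> k n u \<omega> \<partial>S) \<le>
     (\<integral>\<omega>. staying_weight \<beta> n n u \<omega> \<partial>S) + (\<Sum>j\<in>{k<..n}. rate ^ j * (K / sqrt (real (n - j + 1))))"
    if kn: "k \<le> n" for k n u
  proof -
    define g where "g j \<omega> = killed_exp (\<beta> - t) (walk n \<omega> - u) * exp (- t * walk j \<omega>)" for j \<omega>
    have [measurable]: "g j \<in> borel_measurable S" for j unfolding g_def by measurable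
    have g0: "0 \<le> g j \<omega>" for j \<omega>
      using killed_exp_bounds(1)[of "\<beta> - t"] t_less by (simp add: g_def)
    have pointwise: "staying_weight \<beta> k n u \<omega> \<le> staying_weight \<beta> n n u \<omega> + (\<Sum>j\<in>{k<..n}. g j \<omega>)" for \<omega>
    proof (cases "staying_weight \<beta> k n u \<omega> = staying_weight \<beta> n n u \<omega> \<or> staying_weight \<beta> k n u \<omega> = 0")
      case True
      then show ?thesis using sum_nonneg[of "{k<..n}" "\<lambda>j. g j \<omega>"] g0 staying_weight_bounds(1)[of \<beta> n n u \<omega>] \<beta>_pos by auto
    next
      case False
      define y where "y = walk n \<omega> - u"
      have k: "\<forall>j\<in>{1..k}. y \<le> walk j \<omega>" "y > 0" and eq: "staying_weight \<beta> k n u \<omega> = exp (- \<beta> * y)"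
        using False by (auto simp: staying_weight_def killed_exp_def y_def split: if_splits)
      have "\<not> (\<forall>j\<in>{1..n}. y \<le> walk j \<omega>)"
      proof
        assume "\<forall>j\<in>{1..n}. y \<le> walk j \<omega>"
        then have "staying_weight \<beta> n n u \<omega> = killed_exp \<beta> y"
          by (simp add: staying_weight_def y_def)
        moreover have "staying_weight \<beta> k n u \<omega> = killed_exp \<beta> y"
          using k(1) by (simp add: staying_weight_def y_def)
        ultimately show False using False by simp
      qed
      then obtain j where j: "j \<in> {1..n}" "walk j \<omega> < y" by force
      then have jk: "j \<in> {k<..n}" using k(1) by (cases "j \<le> k") force+
      have "t * walk j \<omega> \<le> t * y" using j(2) t_pos by simp
      then have "exp (- \<beta> * y) \<le> exp (- (\<beta> - t) * y + (- t * walk j \<omega>))" by (simp add: algebra_simps)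
      also have "\<dots> = g j \<omega>" using k(2) unfolding exp_add by (simp add: g_def killed_exp_def y_def)
      also have "\<dots> \<le> (\<Sum>j\<in>{k<..n}. g j \<omega>)" using jk g0 by (intro member_le_sum) auto
      finally show ?thesis using eq staying_weight_bounds(1)[of \<beta> n n u \<omega>] \<beta>_pos by simp
    qed
    have gb: "(\<integral>\<^sup>+\<omega>. ennreal (g j \<omega>) \<partial>S) \<le> ennreal (rate ^ j * (K / sqrt (real (n - j + 1))))" if "j \<le> n" for j
    proof -
      have "(\<integral>\<^sup>+\<omega>. ennreal (g j \<omega>) \<partial>S) = (\<integral>\<^sup>+\<omega>. (\<integral>\<^sup>+\<omega>'. ennreal (g j (comb_seq j \<omega> \<omega>')) \<partial>S) \<partial>S)"
        by (rule nn_integral_comb_seq) measurable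
      also have "\<dots> = (\<integral>\<^sup>+\<omega>. (\<integral>\<^sup>+\<omega>'. ennreal (exp (- t * walk j \<omega>)) *
           ennreal (killed_exp (\<beta> - t) (walk (n - j) \<omega>' - (u - walk j \<omega>))) \<partial>S) \<partial>S)"
      proof (intro nn_integral_cong)
        fix \<omega> \<omega>' :: "nat \<Rightarrow> real"
        have "walk n (comb_seq j \<omega> \<omega>') = walk j \<omega> + walk (n - j) \<omega>'"
          using walk_comb_seq_add[of j "n - j" \<omega> \<omega>'] that by simp
        then have "g j (comb_seq j \<omega> \<omega>') =
            exp (- t * walk j \<omega>) * killed_exp (\<beta> - t) (walk (n - j) \<omega>' - (u - walk j \<omega>))"
          by (simp add: g_def walk_comb_seq_le algebra_simps)
        then show "ennreal (g j (comb_seq j \<omega> \<omega>')) = ennreal (exp (- t * walk j \<omega>)) *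
           ennreal (killed_exp (\<beta> - t) (walk (n - j) \<omega>' - (u - walk j \<omega>)))"
          by (simp add: ennreal_mult')
      qed
      also have "\<dots> = (\<integral>\<^sup>+\<omega>. ennreal (exp (- t * walk j \<omega>)) *
           (\<integral>\<^sup>+\<omega>'. ennreal (killed_exp (\<beta> - t) (walk (n - j) \<omega>' - (u - walk j \<omega>))) \<partial>S) \<partial>S)"
        by (intro nn_integral_cong nn_integral_cmult) measurable
      also have "\<dots> \<le> (\<integral>\<^sup>+\<omega>. ennreal (exp (- t * walk j \<omega>)) * ennreal (K / sqrt (real (n - j + 1))) \<partial>S)"
        by (intro nn_integral_mono mult_left_mono bnd) auto
      also have "\<dots> = (\<integral>\<^sup>+\<omega>. ennreal (exp (- t * walk j \<omega>)) \<partial>S) * ennreal (K / sqrt (real (n - j + 1)))"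
        by (rule nn_integral_multc) measurable
      also have "\<dots> = ennreal (rate ^ j * (K / sqrt (real (n - j + 1))))"
        unfolding nn_integral_exp_neg_walk using rate K by (subst ennreal_mult) auto
      finally show ?thesis .
    qed
    define b where "b j = rate ^ j * (K / sqrt (real (n - j + 1)))" for j
    have nonneg: "0 \<le> b j" for j using rate K by (simp add: b_def)
    have "ennreal (\<integral>\<omega>. staying_weight \<beta> k n u \<omega> \<partial>S) = (\<integral>\<^sup>+\<omega>. ennreal (staying_weight \<beta> k n u \<omega>) \<partial>S)"
      using staying_weight_bounds[of \<beta>] \<beta>_pos integrable_staying_weight
      by (intro nn_integral_eq_integral[symmetric]) auto
    also have "\<dots> \<le> (\<integral>\<^sup>+\<omega>. ennreal (staying_weight \<beta> n n u \<omega>) + (\<Sum>j\<in>{k<..n}. ennreal (g j \<omega>)) \<partial>S)"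
    proof (rule nn_integral_mono)
      fix \<omega>
      have "ennreal (staying_weight \<beta> k n u \<omega>) \<le> ennreal (staying_weight \<beta> n n u \<omega> + (\<Sum>j\<in>{k<..n}. g j \<omega>))"
        by (intro ennreal_leI pointwise)
      also have "\<dots> = ennreal (staying_weight \<beta> n n u \<omega>) + (\<Sum>j\<in>{k<..n}. ennreal (g j \<omega>))"
        using staying_weight_bounds[of \<beta>] \<beta>_pos g0 by (subst ennreal_plus) (auto intro!: sum_nonneg)
      finally show "ennreal (staying_weight \<beta> k n u \<omega>) \<le> ennreal (staying_weight \<beta> n n u \<omega>) + (\<Sum>j\<in>{k<..n}. ennreal (g j \<omega>))" .
    qed
    also have "\<dots> = (\<integral>\<^sup>+\<omega>. ennreal (staying_weight \<beta> n n u \<omega>) \<partial>S) + (\<Sum>j\<in>{k<..n}. (\<integral>\<^sup>+\<omega>. ennreal (g j \<omega>) \<partial>S))"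
      by (subst nn_integral_add) (auto simp: nn_integral_sum)
    also have "\<dots> \<le> ennreal (\<integral>\<omega>. staying_weight \<beta> n n u \<omega> \<partial>S) + (\<Sum>j\<in>{k<..n}. ennreal (b j))"
      using staying_weight_bounds[of \<beta>] \<beta>_pos integrable_staying_weight
      by (intro add_mono sum_mono gb[folded b_def]) (auto simp: nn_integral_eq_integral)
    also have "\<dots> = ennreal ((\<integral>\<omega>. staying_weight \<beta> n n u \<omega> \<partial>S) + (\<Sum>j\<in>{k<..n}. b j))"
      using nonneg staying_weight_bounds[of \<beta>] \<beta>_pos
      by (subst ennreal_plus) (auto intro!: sum_nonneg integral_nonneg_AE)
    finally show ?thesis unfolding b_def[symmetric]
      using nonneg staying_weight_bounds[of \<beta>] \<beta>_pos
      by (subst (asm) ennreal_le_iff) (auto intro!: add_nonneg_nonneg sum_nonneg integral_nonneg_AE)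
  qed
  with K show ?thesis by blast
qed

text \<open>
  Let the first L + 1 steps be at least a > 0; then the walk has climbed to (L + 1) a.  Afterwards it
  falls below a only if the fresh walk gets below - L a, and by the exponential Markov inequality the
  probability of that is at most exp(- t L a) times a geometric series, which is below 1 / 2 for
  large L.
\<close>

lemma walk_stays_above:
  "\<exists>a>0. \<exists>p>0. \<forall>k. measure S {\<omega>\<in>space S. \<forall>j\<in>{1..k}. a \<le> walk j \<omega>} \<ge> p"
proof -
  have "\<exists>a>0. measure \<nu> {a..} > 0"
  proof (rule ccontr)
    assume neg: "\<not> ?thesis"
    have "AE x in \<nu>. x < 1 / real (Suc n)" for n
    proof -
      have "measure \<nu> {1 / real (Suc n)..} = 0"
        using neg measure_nonneg[of \<nu> "{1 / real (Suc n)..}"] by (metis less_le of_nat_0_less_iff zero_less_Suc zero_less_divide_1_iff)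
      then have "AE x in \<nu>. x \<notin> {1 / real (Suc n)..}"
        using M.prob_eq_0[of "{1 / real (Suc n)..}"] by auto
      then show ?thesis by eventually_elim auto
    qed
    then have "AE x in \<nu>. \<forall>n. x < 1 / real (Suc n)" by (subst AE_all_countable) auto
    then have "AE x in \<nu>. x \<le> 0"
    proof eventually_elim
      case (elim x)
      show ?case
      proof (rule ccontr)
        assume "\<not> x \<le> 0"
        then obtain n where "1 / real (Suc n) < x" using nat_approx_posE[of x] by auto
        then show False using elim by (metis less_asym)
      qed
    qed
    then have "(LINT x|\<nu>. x) \<le> (LINT x|\<nu>. 0)"
      using nu.integrable_moments_le_3[OF third_moment, of 1] by (intro integral_mono_AE) auto
    then show False using drift drift_pos by simp
  qed
  then obtain a where a: "a > 0" and q: "measure \<nu> {a..} > 0" by blast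
  define T where "T = 1 / (1 - rate)"
  have T: "T > 0" using rate by (simp add: T_def)
  have "(\<lambda>L. exp (- (t * real L * a)) * T) \<longlonglongrightarrow> 0"
    using t_pos a by real_asymp
  then have "eventually (\<lambda>L. exp (- (t * real L * a)) * T < 1 / 2) sequentially"
    by (rule order_tendstoD) simp
  then obtain L where L: "exp (- (t * real L * a)) * T < 1 / 2"
    using eventually_happens' sequentially_bot by blast
  define A where "A = {\<omega>\<in>space S. \<forall>i\<in>{..L}. \<omega> i \<in> {a..}}"
  have A: "measure S A = measure \<nu> {a..} ^ Suc L"
  proof -
    have "emeasure S A = (\<Prod>i\<in>{..L}. emeasure \<nu> {a..})"
      unfolding A_def by (rule emeasure_PiM_Collect) auto
    then have "emeasure S A = ennreal (measure \<nu> {a..} ^ Suc L)"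
      by (simp add: M.emeasure_eq_measure ennreal_power del: power_Suc)
    then show ?thesis by (simp add: measure_def)
  qed
  have [measurable]: "A \<in> sets S" unfolding A_def by measurable
  define B where "B k = {\<omega>\<in>space S. \<forall>j\<in>{1..k}. - (real L * a) \<le> walk j \<omega>}" for k
  have [measurable]: "B k \<in> sets S" for k unfolding B_def by measurable
  have B: "measure S (B k) \<ge> 1 / 2" for k
  proof -
    define D where "D j = {\<omega>\<in>space S. walk j \<omega> < - (real L * a)}" for j
    have [measurable]: "D j \<in> sets S" for j unfolding D_def by measurable
    have D: "measure S (D j) \<le> exp (- (t * real L * a)) * rate ^ j" for j
    proof -
      have "emeasure S (D j) = (\<integral>\<^sup>+\<omega>. indicator (D j) \<omega> \<partial>S)" by simp
      also have "\<dots> \<le> (\<integral>\<^sup>+\<omega>. ennreal (exp (- (t * real L * a))) * ennreal (exp (- t * walk j \<omega>)) \<partial>S)"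
      proof (rule nn_integral_mono)
        fix \<omega>
        show "indicator (D j) \<omega> \<le> ennreal (exp (- (t * real L * a))) * ennreal (exp (- t * walk j \<omega>))"
        proof (cases "\<omega> \<in> D j")
          case True
          then have "t * walk j \<omega> \<le> t * (- (real L * a))" using t_pos by (intro mult_left_mono) (auto simp: D_def)
          then have "1 \<le> exp (- (t * real L * a) + (- t * walk j \<omega>))" by (simp add: algebra_simps)
          also have "\<dots> = exp (- (t * real L * a)) * exp (- t * walk j \<omega>)" by (rule exp_add)
          finally show ?thesis using True by (simp add: ennreal_mult'[symmetric])
        qed simp
      qed
      also have "\<dots> = ennreal (exp (- (t * real L * a))) * (\<integral>\<^sup>+\<omega>. ennreal (exp (- t * walk j \<omega>)) \<partial>S)"
        by (rule nn_integral_cmult) measurable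
      also have "\<dots> = ennreal (exp (- (t * real L * a)) * rate ^ j)"
        unfolding nn_integral_exp_neg_walk using rate by (intro ennreal_mult[symmetric]) auto
      finally show ?thesis using rate by (simp add: P.emeasure_eq_measure)
    qed
    have eq: "space S - B k = (\<Union>j\<in>{1..k}. D j)" by (auto simp: B_def D_def not_le)
    have "measure S (space S - B k) \<le> (\<Sum>j\<in>{1..k}. measure S (D j))"
      unfolding eq by (rule P.finite_measure_subadditive_finite) auto
    also have "\<dots> \<le> (\<Sum>j\<in>{1..k}. exp (- (t * real L * a)) * rate ^ j)" by (intro sum_mono D)
    also have "\<dots> = exp (- (t * real L * a)) * (\<Sum>j\<in>{1..k}. rate ^ j)" by (simp add: sum_distrib_left)
    also have "\<dots> \<le> exp (- (t * real L * a)) * T"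
    proof (rule mult_left_mono)
      have "(\<Sum>j\<in>{1..k}. rate ^ j) \<le> (\<Sum>j. rate ^ j)" using rate by (intro sum_le_suminf) (auto intro: summable_geometric)
      also have "\<dots> = T" using rate by (simp add: suminf_geometric T_def)
      finally show "(\<Sum>j\<in>{1..k}. rate ^ j) \<le> T" .
    qed simp
    finally show ?thesis using L by (subst (asm) P.prob_compl) auto
  qed
  define p where "p = measure \<nu> {a..} ^ Suc L / 2"
  have "p > 0" using q by (simp add: p_def)
  moreover have "measure S {\<omega>\<in>space S. \<forall>j\<in>{1..k}. a \<le> walk j \<omega>} \<ge> p" for k
  proof -
    let ?E = "{\<omega>\<in>space S. \<forall>j\<in>{1..k}. a \<le> walk j \<omega>}"
    have E_comb: "comb_seq (Suc L) \<omega> \<omega>' \<in> ?E" if "\<omega> \<in> A" "\<omega>' \<in> B k" for \<omega> \<omega>'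
    proof -
      have long: "walk j \<omega> \<ge> real j * a" if "j \<le> Suc L" for j
      proof -
        have "(\<Sum>i<j. a) \<le> (\<Sum>i<j. \<omega> i)" using \<open>\<omega> \<in> A\<close> that by (intro sum_mono) (auto simp: A_def)
        then show ?thesis by (simp add: walk_def)
      qed
      have "a \<le> walk j (comb_seq (Suc L) \<omega> \<omega>')" if "j \<in> {1..k}" for j
      proof (cases "j \<le> Suc L")
        case True
        have "1 * a \<le> real j * a" using that a by (intro mult_right_mono) auto
        then show ?thesis using long[OF True] True by (simp add: walk_comb_seq_le)
      next
        case False
        then have "walk j (comb_seq (Suc L) \<omega> \<omega>') = walk (Suc L) \<omega> + walk (j - Suc L) \<omega>'"
          using walk_comb_seq_add[of "Suc L" "j - Suc L"] by simp
        moreover have "walk (j - Suc L) \<omega>' \<ge> - (real L * a)"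
        proof -
          have "j - Suc L \<in> {1..k}" using that False by auto
          then show ?thesis using \<open>\<omega>' \<in> B k\<close> unfolding B_def by blast
        qed
        moreover have "walk (Suc L) \<omega> \<ge> real (Suc L) * a" by (rule long) simp
        ultimately show ?thesis by (simp add: algebra_simps)
      qed
      then show ?thesis by (auto simp: space_PiM)
    qed
    have "ennreal p \<le> ennreal (measure S A * measure S (B k))"
      using B[of k] q unfolding A p_def by (intro ennreal_leI) (auto simp: field_simps)
    also have "\<dots> = (\<integral>\<^sup>+\<omega>. indicator A \<omega> * (\<integral>\<^sup>+\<omega>'. indicator (B k) \<omega>' \<partial>S) \<partial>S)"
      by (simp add: P.emeasure_eq_measure ennreal_mult nn_integral_multc)
    also have "\<dots> = (\<integral>\<^sup>+\<omega>. (\<integral>\<^sup>+\<omega>'. indicator A \<omega> * indicator (B k) \<omega>' \<partial>S) \<partial>S)"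
      by (intro nn_integral_cong nn_integral_cmult[symmetric]) measurable
    also have "\<dots> \<le> (\<integral>\<^sup>+\<omega>. (\<integral>\<^sup>+\<omega>'. indicator ?E (comb_seq (Suc L) \<omega> \<omega>') \<partial>S) \<partial>S)"
      using E_comb by (intro nn_integral_mono) (auto simp: indicator_def)
    also have "\<dots> = (\<integral>\<^sup>+\<omega>. indicator ?E \<omega> \<partial>S)" by (rule nn_integral_comb_seq[symmetric]) measurable
    also have "\<dots> = ennreal (measure S ?E)" by (simp add: P.emeasure_eq_measure)
    finally show ?thesis by simp
  qed
  ultimately show ?thesis using a by blast
qed

lemma integrable_prefix: "integrable S (\<lambda>\<omega>. (1 - exp (- \<beta> * max 0 (running_min k \<omega>))) / \<beta>)"
proof (rule P.integrable_const_bound[of _ "1 / \<beta>"])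
  show "AE \<omega> in S. norm ((1 - exp (- \<beta> * max 0 (running_min k \<omega>))) / \<beta>) \<le> 1 / \<beta>"
  proof (rule AE_I2)
    fix \<omega>
    have "exp (- \<beta> * max 0 (running_min k \<omega>)) \<le> 1" using \<beta>_pos by simp
    then have "\<bar>1 - exp (- \<beta> * max 0 (running_min k \<omega>))\<bar> \<le> 1"
      using exp_ge_zero[of "- \<beta> * max 0 (running_min k \<omega>)"] by linarith
    then show "norm ((1 - exp (- \<beta> * max 0 (running_min k \<omega>))) / \<beta>) \<le> 1 / \<beta>"
      using \<beta>_pos unfolding real_norm_def abs_divide by (simp add: divide_right_mono)
  qed
qed measurable

lemma prefix_constant_lower: "\<exists>c0>0. \<forall>k\<ge>1. c0 \<le> prefix_constant k"
proof -
  obtain a p where a: "a > 0" and p: "p > 0" and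
    E: "\<And>k. measure S {\<omega>\<in>space S. \<forall>j\<in>{1..k}. a \<le> walk j \<omega>} \<ge> p"
    using walk_stays_above by blast
  define b where "b = (1 - exp (- \<beta> * a)) / \<beta>"
  have b: "b > 0" using \<beta>_pos a by (simp add: b_def)
  have "b * p / (\<sigma> * sqrt (2 * pi)) \<le> prefix_constant k" if "k \<ge> 1" for k
  proof -
    let ?E = "{\<omega>\<in>space S. \<forall>j\<in>{1..k}. a \<le> walk j \<omega>}"
    have "b * p \<le> b * measure S ?E" using E[of k] b by simp
    also have "\<dots> = (\<integral>\<omega>. b * indicator ?E \<omega> \<partial>S)" by simp
    also have "\<dots> \<le> (\<integral>\<omega>. (1 - exp (- \<beta> * max 0 (running_min k \<omega>))) / \<beta> \<partial>S)"
    proof (rule integral_mono[OF _ integrable_prefix])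
      show "integrable S (\<lambda>\<omega>. b * indicator ?E \<omega>)"
        using b by (intro P.integrable_const_bound[of _ b]) (auto simp: indicator_def)
      fix \<omega>
      show "b * indicator ?E \<omega> \<le> (1 - exp (- \<beta> * max 0 (running_min k \<omega>))) / \<beta>"
      proof (cases "\<omega> \<in> ?E")
        case True
        then have "a \<le> running_min k \<omega>" using le_running_min_iff[OF that] by auto
        then have "\<beta> * a \<le> \<beta> * max 0 (running_min k \<omega>)" using \<beta>_pos by (intro mult_left_mono) auto
        then show ?thesis using True \<beta>_pos by (simp add: b_def divide_right_mono)
      next
        case False then show ?thesis using \<beta>_pos by simp
      qed
    qed
    finally show ?thesis unfolding prefix_constant_def using C.sd_pos by (intro divide_right_mono) auto
  qed
  moreover have "b * p / (\<sigma> * sqrt (2 * pi)) > 0" using b p C.sd_pos by simp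
  ultimately show ?thesis by blast
qed

lemma prefix_constant_decreasing: "decseq (\<lambda>k. prefix_constant (Suc k))"
proof (rule decseq_SucI)
  fix k
  have "running_min (Suc (Suc k)) \<omega> \<le> running_min (Suc k) \<omega>" for \<omega>
    unfolding running_min_def by (intro Min_antimono) auto
  then have "max 0 (running_min (Suc (Suc k)) \<omega>) \<le> max 0 (running_min (Suc k) \<omega>)" for \<omega>
    by (intro max.mono) auto
  then have "(1 - exp (- \<beta> * max 0 (running_min (Suc (Suc k)) \<omega>))) / \<beta> \<le>
      (1 - exp (- \<beta> * max 0 (running_min (Suc k) \<omega>))) / \<beta>" for \<omega>
    using \<beta>_pos by (intro divide_right_mono diff_left_mono) (auto intro!: mult_left_mono simp del: max.bounded_iff)
  then show "prefix_constant (Suc (Suc k)) \<le> prefix_constant (Suc k)"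
    unfolding prefix_constant_def using C.sd_pos
    by (intro divide_right_mono[OF integral_mono[OF integrable_prefix integrable_prefix]]) auto
qed

text \<open>
  Since n \<le> (n - j + 1) (j + 1), the factor sqrt n costs at most j + 1 in the j-th summand, and the
  errors become tails of the convergent series of (j + 1) rate^j.
\<close>

lemma prefix_error_scaled:
  "\<exists>e. e \<longlonglongrightarrow> 0 \<and> (\<forall>k n u. k \<le> n \<longrightarrow> sqrt n * (\<integral>\<omega>. staying_weight \<beta> k n u \<omega> \<partial>S) - e k \<le>
     sqrt n * (\<integral>\<omega>. staying_weight \<beta> n n u \<omega> \<partial>S))"
proof -
  obtain K where K: "K > 0" and err: "\<And>k n u. k \<le> n \<Longrightarrow> (\<integral>\<omega>. staying_weight \<beta> k n u \<omega> \<partial>S) \<le>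
     (\<integral>\<omega>. staying_weight \<beta> n n u \<omega> \<partial>S) + (\<Sum>j\<in>{k<..n}. rate ^ j * (K / sqrt (real (n - j + 1))))"
    using prefix_error by blast
  define f where "f j = K * (real (Suc j) * rate ^ j)" for j
  have "summable (\<lambda>j. real (Suc j) * rate ^ j)"
    using geometric_deriv_sums[of rate] rate by (auto simp: sums_iff)
  then have f: "summable f" unfolding f_def by (rule summable_mult)
  have f0: "0 \<le> f j" for j using K rate by (simp add: f_def)
  define e where "e k = suminf f - (\<Sum>j<Suc k. f j)" for k
  have "(\<lambda>k. \<Sum>j<k. f j) \<longlonglongrightarrow> suminf f" using f by (rule summable_LIMSEQ)
  then have "(\<lambda>k. suminf f - (\<Sum>j<Suc k. f j)) \<longlonglongrightarrow> suminf f - suminf f"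
    by (intro tendsto_intros LIMSEQ_Suc)
  then have "e \<longlonglongrightarrow> 0" by (simp add: e_def[abs_def])
  moreover have "sqrt n * (\<integral>\<omega>. staying_weight \<beta> k n u \<omega> \<partial>S) - e k \<le>
     sqrt n * (\<integral>\<omega>. staying_weight \<beta> n n u \<omega> \<partial>S)" if "k \<le> n" for k n u
  proof -
    have "sqrt n * (\<Sum>j\<in>{k<..n}. rate ^ j * (K / sqrt (real (n - j + 1)))) \<le> (\<Sum>j\<in>{k<..n}. f j)"
      unfolding sum_distrib_left
    proof (rule sum_mono)
      fix j assume j: "j \<in> {k<..n}"
      have "real n \<le> real (n - j + 1) * real (Suc j)"
      proof -
        obtain d where "n = j + d" using j by (metis greaterThanAtMost_iff le_iff_add)
        then show ?thesis by (simp add: algebra_simps)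
      qed
      then have "sqrt n \<le> sqrt (real (n - j + 1)) * sqrt (real (Suc j))"
        by (metis real_sqrt_le_iff real_sqrt_mult)
      also have "sqrt (real (Suc j)) \<le> real (Suc j)"
        using real_sqrt_le_mono[of "real (Suc j)" "(real (Suc j))\<^sup>2"] self_le_power[of "real (Suc j)" 2] by simp
      finally have "sqrt n \<le> sqrt (real (n - j + 1)) * real (Suc j)" by (simp add: mult_left_mono)
      then have "sqrt n / sqrt (real (n - j + 1)) \<le> real (Suc j)" by (simp add: divide_le_eq mult.commute)
      then have "(rate ^ j * K) * (sqrt n / sqrt (real (n - j + 1))) \<le> (rate ^ j * K) * real (Suc j)"
        using K rate by (intro mult_left_mono) auto
      then show "sqrt n * (rate ^ j * (K / sqrt (real (n - j + 1)))) \<le> f j"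
        by (simp add: f_def algebra_simps)
    qed
    also have "(\<Sum>j\<in>{k<..n}. f j) = (\<Sum>j<Suc n. f j) - (\<Sum>j<Suc k. f j)"
    proof -
      have "sum f ({..<Suc k} \<union> {k<..n}) = (\<Sum>j<Suc k. f j) + (\<Sum>j\<in>{k<..n}. f j)"
        by (rule sum.union_disjoint) auto
      moreover have "{..<Suc k} \<union> {k<..n} = {..<Suc n}" using that by auto
      ultimately show ?thesis by (simp del: sum.lessThan_Suc)
    qed
    also have "\<dots> \<le> e k" unfolding e_def using sum_le_suminf[OF f, of "{..<Suc n}"] f0 by simp
    finally have 1: "sqrt n * (\<Sum>j\<in>{k<..n}. rate ^ j * (K / sqrt (real (n - j + 1)))) \<le> e k" .
    have "sqrt n * (\<integral>\<omega>. staying_weight \<beta> k n u \<omega> \<partial>S) \<le> sqrt n *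
      ((\<integral>\<omega>. staying_weight \<beta> n n u \<omega> \<partial>S) + (\<Sum>j\<in>{k<..n}. rate ^ j * (K / sqrt (real (n - j + 1)))))"
      by (intro mult_left_mono err that) auto
    with 1 show ?thesis by (simp add: distrib_left)
  qed
  ultimately show ?thesis by blast
qed

theorem staying_weight_limit:
  "\<exists>c>0. \<forall>N u B. filterlim N at_top sequentially \<longrightarrow> (\<forall>i. \<bar>u i - real (N i) * \<rho>\<bar> \<le> B) \<longrightarrow>
     (\<lambda>i. sqrt (N i) * (\<integral>\<omega>. staying_weight \<beta> (N i) (N i) (u i) \<omega> \<partial>S)) \<longlonglongrightarrow> c"
proof -
  obtain c0 where c0: "c0 > 0" "\<And>k. k \<ge> 1 \<Longrightarrow> c0 \<le> prefix_constant k"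
    using prefix_constant_lower by blast
  obtain c where c: "(\<lambda>k. prefix_constant (Suc k)) \<longlonglongrightarrow> c"
    by (rule decseq_convergent[OF prefix_constant_decreasing, of c0]) (use c0(2) in auto)
  have "c0 \<le> c" using c0(2) by (intro LIMSEQ_le_const[OF c]) auto
  then have "c > 0" using c0 by simp
  obtain e where e: "e \<longlonglongrightarrow> 0" and err: "\<And>k n u. k \<le> n \<Longrightarrow>
      sqrt n * (\<integral>\<omega>. staying_weight \<beta> k n u \<omega> \<partial>S) - e k \<le> sqrt n * (\<integral>\<omega>. staying_weight \<beta> n n u \<omega> \<partial>S)"
    using prefix_error_scaled by blast
  have "(\<lambda>i. sqrt (N i) * (\<integral>\<omega>. staying_weight \<beta> (N i) (N i) (u i) \<omega> \<partial>S)) \<longlonglongrightarrow> c"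
    if N: "filterlim N at_top sequentially" and u: "\<And>i. \<bar>u i - real (N i) * \<rho>\<bar> \<le> B" for N u B
  proof (rule tendsto_of_approximations[OF prefix_limit[OF _ N u] c LIMSEQ_Suc[OF e]])
    fix k
    show "Suc k \<ge> 1" by simp
    have ev: "eventually (\<lambda>i. N i \<ge> Suc k) sequentially" using N by (simp add: filterlim_at_top)
    then show "eventually (\<lambda>i. sqrt (N i) * (\<integral>\<omega>. staying_weight \<beta> (N i) (N i) (u i) \<omega> \<partial>S) \<le>
        sqrt (N i) * (\<integral>\<omega>. staying_weight \<beta> (Suc k) (N i) (u i) \<omega> \<partial>S)) sequentially"
    proof eventually_elim
      case (elim i)
      show ?case
        using elim killed_exp_bounds[of \<beta>] \<beta>_pos
        by (intro mult_left_mono integral_mono integrable_staying_weight) (auto simp: staying_weight_def)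
    qed
    from ev show "eventually (\<lambda>i. sqrt (N i) * (\<integral>\<omega>. staying_weight \<beta> (Suc k) (N i) (u i) \<omega> \<partial>S) - e (Suc k) \<le>
        sqrt (N i) * (\<integral>\<omega>. staying_weight \<beta> (N i) (N i) (u i) \<omega> \<partial>S)) sequentially"
      by eventually_elim (rule err)
  qed
  with \<open>c > 0\<close> show ?thesis by blast
qed

end

section \<open>Exponential tilting and time reversal\<close>

lemma first_passage_eq_iff:
  "first_passage X u \<omega> = enat n \<longleftrightarrow> partial_sum X n \<omega> > u \<and> (\<forall>m<n. partial_sum X m \<omega> \<le> u)"
proof
  assume eq: "first_passage X u \<omega> = enat n"
  have "{n. partial_sum X n \<omega> > u} \<noteq> {}"
  proof
    assume "{n. partial_sum X n \<omega> > u} = {}"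
    then have "first_passage X u \<omega> = \<infinity>" by (simp only: first_passage_def image_empty Inf_empty top_enat_def)
    then show False using eq by simp
  qed
  then have "enat ` {n. partial_sum X n \<omega> > u} \<noteq> {}" by simp
  then have "first_passage X u \<omega> \<in> enat ` {n. partial_sum X n \<omega> > u}"
    unfolding first_passage_def Inf_enat_def by (auto intro: LeastI)
  then have 1: "partial_sum X n \<omega> > u" using eq by auto
  have "partial_sum X m \<omega> \<le> u" if "m < n" for m
  proof (rule ccontr)
    assume "\<not> ?thesis"
    then have "first_passage X u \<omega> \<le> enat m"
      unfolding first_passage_def by (intro INF_lower) auto
    then show False using eq that by simp
  qed
  with 1 show "partial_sum X n \<omega> > u \<and> (\<forall>m<n. partial_sum X m \<omega> \<le> u)" by blast
next
  assume n: "partial_sum X n \<omega> > u \<and> (\<forall>m<n. partial_sum X m \<omega> \<le> u)"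
  show "first_passage X u \<omega> = enat n"
    unfolding first_passage_def
  proof (rule antisym)
    show "(INF n \<in> {n. partial_sum X n \<omega> > u}. enat n) \<le> enat n" using n by (intro INF_lower) auto
    show "enat n \<le> (INF n \<in> {n. partial_sum X n \<omega> > u}. enat n)"
      using n by (intro INF_greatest) (auto simp: not_less[symmetric])
  qed
qed

text \<open>
  On rectangles both sides factor into one-dimensional integrals.
\<close>

lemma density_PiM:
  fixes f :: "'a \<Rightarrow> ennreal"
  assumes "prob_space M" "prob_space (density M f)" and [measurable]: "f \<in> borel_measurable M"
    and I: "finite I"
  shows "PiM I (\<lambda>_. density M f) = density (PiM I (\<lambda>_. M)) (\<lambda>x. \<Prod>i\<in>I. f (x i))"
proof -
  interpret M: prob_space M by fact
  interpret D: prob_space "density M f" by fact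
  interpret PM: product_sigma_finite "\<lambda>_. M" ..
  interpret PD: product_sigma_finite "\<lambda>_. density M f" ..
  have sets_eq: "sets (PiM I (\<lambda>_. M)) = sets (PiM I (\<lambda>_. density M f))"
    by (intro sets_PiM_cong) auto
  have [measurable]: "(\<lambda>x. \<Prod>i\<in>I. f (x i)) \<in> borel_measurable (PiM I (\<lambda>_. M))"
    by measurable
  show ?thesis
  proof (rule PD.PiM_eqI[symmetric, OF I])
    show "sets (density (PiM I (\<lambda>_. M)) (\<lambda>x. \<Prod>i\<in>I. f (x i))) = sets (PiM I (\<lambda>_. density M f))"
      using sets_eq by simp
    fix A assume A: "\<And>i. i \<in> I \<Longrightarrow> A i \<in> sets (density M f)"
    then have A': "\<And>i. i \<in> I \<Longrightarrow> A i \<in> sets M" by simp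
    have [measurable]: "Pi\<^sub>E I A \<in> sets (PiM I (\<lambda>_. M))" using A' I by (intro sets_PiM_I_finite) auto
    have "emeasure (density (PiM I (\<lambda>_. M)) (\<lambda>x. \<Prod>i\<in>I. f (x i))) (Pi\<^sub>E I A) =
        (\<integral>\<^sup>+x. (\<Prod>i\<in>I. f (x i)) * indicator (Pi\<^sub>E I A) x \<partial>PiM I (\<lambda>_. M))"
      by (rule emeasure_density) measurable
    also have "\<dots> = (\<integral>\<^sup>+x. (\<Prod>i\<in>I. f (x i) * indicator (A i) (x i)) \<partial>PiM I (\<lambda>_. M))"
    proof (rule nn_integral_cong)
      fix x assume "x \<in> space (PiM I (\<lambda>_. M))"
      then have "x \<in> extensional I" by (auto simp: space_PiM PiE_def)
      then have "indicator (Pi\<^sub>E I A) x = (\<Prod>i\<in>I. indicator (A i) (x i) :: ennreal)"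
        using I by (auto simp: indicator_def PiE_def Pi_def prod_zero_iff)
      then show "(\<Prod>i\<in>I. f (x i)) * indicator (Pi\<^sub>E I A) x = (\<Prod>i\<in>I. f (x i) * indicator (A i) (x i))"
        by (simp add: prod.distrib)
    qed
    also have "\<dots> = (\<Prod>i\<in>I. \<integral>\<^sup>+x. f x * indicator (A i) x \<partial>M)"
      using A' I by (intro PM.product_nn_integral_prod) auto
    also have "\<dots> = (\<Prod>i\<in>I. emeasure (density M f) (A i))"
      using A' by (intro prod.cong refl emeasure_density[symmetric]) auto
    finally show "emeasure (density (PiM I (\<lambda>_. M)) (\<lambda>x. \<Prod>i\<in>I. f (x i))) (Pi\<^sub>E I A) =
        (\<Prod>i\<in>I. emeasure (density M f) (A i))" .
  qed
qed

text \<open>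
  Independent and identically distributed steps form a product measure, which is invariant under
  permutations of the coordinates.  The reversed enumeration starts at 0, as required for walks.
\<close>

lemma (in prob_space) distr_reversed_iid:
  fixes X :: "nat \<Rightarrow> 'a \<Rightarrow> real"
  assumes indep: "indep_vars (\<lambda>_. borel) X {1..}"
    and ident: "\<And>i. i \<ge> 1 \<Longrightarrow> distr M borel (X i) = distr M borel (X 1)"
    and n: "n \<ge> 1"
  shows "distr M (PiM {..<n} (\<lambda>_. borel)) (\<lambda>\<omega>. \<lambda>i\<in>{..<n}. X (n - i) \<omega>) = PiM {..<n} (\<lambda>_. distr M borel (X 1))"
proof -
  have X[measurable]: "X i \<in> borel_measurable M" if "i \<ge> 1" for i
    using indep that by (auto simp: indep_vars_def2)
  let ?\<mu> = "distr M borel (X 1)"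
  have \<mu>: "prob_space ?\<mu>" by (intro prob_space_distr X) simp
  have "indep_vars (\<lambda>_. borel) X {1..n}" by (rule indep_vars_subset[OF indep]) auto
  then have "distr M (PiM {1..n} (\<lambda>_. borel)) (\<lambda>\<omega>. \<lambda>i\<in>{1..n}. X i \<omega>) = PiM {1..n} (\<lambda>i. distr M borel (X i))"
    using n X by (subst (asm) indep_vars_iff_distr_eq_PiM') auto
  also have "\<dots> = PiM {1..n} (\<lambda>_. ?\<mu>)" by (intro PiM_cong ident) auto
  finally have law: "distr M (PiM {1..n} (\<lambda>_. borel)) (\<lambda>\<omega>. \<lambda>i\<in>{1..n}. X i \<omega>) = PiM {1..n} (\<lambda>_. ?\<mu>)" .
  have "PiM {..<n} (\<lambda>_. ?\<mu>) = distr (PiM {1..n} (\<lambda>_. ?\<mu>)) (PiM {..<n} (\<lambda>_. ?\<mu>)) (\<lambda>x. \<lambda>i\<in>{..<n}. x (n - i))"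
    by (rule distr_PiM_reindex[symmetric]) (use \<mu> in \<open>auto simp: inj_on_def\<close>)
  also have "\<dots> = distr (PiM {1..n} (\<lambda>_. ?\<mu>)) (PiM {..<n} (\<lambda>_. borel)) (\<lambda>x. \<lambda>i\<in>{..<n}. x (n - i))"
    by (intro distr_cong refl sets_PiM_cong) auto
  also have "\<dots> = distr M (PiM {..<n} (\<lambda>_. borel)) ((\<lambda>x. \<lambda>i\<in>{..<n}. x (n - i)) \<circ> (\<lambda>\<omega>. \<lambda>i\<in>{1..n}. X i \<omega>))"
    unfolding law[symmetric]
    by (intro distr_distr measurable_restrict) (auto intro!: measurable_component_singleton X)
  also have "(\<lambda>x. \<lambda>i\<in>{..<n}. x (n - i)) \<circ> (\<lambda>\<omega>. \<lambda>i\<in>{1..n}. X i \<omega>) = (\<lambda>\<omega>. \<lambda>i\<in>{..<n}. X (n - i) \<omega>)"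
    by (auto simp: fun_eq_iff)
  finally show ?thesis ..
qed

lemma partial_sum_eq_reversed_walk:
  assumes "m \<le> n"
  shows "partial_sum X m \<omega> = walk n (\<lambda>i\<in>{..<n}. X (n - i) \<omega>) - walk (n - m) (\<lambda>i\<in>{..<n}. X (n - i) \<omega>)"
proof -
  define x where "x = (\<lambda>i\<in>{..<n}. X (n - i) \<omega>)"
  have "{..<n} = {..<n - m} \<union> {n - m..<n}" by auto
  then have "walk n x = walk (n - m) x + (\<Sum>i\<in>{n - m..<n}. x i)"
    unfolding walk_def by (metis sum.union_disjoint finite_atLeastLessThan finite_lessThan ivl_disj_int_one(2))
  also have "(\<Sum>i\<in>{n - m..<n}. x i) = (\<Sum>i=1..m. X i \<omega>)"
    using assms by (intro sum.reindex_bij_witness[of _ "\<lambda>i. n - i" "\<lambda>i. n - i"]) (auto simp: x_def)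
  finally show ?thesis unfolding x_def[symmetric] partial_sum_def by simp
qed

text \<open>
  In terms of the reversed steps S_m is walk n - walk (n - m), so the condition S_m \<le> u for m < n
  becomes walk n - u \<le> walk j with j = n - m.
\<close>

lemma first_passage_eq_reversed:
  fixes X :: "nat \<Rightarrow> 'a \<Rightarrow> real"
  assumes "n \<ge> 1"
  defines "x \<omega> \<equiv> \<lambda>i\<in>{..<n}. X (n - i) \<omega>"
  shows "first_passage X u \<omega> = enat n \<longleftrightarrow>
    u < walk n (x \<omega>) \<and> (\<forall>j\<in>{1..n}. walk n (x \<omega>) - u \<le> walk j (x \<omega>))"
proof -
  have ps: "partial_sum X m \<omega> = walk n (x \<omega>) - walk (n - m) (x \<omega>)" if "m \<le> n" for m
    unfolding x_def by (rule partial_sum_eq_reversed_walk[OF that])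
  have "(\<forall>m<n. partial_sum X m \<omega> \<le> u) \<longleftrightarrow> (\<forall>j\<in>{1..n}. walk n (x \<omega>) - u \<le> walk j (x \<omega>))"
  proof safe
    fix j assume "\<forall>m<n. partial_sum X m \<omega> \<le> u" "j \<in> {1..n}"
    then have "partial_sum X (n - j) \<omega> \<le> u" by auto
    then show "walk n (x \<omega>) - u \<le> walk j (x \<omega>)" using ps[of "n - j"] \<open>j \<in> {1..n}\<close> by simp
  next
    fix m assume "\<forall>j\<in>{1..n}. walk n (x \<omega>) - u \<le> walk j (x \<omega>)" "m < n"
    then have "walk n (x \<omega>) - u \<le> walk (n - m) (x \<omega>)" by auto
    then show "partial_sum X m \<omega> \<le> u" using ps[of m] \<open>m < n\<close> by simp
  qed
  then show ?thesis unfolding first_passage_eq_iff using ps[of n] by simp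
qed

text \<open>
  For l = E[exp(alpha X)] this is the probability measure of the exponential family (Cramer's
  transform).
\<close>

definition tilted :: "real measure \<Rightarrow> real \<Rightarrow> real \<Rightarrow> real measure" where
  "tilted \<mu> \<alpha> l = density \<mu> (\<lambda>x. ennreal (exp (\<alpha> * x) / l))"

lemma real_distribution_tilted:
  assumes [measurable_cong]: "sets \<mu> = sets borel" and l: "l > 0" "(\<integral>\<^sup>+x. ennreal (exp (\<alpha> * x)) \<partial>\<mu>) = ennreal l"
  shows "real_distribution (tilted \<mu> \<alpha> l)"
proof -
  have "emeasure (tilted \<mu> \<alpha> l) (space (tilted \<mu> \<alpha> l)) = (\<integral>\<^sup>+x. ennreal (exp (\<alpha> * x) / l) \<partial>\<mu>)"
    unfolding tilted_def by (subst emeasure_density) (auto intro!: nn_integral_cong)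
  also have "\<dots> = (\<integral>\<^sup>+x. ennreal (1 / l) * ennreal (exp (\<alpha> * x)) \<partial>\<mu>)"
    using l by (intro nn_integral_cong) (simp add: ennreal_mult'[symmetric])
  also have "\<dots> = ennreal (1 / l) * ennreal l" unfolding l(2)[symmetric] by (rule nn_integral_cmult) measurable
  also have "\<dots> = 1" using l by (simp add: ennreal_mult'[symmetric])
  finally have "prob_space (tilted \<mu> \<alpha> l)" by (rule prob_spaceI)
  then show ?thesis unfolding real_distribution_def real_distribution_axioms_def tilted_def
    using assms(1) by (auto dest: sets_eq_imp_space_eq)
qed

text \<open>
  The density of n tilted steps is exp(alpha S_n) / l^n, so that undoing the tilt multiplies the
  integrand by l^n exp(- alpha S_n) = l^n exp(- alpha u) exp(- alpha (S_n - u)).  This is done on the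
  finite product of the first n coordinates, where the densities exist; the result is then moved to
  sequence space, on which all the walks of different lengths live together.
\<close>

lemma (in prob_space) prob_first_passage_eq:
  fixes X :: "nat \<Rightarrow> 'a \<Rightarrow> real"
  assumes indep: "indep_vars (\<lambda>_. borel) X {1..}"
    and ident: "\<And>i. i \<ge> 1 \<Longrightarrow> distr M borel (X i) = distr M borel (X 1)"
    and l: "l > 0" "(\<integral>\<^sup>+x. ennreal (exp (\<alpha> * x)) \<partial>distr M borel (X 1)) = ennreal l"
    and \<alpha>: "\<alpha> \<ge> 0"
    and n: "n \<ge> 1"
  defines "\<nu> \<equiv> tilted (distr M borel (X 1)) \<alpha> l"
  shows "prob {\<omega>\<in>space M. first_passage X u \<omega> = enat n} =
    l ^ n * exp (- \<alpha> * u) * (\<integral>\<omega>. staying_weight \<alpha> n n u \<omega> \<partial>PiM UNIV (\<lambda>_. \<nu>))"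
proof -
  define \<mu> where "\<mu> = distr M borel (X 1)"
  have X[measurable]: "X i \<in> borel_measurable M" if "i \<ge> 1" for i
    using indep that by (auto simp: indep_vars_def2)
  note law = distr_reversed_iid[OF indep ident n] and emeasure_M = emeasure_eq_measure
  interpret mu: prob_space \<mu> unfolding \<mu>_def by (intro prob_space_distr X) simp
  have nu: "real_distribution \<nu>" unfolding \<nu>_def by (intro real_distribution_tilted l) simp
  interpret nu: real_distribution \<nu> by (rule nu)
  interpret iid_sequence \<nu> ..
  define I where "I = {..<n}"
  define B where "B = PiM I (\<lambda>_. borel :: real measure)"
  have sets_mu: "sets \<mu> = sets borel" by (simp add: \<mu>_def)
  have walkB[measurable]: "walk j \<in> borel_measurable B" if "j \<le> n" for j
    unfolding walk_def B_def using that
    by (intro borel_measurable_sum measurable_component_singleton) (auto simp: I_def)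
  have sB[measurable_cong]: "sets (PiM I (\<lambda>_. \<mu>)) = sets B" "sets (PiM I (\<lambda>_. \<nu>)) = sets B"
    unfolding B_def by (auto intro!: sets_PiM_cong simp: sets_mu)
  define w where "w = staying_weight \<alpha> n n u"
  have w0: "0 \<le> w x" "w x \<le> 1" for x unfolding w_def using staying_weight_bounds[OF \<alpha>] by auto
  define A where "A = {x\<in>space B. u < walk n x \<and> (\<forall>j\<in>{1..n}. walk n x - u \<le> walk j x)}"
  have A[measurable]: "A \<in> sets B"
  proof -
    have 1: "{x\<in>space B. \<forall>j\<in>{1..n}. walk n x - u \<le> walk j x} \<in> sets B"
      by (intro sets.sets_Collect_finite_All borel_measurable_le borel_measurable_diff walkB) auto
    have 2: "{x\<in>space B. u < walk n x} \<in> sets B" by (intro borel_measurable_less walkB) auto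
    show ?thesis unfolding A_def by (rule sets.sets_Collect_conj[OF 1 2])
  qed
  have w_eq: "exp (- \<alpha> * walk n x) * indicator A x = exp (- \<alpha> * u) * w x" if "x \<in> space B" for x
    using that unfolding A_def w_def
    by (auto simp: staying_weight_def killed_exp_def indicator_def exp_add[symmetric] algebra_simps)
  have wB[measurable]: "w \<in> borel_measurable B"
  proof -
    have "(\<lambda>x. exp (\<alpha> * u) * (exp (- \<alpha> * walk n x) * indicator A x)) \<in> borel_measurable B"
      using walkB[of n] A by measurable
    moreover have "exp (\<alpha> * u) * (exp (- \<alpha> * walk n x) * indicator A x) = w x" if "x \<in> space B" for x
      unfolding w_eq[OF that] by (simp add: mult.assoc[symmetric] exp_add[symmetric])
    ultimately show ?thesis by (rule measurable_cong[THEN iffD1, rotated])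
  qed
  let ?x = "\<lambda>\<omega>. \<lambda>i\<in>I. X (n - i) \<omega>"
  have xm: "?x \<in> measurable M B"
    unfolding B_def by (intro measurable_restrict X) (auto simp: I_def)
  have "emeasure M {\<omega>\<in>space M. first_passage X u \<omega> = enat n} = emeasure M (?x -` A \<inter> space M)"
    using measurable_space[OF xm]
    by (intro arg_cong[where f="emeasure M"]) (auto simp: A_def first_passage_eq_reversed[OF n] I_def)
  also have "\<dots> = emeasure (distr M B ?x) A" by (rule emeasure_distr[symmetric, OF xm A])
  also have "distr M B ?x = PiM I (\<lambda>_. \<mu>)"
    using law by (simp add: I_def B_def \<mu>_def)
  also have "emeasure (PiM I (\<lambda>_. \<mu>)) A = (\<integral>\<^sup>+x. indicator A x \<partial>PiM I (\<lambda>_. \<mu>))"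
    using A by (simp add: sB)
  also have "\<dots> = (\<integral>\<^sup>+x. (\<Prod>i\<in>I. ennreal (exp (\<alpha> * x i) / l)) * (ennreal (l ^ n * exp (- \<alpha> * u)) * ennreal (w x)) \<partial>PiM I (\<lambda>_. \<mu>))"
  proof (rule nn_integral_cong)
    fix x assume "x \<in> space (PiM I (\<lambda>_. \<mu>))"
    then have x: "x \<in> space B" using sB(1)[THEN sets_eq_imp_space_eq] by simp
    have "(\<Prod>i\<in>I. exp (\<alpha> * x i) / l) = exp (\<alpha> * walk n x) / l ^ n"
      by (simp add: prod_dividef exp_sum[symmetric] sum_distrib_left walk_def I_def)
    then have "(\<Prod>i\<in>I. exp (\<alpha> * x i) / l) * (l ^ n * exp (- \<alpha> * u) * w x) =
        exp (\<alpha> * walk n x) * (exp (- \<alpha> * walk n x) * indicator A x)"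
      using l unfolding w_eq[OF x] by simp
    also have "\<dots> = indicator A x" by (simp add: mult.assoc[symmetric] exp_add[symmetric])
    finally have eq: "(\<Prod>i\<in>I. exp (\<alpha> * x i) / l) * (l ^ n * exp (- \<alpha> * u) * w x) = indicator A x" .
    have "(\<Prod>i\<in>I. ennreal (exp (\<alpha> * x i) / l)) * (ennreal (l ^ n * exp (- \<alpha> * u)) * ennreal (w x)) =
        ennreal ((\<Prod>i\<in>I. exp (\<alpha> * x i) / l) * (l ^ n * exp (- \<alpha> * u) * w x))"
      using l w0 by (simp add: prod_ennreal ennreal_mult prod_nonneg)
    then show "indicator A x = (\<Prod>i\<in>I. ennreal (exp (\<alpha> * x i) / l)) * (ennreal (l ^ n * exp (- \<alpha> * u)) * ennreal (w x))"
      unfolding eq by (simp add: indicator_def)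
  qed
  also have "\<dots> = (\<integral>\<^sup>+x. ennreal (l ^ n * exp (- \<alpha> * u)) * ennreal (w x) \<partial>PiM I (\<lambda>_. \<nu>))"
  proof -
    have D: "PiM I (\<lambda>_. \<nu>) = density (PiM I (\<lambda>_. \<mu>)) (\<lambda>x. \<Prod>i\<in>I. ennreal (exp (\<alpha> * x i) / l))"
      unfolding \<nu>_def tilted_def \<mu>_def[symmetric]
    proof (rule density_PiM)
      show "prob_space (density \<mu> (\<lambda>x. ennreal (exp (\<alpha> * x) / l)))"
        using nu unfolding real_distribution_def \<nu>_def tilted_def \<mu>_def[symmetric] by simp
      show "prob_space \<mu>" by (rule mu.prob_space_axioms)
    qed (auto simp: I_def \<mu>_def)
    have [measurable]: "(\<lambda>x. \<Prod>i\<in>I. ennreal (exp (\<alpha> * x i) / l)) \<in> borel_measurable (PiM I (\<lambda>_. \<mu>))"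
      by (intro borel_measurable_prod_ennreal measurable_compose[OF measurable_component_singleton]) (auto simp: \<mu>_def)
    show ?thesis unfolding D by (rule nn_integral_density[symmetric]) measurable
  qed
  also have "\<dots> = ennreal (l ^ n * exp (- \<alpha> * u)) * (\<integral>\<^sup>+x. ennreal (w x) \<partial>PiM I (\<lambda>_. \<nu>))"
    by (rule nn_integral_cmult) measurable
  also have "(\<integral>\<^sup>+x. ennreal (w x) \<partial>PiM I (\<lambda>_. \<nu>)) = (\<integral>\<^sup>+\<omega>. ennreal (w \<omega>) \<partial>S)"
  proof -
    have w_restrict: "w (restrict \<omega> I) = w \<omega>" for \<omega>
    proof -
      have "walk j (restrict \<omega> I) = walk j \<omega>" if "j \<le> n" for j
        using that unfolding walk_def by (intro sum.cong) (auto simp: I_def)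
      then show ?thesis by (simp add: w_def staying_weight_def)
    qed
    have "PiM I (\<lambda>_. \<nu>) = distr S (PiM I (\<lambda>_. \<nu>)) (\<lambda>\<omega>. restrict \<omega> I)"
      by (rule distr_PiM_restrict_finite[symmetric]) (auto simp: I_def)
    then have "(\<integral>\<^sup>+x. ennreal (w x) \<partial>PiM I (\<lambda>_. \<nu>)) = (\<integral>\<^sup>+x. ennreal (w x) \<partial>distr S (PiM I (\<lambda>_. \<nu>)) (\<lambda>\<omega>. restrict \<omega> I))"
      by simp
    also have "\<dots> = (\<integral>\<^sup>+\<omega>. ennreal (w (restrict \<omega> I)) \<partial>S)"
      by (intro nn_integral_distr measurable_restrict_subset) auto
    also have "\<dots> = (\<integral>\<^sup>+\<omega>. ennreal (w \<omega>) \<partial>S)" by (simp only: w_restrict)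
    finally show ?thesis .
  qed
  also have "\<dots> = ennreal (\<integral>\<omega>. w \<omega> \<partial>S)"
    using w0 integrable_staying_weight[OF \<alpha>] unfolding w_def by (intro nn_integral_eq_integral) auto
  also have "ennreal (l ^ n * exp (- \<alpha> * u)) * \<dots> = ennreal (l ^ n * exp (- \<alpha> * u) * (\<integral>\<omega>. w \<omega> \<partial>S))"
    using l by (intro ennreal_mult'[symmetric]) auto
  finally have "ennreal (measure M {\<omega>\<in>space M. first_passage X u \<omega> = enat n}) =
      ennreal (l ^ n * exp (- \<alpha> * u) * (\<integral>\<omega>. w \<omega> \<partial>S))"
    by (simp add: emeasure_M)
  then show ?thesis
    using l w0 by (simp add: w_def)
qed

section \<open>Moments of the tilted law\<close>

lemma nn_integral_exp_tilted:
  assumes [measurable_cong]: "sets \<mu> = sets borel" and l: "l > 0"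
  shows "(\<integral>\<^sup>+x. ennreal (exp (s * x)) \<partial>tilted \<mu> \<alpha> l) =
    (\<integral>\<^sup>+x. ennreal (exp ((\<alpha> + s) * x)) \<partial>\<mu>) / ennreal l"
proof -
  have "(\<integral>\<^sup>+x. ennreal (exp (s * x)) \<partial>tilted \<mu> \<alpha> l) = (\<integral>\<^sup>+x. ennreal (exp (\<alpha> * x) / l) * ennreal (exp (s * x)) \<partial>\<mu>)"
    unfolding tilted_def by (rule nn_integral_density) measurable
  also have "\<dots> = (\<integral>\<^sup>+x. ennreal (exp ((\<alpha> + s) * x)) / ennreal l \<partial>\<mu>)"
    using l by (intro nn_integral_cong)
      (simp add: ennreal_mult'[symmetric] divide_ennreal exp_add[symmetric] algebra_simps)
  also have "\<dots> = (\<integral>\<^sup>+x. ennreal (exp ((\<alpha> + s) * x)) \<partial>\<mu>) / ennreal l"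
    by (rule nn_integral_divide) measurable
  finally show ?thesis .
qed

text \<open>
  The tilted law and the original one have the same null sets.
\<close>

lemma nonlattice_tilted:
  assumes \<mu>: "real_distribution \<mu>" and l: "l > 0" "(\<integral>\<^sup>+x. ennreal (exp (\<alpha> * x)) \<partial>\<mu>) = ennreal l"
    and nl: "nonlattice \<mu>"
  shows "nonlattice (tilted \<mu> \<alpha> l)"
proof (rule ccontr)
  assume "\<not> ?thesis"
  then obtain a h where h: "h > 0" "measure (tilted \<mu> \<alpha> l) (range (\<lambda>k::int. a + h * of_int k)) = 1"
    unfolding nonlattice_def by blast
  interpret mu: real_distribution \<mu> by fact
  interpret nu: real_distribution "tilted \<mu> \<alpha> l" by (intro real_distribution_tilted l) simp
  let ?R = "range (\<lambda>k::int. a + h * of_int k)"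
  have R: "?R \<in> sets borel" by (rule sets.countable[rotated]) auto
  then have "AE x in tilted \<mu> \<alpha> l. x \<in> ?R" using h(2) nu.prob_eq_1[of ?R] by simp
  then have "AE x in \<mu>. x \<in> ?R" using l unfolding tilted_def by (subst (asm) AE_density) auto
  then show False using mu.AE_lattice_imp_not_nonlattice[OF h(1)] nl by blast
qed

lemma power3_le_exp:
  fixes z :: real assumes "z \<ge> 0" shows "z ^ 3 \<le> 27 * exp z"
proof -
  have "(z / 3) ^ 3 \<le> (1 + z / real 3) ^ 3" using assms by (intro power_mono) auto
  also have "\<dots> \<le> exp z" using assms by (intro exp_ge_one_plus_x_over_n_power_n) auto
  finally show ?thesis by (simp add: power_divide)
qed

lemma (in real_distribution) third_moment_of_exponential_moments:
  assumes "\<eta> > 0" "(\<integral>\<^sup>+x. ennreal (exp (\<eta> * x)) \<partial>M) < \<infinity>" "(\<integral>\<^sup>+x. ennreal (exp (- \<eta> * x)) \<partial>M) < \<infinity>"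
  shows "integrable M (\<lambda>x. \<bar>x\<bar> ^ 3)"
proof (rule Bochner_Integration.integrable_bound)
  have "integrable M (\<lambda>x. exp (\<eta> * x))" "integrable M (\<lambda>x. exp (- \<eta> * x))"
    using assms by (auto intro!: integrableI_bounded)
  then show "integrable M (\<lambda>x. 27 / \<eta> ^ 3 * (exp (\<eta> * x) + exp (- \<eta> * x)))" by simp
  show "AE x in M. norm (\<bar>x\<bar> ^ 3) \<le> norm (27 / \<eta> ^ 3 * (exp (\<eta> * x) + exp (- \<eta> * x)))"
  proof (rule AE_I2)
    fix x
    have "(\<eta> * \<bar>x\<bar>) ^ 3 \<le> 27 * exp (\<eta> * \<bar>x\<bar>)" using assms by (intro power3_le_exp) auto
    also have "exp (\<eta> * \<bar>x\<bar>) \<le> exp (\<eta> * x) + exp (- \<eta> * x)" by (cases "x \<ge> 0") auto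
    finally have "\<eta> ^ 3 * \<bar>x\<bar> ^ 3 \<le> 27 * (exp (\<eta> * x) + exp (- \<eta> * x))"
      by (simp add: power_mult_distrib)
    then have "\<bar>x\<bar> ^ 3 \<le> 27 * (exp (\<eta> * x) + exp (- \<eta> * x)) / \<eta> ^ 3"
      using assms by (simp add: pos_le_divide_eq mult.commute)
    moreover have "0 \<le> 27 * (exp (\<eta> * x) + exp (- \<eta> * x)) / \<eta> ^ 3" using assms by (simp add: add_nonneg_nonneg)
    ultimately show "norm (\<bar>x\<bar> ^ 3) \<le> norm (27 / \<eta> ^ 3 * (exp (\<eta> * x) + exp (- \<eta> * x)))"
      using assms(1) by (simp add: power_abs)
  qed
qed auto

text \<open>
  Jensen's inequality, by integrating the tangent exp(s m) (1 + s (x - m)) of exp(s x) at the mean m.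
\<close>

lemma (in real_distribution) exp_mean_le_mgf:
  assumes "integrable M (\<lambda>x. x)"
  shows "ennreal (exp (s * (LINT x|M. x))) \<le> (\<integral>\<^sup>+x. ennreal (exp (s * x)) \<partial>M)"
proof (cases "(\<integral>\<^sup>+x. ennreal (exp (s * x)) \<partial>M) < \<infinity>")
  case True
  define m where "m = (LINT x|M. x)"
  have int: "integrable M (\<lambda>x. exp (s * x))" using True by (auto intro!: integrableI_bounded)
  have "exp (s * m) = exp (s * m) * (LINT x|M. 1 + s * (x - m))"
    using assms prob_space by (simp add: m_def del: space_eq_univ)
  also have "\<dots> = (LINT x|M. exp (s * m) * (1 + s * (x - m)))" by simp
  also have "\<dots> \<le> (LINT x|M. exp (s * x))"
  proof (rule integral_mono)
    show "integrable M (\<lambda>x. exp (s * m) * (1 + s * (x - m)))" using assms by simp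
    fix x
    have "exp (s * m) * (1 + s * (x - m)) \<le> exp (s * m) * exp (s * (x - m))"
      by (intro mult_left_mono exp_ge_add_one_self) auto
    also have "\<dots> = exp (s * x)" by (simp add: exp_add[symmetric] algebra_simps)
    finally show "exp (s * m) * (1 + s * (x - m)) \<le> exp (s * x)" .
  qed (rule int)
  finally have "ennreal (exp (s * m)) \<le> ennreal (LINT x|M. exp (s * x))" by (rule ennreal_leI)
  then show ?thesis using int by (simp add: m_def nn_integral_eq_integral)
next
  case False then show ?thesis by (simp add: less_top[symmetric])
qed

text \<open>
  By Jensen's inequality K s - s m, with m the mean, has a minimum at s = 0, so its derivative
  vanishes there.  This avoids differentiating under the integral sign.
\<close>

lemma (in real_distribution) mean_eq_deriv_cgf:
  assumes int: "integrable M (\<lambda>x. x)" and \<eta>: "\<eta> > 0"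
    and K: "\<And>s. \<bar>s\<bar> < \<eta> \<Longrightarrow> (\<integral>\<^sup>+x. ennreal (exp (s * x)) \<partial>M) = ennreal (exp (K s))"
    and K0: "K 0 = 0" and deriv: "(K has_real_derivative d) (at 0)"
  shows "(LINT x|M. x) = d"
proof -
  let ?m = "LINT x|M. x"
  have "d - ?m = 0"
  proof (rule DERIV_local_min)
    show "((\<lambda>s. K s - s * ?m) has_real_derivative d - ?m) (at 0)"
      by (auto intro!: derivative_eq_intros deriv)
    show "0 < \<eta>" by fact
    show "\<forall>y. \<bar>0 - y\<bar> < \<eta> \<longrightarrow> K 0 - 0 * ?m \<le> K y - y * ?m"
    proof (intro allI impI)
      fix y assume "\<bar>0 - y\<bar> < \<eta>"
      then have "ennreal (exp (y * ?m)) \<le> ennreal (exp (K y))"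
        using exp_mean_le_mgf[OF int, of y] K[of y] by simp
      then show "K 0 - 0 * ?m \<le> K y - y * ?m" by (simp add: K0)
    qed
  qed
  then show ?thesis by simp
qed

text \<open>
  By convexity of the exponential function its chords from 0 have increasing slope.
\<close>

lemma exp_chord_le:
  fixes x :: real assumes "0 < s" "s \<le> t"
  shows "x \<le> (exp (s * x) - 1) / s" "(exp (s * x) - 1) / s \<le> (exp (t * x) - 1) / t"
proof -
  have "s * x \<le> exp (s * x) - 1" using exp_ge_add_one_self[of "s * x"] by linarith
  then show "x \<le> (exp (s * x) - 1) / s" using assms by (simp add: pos_le_divide_eq mult.commute)
  define p where "p = s / t"
  have p: "0 \<le> p" "p \<le> 1" using assms by (auto simp: p_def)
  have "exp ((1 - p) *\<^sub>R 0 + p *\<^sub>R (t * x)) \<le> (1 - p) * exp 0 + p * exp (t * x)"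
    using convex_onD[OF exp_convex, of p 0 "t * x"] p by auto
  then have "exp (s * x) \<le> 1 + p * (exp (t * x) - 1)"
    using assms by (simp add: p_def algebra_simps)
  then show "(exp (s * x) - 1) / s \<le> (exp (t * x) - 1) / t"
    using assms by (simp add: p_def field_simps)
qed

text \<open>
  At the boundary point 0 of the domain only the inequality from Jensen would be available, so here
  the difference quotients are passed to the limit.  They are dominated since they lie between x and
  the slope of the chord up to t.
\<close>

lemma (in real_distribution) right_deriv_mgf_at_0:
  assumes int: "integrable M (\<lambda>x. x)" and s0: "s0 > 0"
    and L: "\<And>s. s \<in> {0..<s0} \<Longrightarrow> (\<integral>\<^sup>+x. ennreal (exp (s * x)) \<partial>M) = ennreal (L s)"
      "\<And>s. s \<in> {0..<s0} \<Longrightarrow> L s \<ge> 0"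
    and deriv: "(L has_real_derivative d) (at 0 within {0..<s0})"
  shows "d = (LINT x|M. x)"
proof -
  define t where "t = s0 / 2"
  define s where "s n = t / real (Suc n)" for n
  have t: "0 < t" "t < s0" using s0 by (auto simp: t_def)
  have s: "0 < s n" "s n \<le> t" for n using t by (auto simp: s_def field_simps)
  have s_lim: "s \<longlonglongrightarrow> 0" unfolding s_def by real_asymp
  have exp_int: "integrable M (\<lambda>x. exp (z * x))" if "z \<in> {0..<s0}" for z
    using L[OF that] by (auto intro!: integrableI_bounded)
  have LI: "L z = (LINT x|M. exp (z * x))" if "z \<in> {0..<s0}" for z
    using L[OF that] exp_int[OF that] by (simp add: nn_integral_eq_integral integral_nonneg_AE)
  have inS: "s n \<in> {0..<s0}" for n using s[of n] t by auto
  have "((\<lambda>z. (L z - L 0) / (z - 0)) \<longlongrightarrow> d) (at 0 within {0..<s0})"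
    using deriv by (simp add: has_field_derivative_iff)
  moreover have "filterlim s (at 0 within {0..<s0}) sequentially"
    using s_lim inS s by (auto simp: filterlim_at intro!: always_eventually less_imp_neq[symmetric])
  ultimately have quot: "(\<lambda>n. (L (s n) - L 0) / (s n - 0)) \<longlonglongrightarrow> d" by (rule filterlim_compose)
  have quot_eq: "(L (s n) - L 0) / (s n - 0) = (LINT x|M. (exp (s n * x) - 1) / s n)" for n
  proof -
    have "L 0 = 1" using LI[of 0] s0 prob_space by (simp del: space_eq_univ)
    moreover have "(LINT x|M. (exp (s n * x) - 1) / s n) = ((LINT x|M. exp (s n * x)) - 1) / s n"
      using exp_int[OF inS[of n]] prob_space by (simp add: Bochner_Integration.integral_diff del: space_eq_univ)
    ultimately show ?thesis by (simp only: LI[OF inS] diff_zero)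
  qed
  have mean: "(\<lambda>n. LINT x|M. (exp (s n * x) - 1) / s n) \<longlonglongrightarrow> (LINT x|M. x)"
  proof (rule integral_dominated_convergence[where w="\<lambda>x. \<bar>x\<bar> + (exp (t * x) + 1) / t"])
    show "integrable M (\<lambda>x. \<bar>x\<bar> + (exp (t * x) + 1) / t)"
      using int exp_int[of t] t by auto
    show "AE x in M. (\<lambda>n. (exp (s n * x) - 1) / s n) \<longlonglongrightarrow> x"
    proof (rule AE_I2)
      fix x
      have "((\<lambda>z. exp (z * x)) has_real_derivative exp (0 * x) * x) (at 0)"
        by (auto intro!: derivative_eq_intros)
      then have "((\<lambda>z. (exp (z * x) - exp (0 * x)) / (z - 0)) \<longlongrightarrow> exp (0 * x) * x) (at 0)"
        by (simp only: has_field_derivative_iff)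
      moreover have "filterlim s (at 0) sequentially"
        using s_lim s by (auto simp: filterlim_at intro!: always_eventually less_imp_neq[symmetric])
      ultimately have "(\<lambda>n. (exp (s n * x) - exp (0 * x)) / (s n - 0)) \<longlonglongrightarrow> exp (0 * x) * x"
        by (rule filterlim_compose)
      then show "(\<lambda>n. (exp (s n * x) - 1) / s n) \<longlonglongrightarrow> x" by simp
    qed
    show "AE x in M. norm ((exp (s n * x) - 1) / s n) \<le> \<bar>x\<bar> + (exp (t * x) + 1) / t" for n
    proof (rule AE_I2)
      fix x
      have "(exp (t * x) - 1) / t \<le> (exp (t * x) + 1) / t" "0 \<le> (exp (t * x) + 1) / t"
        using t by (auto simp: divide_right_mono add_nonneg_nonneg)
      then show "norm ((exp (s n * x) - 1) / s n) \<le> \<bar>x\<bar> + (exp (t * x) + 1) / t"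
        using exp_chord_le[OF s(1)[of n] s(2)[of n], of x] unfolding real_norm_def by linarith
    qed
  qed auto
  show ?thesis by (rule LIMSEQ_unique[OF quot]) (simp only: quot_eq mean)
qed

section \<open>The exact asymptotics\<close>

lemma contracting_walkI:
  assumes "real_distribution \<nu>" "nonlattice \<nu>" "integrable \<nu> (\<lambda>x. \<bar>x\<bar> ^ 3)" "(LINT x|\<nu>. x) = \<rho>" "\<rho> > 0"
    "0 < t" "t < \<beta>" "(\<integral>\<^sup>+x. ennreal (exp (- t * x)) \<partial>\<nu>) < 1"
  shows "contracting_walk \<nu> \<rho> (sqrt (LINT x|\<nu>. (x - \<rho>)\<^sup>2)) \<beta> t"
proof -
  interpret nu: real_distribution \<nu> by fact
  show ?thesis by unfold_locales (use assms in \<open>auto intro!: integral_nonneg_AE\<close>)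
qed

lemma floor_ratio_tendsto:
  fixes \<rho> :: real and U :: "nat \<Rightarrow> real"
  assumes "\<rho> > 0" "filterlim U at_top sequentially"
  shows "filterlim (\<lambda>i. nat \<lfloor>U i / \<rho>\<rfloor>) at_top sequentially"
    "(\<lambda>i. sqrt (U i) / sqrt (real (nat \<lfloor>U i / \<rho>\<rfloor>))) \<longlonglongrightarrow> sqrt \<rho>"
proof -
  have "filterlim (\<lambda>v::real. v / \<rho>) at_top at_top" using assms(1) by real_asymp
  from filterlim_compose[OF this assms(2)]
  have div: "filterlim (\<lambda>i. U i / \<rho>) at_top sequentially" .
  have "filterlim (\<lambda>v::real. nat \<lfloor>v\<rfloor>) at_top at_top" by real_asymp
  from filterlim_compose[OF this div]
  show N: "filterlim (\<lambda>i. nat \<lfloor>U i / \<rho>\<rfloor>) at_top sequentially" .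
  have "((\<lambda>v::real. sqrt (\<rho> * v) / sqrt (real (nat \<lfloor>v\<rfloor>))) \<longlongrightarrow> sqrt \<rho>) at_top"
    using assms(1) by (real_asymp simp: powr_half_sqrt)
  from filterlim_compose[OF this div] assms(1)
  show "(\<lambda>i. sqrt (U i) / sqrt (real (nat \<lfloor>U i / \<rho>\<rfloor>))) \<longlonglongrightarrow> sqrt \<rho>" by simp
qed

text \<open>
  The derivative at alpha = 0 would be the mean of X_1, which is negative; hence rho > 0 forces
  alpha > 0.  Consequently alpha is an interior point of D and the tilted law has exponential moments on
  both sides, the mean rho, and E[exp(- t X)] = lam(alpha - t) / lam(alpha) < 1 for small t > 0
  because Lambda increases at alpha.
\<close>

theorem theorem2p3:
  fixes M :: "'a measure" and X :: "nat \<Rightarrow> 'a \<Rightarrow> real"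
    and s0 \<alpha> \<rho> \<xi> :: real
  defines "lam \<equiv> mgf M (X 1)"
    and "\<Lambda> \<equiv> cgf M (X 1)"
  defines "\<alpha>bar \<equiv> legendre_transform \<Lambda> \<rho> / ereal \<rho>"
  assumes "prob_space M"
    and indep: "prob_space.indep_vars M (\<lambda>_. borel) X {1..}"
    and ident: "\<And>i. i \<ge> 1 \<Longrightarrow> distr M borel (X i) = distr M borel (X 1)"
    and nonlattice: "nonlattice (distr M borel (X 1))"
    and mean: "integrable M (X 1)" "prob_space.expectation M (X 1) < 0"
    and "s0 > 0"
    and mgf_finite: "\<And>s. s \<in> {0..<s0} \<Longrightarrow> lam s < \<infinity>"
    and "\<alpha> \<in> {0..<s0}"
    and deriv: "((\<lambda>s. real_of_ereal (\<Lambda> s)) has_real_derivative \<rho>) (at \<alpha> within {0..<s0})"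
    and "\<rho> > 0"
    and "\<xi> > 0" and "lam (\<alpha> + \<xi>) < \<infinity>"
  shows "\<alpha>bar = ereal (\<alpha> - real_of_ereal (\<Lambda> \<alpha>) / \<rho>) \<and>
    (\<exists>C::real. C > 0 \<and>
      (\<lambda>u::real. prob_space.prob M
          {\<omega> \<in> space M. first_passage X u \<omega> = enat (nat \<lfloor>u / \<rho>\<rfloor>)})
      \<sim>[at_top]
      (\<lambda>u. C * enn2real (lam \<alpha>) powr (- frac (u / \<rho>)) *
            (exp (- u * real_of_ereal \<alpha>bar) / sqrt u)))"
proof -
  interpret prob_space M by fact
  have X1[measurable]: "X 1 \<in> borel_measurable M" using mean(1) by auto
  define \<mu> where "\<mu> = distr M borel (X 1)"
  interpret mu: real_distribution \<mu> unfolding \<mu>_def by (rule real_distribution_distr) measurable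
  have lam_eq: "lam s = (\<integral>\<^sup>+x. ennreal (exp (s * x)) \<partial>\<mu>)" for s
    unfolding lam_def mgf_def \<mu>_def by (subst nn_integral_distr[OF X1]) simp_all
  have mu_int: "integrable \<mu> (\<lambda>x. x)" and mu_mean: "(LINT x|\<mu>. x) < 0"
    using mean unfolding \<mu>_def by (simp_all only: integrable_distr_eq[OF X1] integral_distr[OF X1] measurable_ident_sets)
  have lam_pos: "0 < lam s" for s
    using mu.exp_mean_le_mgf[OF mu_int, of s] unfolding lam_eq by (rule less_le_trans[rotated]) simp
  define L where "L s = enn2real (lam s)" for s
  have L: "lam s = ennreal (L s)" "L s > 0" "\<Lambda> s = ereal (ln (L s))" if "lam s < \<infinity>" for s
  proof -
    show "lam s = ennreal (L s)" using that by (simp add: L_def)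
    show "L s > 0" using that lam_pos[of s] by (simp add: L_def enn2real_positive_iff)
    show "\<Lambda> s = ereal (ln (L s))" using that unfolding \<Lambda>_def cgf_def lam_def[symmetric] by (simp add: L_def)
  qed
  note LD = L[OF mgf_finite]
  have \<alpha>_D: "\<alpha> \<in> {0..<s0}" by fact
  have deriv_L: "((\<lambda>s. ln (L s)) has_real_derivative \<rho>) (at \<alpha> within {0..<s0})"
    by (rule has_field_derivative_transform_within[OF deriv zero_less_one \<alpha>_D]) (simp add: LD)
  have "\<alpha> > 0"
  proof (rule ccontr)
    assume "\<not> \<alpha> > 0"
    then have "\<alpha> = 0" using \<alpha>_D by simp
    have "L 0 = 1" using mu.emeasure_space_1 by (simp add: L_def lam_eq)
    have "((\<lambda>s. exp (ln (L s))) has_real_derivative exp (ln (L \<alpha>)) * \<rho>) (at \<alpha> within {0..<s0})"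
      by (rule DERIV_chain2[OF DERIV_exp deriv_L])
    then have "(L has_real_derivative exp (ln (L \<alpha>)) * \<rho>) (at \<alpha> within {0..<s0})"
      by (rule has_field_derivative_transform_within[OF _ zero_less_one \<alpha>_D]) (simp add: LD)
    then have "(L has_real_derivative \<rho>) (at 0 within {0..<s0})"
      using \<open>L 0 = 1\<close> \<open>\<alpha> = 0\<close> by simp
    then have "\<rho> = (LINT x|\<mu>. x)"
      by (intro mu.right_deriv_mgf_at_0[OF mu_int \<open>s0 > 0\<close>]) (auto simp: lam_eq[symmetric] LD less_imp_le)
    then show False using mu_mean \<open>\<rho> > 0\<close> by simp
  qed
  have deriv_at: "((\<lambda>s. ln (L s)) has_real_derivative \<rho>) (at \<alpha>)"
  proof -
    have "((\<lambda>s. ln (L s)) has_real_derivative \<rho>) (at \<alpha> within {0<..<s0})"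
      by (rule DERIV_subset[OF deriv_L]) auto
    then show ?thesis using \<open>\<alpha> > 0\<close> \<alpha>_D by (subst (asm) at_within_open) auto
  qed
  define l where "l = L \<alpha>"
  have l: "l > 0" "(\<integral>\<^sup>+x. ennreal (exp (\<alpha> * x)) \<partial>\<mu>) = ennreal l"
    using LD[OF \<alpha>_D] by (simp_all add: l_def lam_eq[symmetric])
  define \<nu> where "\<nu> = tilted \<mu> \<alpha> l"
  have nu: "real_distribution \<nu>" unfolding \<nu>_def by (intro real_distribution_tilted l) simp
  interpret nu: real_distribution \<nu> by (rule nu)
  have mgf_nu: "(\<integral>\<^sup>+x. ennreal (exp (s * x)) \<partial>\<nu>) = lam (\<alpha> + s) / ennreal l" for s
    unfolding \<nu>_def lam_eq using l by (intro nn_integral_exp_tilted) auto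
  define \<eta> where "\<eta> = min \<alpha> (s0 - \<alpha>)"
  have "\<eta> > 0" using \<open>\<alpha> > 0\<close> \<alpha>_D by (simp add: \<eta>_def)
  have near: "\<alpha> + s \<in> {0..<s0}" if "\<bar>s\<bar> < \<eta>" for s using that by (auto simp: \<eta>_def)
  have mgf_nu_near: "(\<integral>\<^sup>+x. ennreal (exp (s * x)) \<partial>\<nu>) = ennreal (exp (ln (L (\<alpha> + s)) - ln l))" if "\<bar>s\<bar> < \<eta>" for s
    using LD[OF near[OF that]] l by (simp add: mgf_nu divide_ennreal exp_diff)
  have third: "integrable \<nu> (\<lambda>x. \<bar>x\<bar> ^ 3)"
    using mgf_nu_near[of "\<eta> / 2"] mgf_nu_near[of "- (\<eta> / 2)"] \<open>\<eta> > 0\<close>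
    by (intro nu.third_moment_of_exponential_moments[of "\<eta> / 2"]) auto
  have nu_int: "integrable \<nu> (\<lambda>x. x)" using nu.integrable_moments_le_3[OF third, of 1] by simp
  have nu_mean: "(LINT x|\<nu>. x) = \<rho>"
  proof (rule nu.mean_eq_deriv_cgf[OF nu_int \<open>\<eta> > 0\<close> mgf_nu_near])
    have "((\<lambda>s. ln (L (\<alpha> + s))) has_real_derivative \<rho>) (at 0)"
      using deriv_at DERIV_shift[of "\<lambda>s. ln (L s)" \<rho> 0 \<alpha>] by (simp add: add.commute)
    from DERIV_diff[OF this DERIV_const[of "ln l"]]
    show "((\<lambda>s. ln (L (\<alpha> + s)) - ln l) has_real_derivative \<rho>) (at 0)" by simp
  qed (auto simp: l_def)
  have tangent: "ereal (s * \<rho>) - \<Lambda> s \<le> ereal (\<alpha> * \<rho> - ln l)" for s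
  proof (cases "lam s < \<infinity>")
    case True
    have "ennreal (exp ((s - \<alpha>) * \<rho>)) \<le> lam s / ennreal l"
      using nu.exp_mean_le_mgf[OF nu_int, of "s - \<alpha>"] by (simp add: nu_mean mgf_nu)
    also have "\<dots> = ennreal (exp (ln (L s) - ln l))"
      using L[OF True] l by (simp add: divide_ennreal exp_diff)
    finally show ?thesis using L(3)[OF True] by (simp add: algebra_simps)
  next
    case False
    then show ?thesis by (simp add: \<Lambda>_def cgf_def lam_def less_top[symmetric])
  qed
  have "legendre_transform \<Lambda> \<rho> = ereal (\<alpha> * \<rho> - ln l)"
    unfolding legendre_transform_def
  proof (rule SUP_eqI)
    fix y assume "\<And>s. s \<in> UNIV \<Longrightarrow> ereal (s * \<rho>) - \<Lambda> s \<le> y"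
    from this[of \<alpha>] show "ereal (\<alpha> * \<rho> - ln l) \<le> y" by (simp add: LD[OF \<alpha>_D] l_def)
  qed (rule tangent)
  then have \<alpha>bar: "\<alpha>bar = ereal (\<alpha> - ln l / \<rho>)"
    using \<open>\<rho> > 0\<close> by (simp add: \<alpha>bar_def diff_divide_distrib)
  obtain d where d: "d > 0" "\<And>h. 0 < h \<Longrightarrow> h < d \<Longrightarrow> ln (L (\<alpha> - h)) < ln (L \<alpha>)"
    using DERIV_pos_inc_left[OF deriv_at \<open>\<rho> > 0\<close>] by blast
  define t where "t = min d \<eta> / 2"
  have t: "0 < t" "t < d" "t < \<eta>" using d \<open>\<eta> > 0\<close> by (auto simp: t_def)
  have "contracting_walk \<nu> \<rho> (sqrt (LINT x|\<nu>. (x - \<rho>)\<^sup>2)) \<alpha> t"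
  proof (rule contracting_walkI[OF nu _ third nu_mean \<open>\<rho> > 0\<close> t(1)])
    show "Defs.nonlattice \<nu>"
      unfolding \<nu>_def using nonlattice by (intro nonlattice_tilted l mu.real_distribution_axioms) (simp add: \<mu>_def)
    show "t < \<alpha>" using t(3) by (simp add: \<eta>_def)
    have "(\<integral>\<^sup>+x. ennreal (exp (- t * x)) \<partial>\<nu>) = ennreal (exp (ln (L (\<alpha> - t)) - ln l))"
      using mgf_nu_near[of "- t"] t by simp
    also have "\<dots> < 1" using d(2)[OF t(1,2)] by (simp add: l_def)
    finally show "(\<integral>\<^sup>+x. ennreal (exp (- t * x)) \<partial>\<nu>) < 1" .
  qed
  from contracting_walk.staying_weight_limit[OF this]
  obtain c where c: "c > 0" "\<And>N u B. filterlim N at_top sequentially \<Longrightarrow> (\<And>i. \<bar>u i - real (N i) * \<rho>\<bar> \<le> B) \<Longrightarrow>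
     (\<lambda>i. sqrt (N i) * (\<integral>\<omega>. staying_weight \<alpha> (N i) (N i) (u i) \<omega> \<partial>PiM UNIV (\<lambda>_. \<nu>))) \<longlonglongrightarrow> c"
    by blast
  define n where "n u = nat \<lfloor>u / \<rho>\<rfloor>" for u
  define J where "J u = (\<integral>\<omega>. staying_weight \<alpha> (n u) (n u) u \<omega> \<partial>PiM UNIV (\<lambda>_. \<nu>))" for u
  define C where "C = sqrt \<rho> * c"
  have "C > 0" using c \<open>\<rho> > 0\<close> by (simp add: C_def)
  have J_lim: "((\<lambda>u. sqrt u * J u) \<longlongrightarrow> C) at_top"
  proof (rule tendsto_at_topI_sequentially)
    fix U :: "nat \<Rightarrow> real" assume U: "filterlim U at_top sequentially"
    \<comment> \<open>The floor is close to its argument for nonnegative levels only, hence the truncation.\<close>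
    define V where "V i = max 0 (U i)" for i
    have "eventually (\<lambda>i. 0 \<le> U i) sequentially"
      using U eventually_ge_at_top[of 0] unfolding filterlim_iff by blast
    then have UV: "eventually (\<lambda>i. U i = V i) sequentially"
      by eventually_elim (simp add: V_def)
    have V: "filterlim V at_top sequentially"
      using filterlim_cong[OF refl refl UV] U by simp
    have "\<bar>V i - real (n (V i)) * \<rho>\<bar> \<le> \<rho>" for i
    proof -
      have "V i / \<rho> \<ge> 0" using \<open>\<rho> > 0\<close> by (simp add: V_def)
      then have "real (n (V i)) = of_int \<lfloor>V i / \<rho>\<rfloor>" by (simp add: n_def)
      then have "\<bar>V i / \<rho> - real (n (V i))\<bar> \<le> 1" by linarith
      then have "\<bar>V i / \<rho> - real (n (V i))\<bar> * \<rho> \<le> 1 * \<rho>" using \<open>\<rho> > 0\<close> by (intro mult_right_mono) auto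
      also have "\<bar>V i / \<rho> - real (n (V i))\<bar> * \<rho> = \<bar>(V i / \<rho> - real (n (V i))) * \<rho>\<bar>"
        using \<open>\<rho> > 0\<close> by (simp add: abs_mult)
      also have "(V i / \<rho> - real (n (V i))) * \<rho> = V i - real (n (V i)) * \<rho>"
        using \<open>\<rho> > 0\<close> by (simp add: left_diff_distrib)
      finally show ?thesis by simp
    qed
    moreover have N: "filterlim (\<lambda>i. n (V i)) at_top sequentially"
      unfolding n_def by (rule floor_ratio_tendsto[OF \<open>\<rho> > 0\<close> V])
    ultimately have "(\<lambda>i. sqrt (n (V i)) * J (V i)) \<longlonglongrightarrow> c"
      unfolding J_def by (intro c(2))
    then have "(\<lambda>i. sqrt (V i) / sqrt (n (V i)) * (sqrt (n (V i)) * J (V i))) \<longlonglongrightarrow> sqrt \<rho> * c"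
      unfolding n_def by (intro tendsto_mult floor_ratio_tendsto[OF \<open>\<rho> > 0\<close> V])
    moreover have "eventually (\<lambda>i. n (V i) > 0) sequentially"
      using N eventually_gt_at_top[of 0] unfolding filterlim_iff by blast
    then have "eventually (\<lambda>i. sqrt (V i) / sqrt (n (V i)) * (sqrt (n (V i)) * J (V i)) = sqrt (U i) * J (U i)) sequentially"
      using UV by eventually_elim simp
    ultimately show "(\<lambda>i. sqrt (U i) * J (U i)) \<longlonglongrightarrow> C"
      unfolding C_def by (rule Lim_transform_eventually)
  qed
  define g where "g u = C * enn2real (lam \<alpha>) powr (- frac (u / \<rho>)) *
            (exp (- u * real_of_ereal \<alpha>bar) / sqrt u)" for u
  have "(\<lambda>u. prob {\<omega> \<in> space M. first_passage X u \<omega> = enat (nat \<lfloor>u / \<rho>\<rfloor>)}) \<sim>[at_top] g"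
  proof (rule asymp_equivI')
    have "((\<lambda>u. (sqrt u * J u) / C) \<longlongrightarrow> C / C) at_top"
      using \<open>C > 0\<close> by (intro tendsto_divide J_lim tendsto_const) auto
    then have "((\<lambda>u. (sqrt u * J u) / C) \<longlongrightarrow> 1) at_top" using \<open>C > 0\<close> by simp
    moreover have "eventually (\<lambda>u. (sqrt u * J u) / C =
        prob {\<omega> \<in> space M. first_passage X u \<omega> = enat (nat \<lfloor>u / \<rho>\<rfloor>)} / g u) at_top"
      using eventually_ge_at_top[of \<rho>]
    proof eventually_elim
      case (elim u)
      then have u: "u > 0" "u / \<rho> \<ge> 1" using \<open>\<rho> > 0\<close> by auto
      have n1: "n u \<ge> 1" using u(2) unfolding n_def by linarith
      have n_real: "real (n u) = u / \<rho> - frac (u / \<rho>)" using u by (simp add: n_def frac_def)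
      have "l ^ n u = l powr (u / \<rho> - frac (u / \<rho>))"
        using l n_real by (simp add: powr_realpow[symmetric])
      also have "\<dots> = exp (ln l * (u / \<rho>)) * l powr (- frac (u / \<rho>))"
        using l by (simp add: powr_def exp_add[symmetric] algebra_simps)
      finally have "l ^ n u * exp (- \<alpha> * u) = l powr (- frac (u / \<rho>)) * exp (- u * (\<alpha> - ln l / \<rho>))"
        by (simp add: exp_add[symmetric] algebra_simps)
      moreover have "prob {\<omega> \<in> space M. first_passage X u \<omega> = enat (n u)} = l ^ n u * exp (- \<alpha> * u) * J u"
        unfolding J_def \<nu>_def \<mu>_def
        by (rule prob_first_passage_eq[OF indep ident l(1) l(2)[unfolded \<mu>_def] less_imp_le[OF \<open>\<alpha> > 0\<close>] n1])
      moreover define A where "A = l powr (- frac (u / \<rho>))"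
      moreover define E where "E = exp (- u * (\<alpha> - ln l / \<rho>))"
      ultimately have P: "prob {\<omega> \<in> space M. first_passage X u \<omega> = enat (n u)} = A * E * J u" by simp
      have G: "g u = C * A * (E / sqrt u)"
        unfolding g_def A_def E_def by (simp add: \<alpha>bar l_def L_def)
      have "A > 0" "E > 0" "sqrt u > 0" using l u by (simp_all add: A_def E_def)
      then have "sqrt u * J u / C = A * E * J u / (C * A * (E / sqrt u))"
        using \<open>C > 0\<close> by (simp add: divide_simps)
      then show ?case using P G by (simp only: n_def)
    qed
    ultimately show "((\<lambda>u. prob {\<omega> \<in> space M. first_passage X u \<omega> = enat (nat \<lfloor>u / \<rho>\<rfloor>)} / g u) \<longlongrightarrow> 1) at_top"
      by (rule Lim_transform_eventually)
  qed
  then have "\<exists>C::real. C > 0 \<and>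
      (\<lambda>u::real. prob {\<omega> \<in> space M. first_passage X u \<omega> = enat (nat \<lfloor>u / \<rho>\<rfloor>)})
      \<sim>[at_top]
      (\<lambda>u. C * enn2real (lam \<alpha>) powr (- frac (u / \<rho>)) *
            (exp (- u * real_of_ereal \<alpha>bar) / sqrt u))"
    using \<open>C > 0\<close> unfolding g_def by blast
  moreover have "\<alpha>bar = ereal (\<alpha> - real_of_ereal (\<Lambda> \<alpha>) / \<rho>)"
    using \<alpha>bar LD[OF \<alpha>_D] by (simp add: l_def)
  ultimately show ?thesis by blast
qed

end
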